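(* Let $W_1,W_2,\dots$ be i.i.d. with law $\lambda_0\in\mathcal{P}(\mathcal{W})$, let $\hat x^n_i$ be measurable functions such that $(\hat x^n_1(\vec w),\dots,\hat x^n_n(\vec w))$ is a Nash equilibrium with type vector $\vec w$ for every $\vec w\in\mathcal{W}^n$, and $\mu_n=\frac1n\sum_{i=1}^n\delta_{(W_i,\hat x^n_i(W_1,\dots,W_n))}$. Let $A\subset\mathcal{P}(\mathcal{W}\times\mathcal{X})$ be measurable and define $$I(A):=\inf\{H(\lambda|\lambda_0):\lambda\ll\lambda_0,\ \overline{A}\cap\mathcal{M}(\lambda)\ne\emptyset\},\qquad S(A):=\{m\in\overline{A}\cap\mathcal{M}:H(m^w|\lambda_0)=I(A)\}.$$ Suppose $I(A)<\infty$. Then $S(A)$ is nonempty and compact. Assume moreover that $$I(A)=\inf\{H(\lambda|\lambda_0):\lambda\ll\lambda_0,\ \mathcal{M}(\lambda)\subset A^\circ\}$$ and that $\mathbb{P}(\mu_n\in A)>0$ for all sufficiently large $n$. Then, for any metric $d$ on $\mathcal{P}(\mathcal{W}\times\mathcal{X})$ compatible with weak convergence and every $\epsilon>0$, there exists $c>0$ such that for all sufficiently large $n$, $$\mathbb{P}(d(\mu_n,S(A))\ge\epsilon\mid\mu_n\in A)\le e^{-cn}.$$ In particular, every limit point of the conditional laws of $\mu_n$ given $\{\mu_n\in A\}$ is supported on $S(A)$, and if $S(A)=\{\nu\}$ is a singleton these conditional laws converge to the point mass at $\nu$. Finally, if $\mathcal{M}(\lambda)$ is a singleton for every $\lambda\ll\lambda_0$,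 then the displayed assumption on $I(A)$ is equivalent to $$I(A)=\inf_{m\in\overline{A}\cap\mathcal{M}}H(m^w|\lambda_0)=\inf_{m\in A^\circ\cap\mathcal{M}}H(m^w|\lambda_0).$$
   Context: Standing assumptions: $\mathcal{X}$ compact metric space, $\mathcal{W}$ complete separable metric space; $\mathcal{P}(S)$ = Borel probability measures on $S$ with the weak topology. $\mathcal{C}$ maps $w$ to a nonempty closed $\mathcal{C}(w)\subset\mathcal{X}$, continuous in the sense that $\mathrm{Gr}(\mathcal{C})=\{(w,x):x\in\mathcal{C}(w)\}$ is closed and whenever $w_n\to w$, $x\in\mathcal{C}(w)$ there exist $n_k$ and $x_{n_k}\in\mathcal{C}(w_{n_k})$ with $x_{n_k}\to x$. $F:\mathcal{P}(\mathcal{W}\times\mathcal{X})\times\mathcal{W}\times\mathcal{X}\to\mathbb{R}$ bounded continuous. A Nash equilibrium with type vector $(w_1,\dots,w_n)$ is $(x_1,\dots,x_n)$ with $x_i\in\mathcal{C}(w_i)$ and $F(\frac1n\sum_k\delta_{(w_k,x_k)},w_i,x_i)=\inf_{y\in\mathcal{C}(w_i)}F(\frac1n\sum_{k\ne i}\delta_{(w_k,x_k)}+\frac1n\delta_{(w_i,y)},w_i,y)$ for all $i$; such equilibria are assumed to exist for all $n$ and type vectors. $m^w$ = first marginal. $\mathcal{M}(\lambda)$ = set of $m$ with $m^w=\lambda$ and, for $m$-a.e. $(w,x)$, $x\in\mathcal{C}(w)$ and $F(m,w,x)=\inf_{y\in\mathcal{C}(w)}F(m,w,y)$; $\mathcal{M}=\bigcup_\lambda\mathcal{M}(\lambda)$.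 $H$ is relative entropy ($+\infty$ unless absolutely continuous). $d(\mu,S)=\inf_{m\in S}d(\mu,m)$. $\inf\emptyset=\infty$. *)

theory Defs
  imports "HOL-Probability.Probability"
begin

definition borel_of :: "'a topology \<Rightarrow> 'a measure" where
  "borel_of X = sigma (topspace X) {U. openin X U}"

definition probs_on :: "'a topology \<Rightarrow> 'a measure set" where
  "probs_on X = {m. prob_space m \<and> sets m = sets (borel_of X)}"

definition bcont :: "'a topology \<Rightarrow> ('a \<Rightarrow> real) set" where
  "bcont X = {f. continuous_map X euclideanreal f \<and> bounded (f ` topspace X)}"

text \<open>The weak topology on P(S): the coarsest topology making all maps
  m \<mapsto> integral of f w.r.t. m (f bounded continuous) continuous.\<close>
definition weak_top :: "'a topology \<Rightarrow> 'a measure topology" where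
  "weak_top X = pullback_topology (probs_on X)
      (\<lambda>m. restrict (\<lambda>f. \<integral>x. f x \<partial>m) (bcont X))
      (product_topology (\<lambda>_. euclideanreal) (bcont X))"

text \<open>H(lam | lam0) in [0, infinity]; +infinity unless lam << lam0.
  With f = d lam / d lam0, H = integral of f ln f w.r.t. lam0 (positive part minus negative part;
  the negative part is bounded by 1/e).\<close>
definition relent :: "'a measure \<Rightarrow> 'a measure \<Rightarrow> ereal" where
  "relent lam0 lam =
     (if absolutely_continuous lam0 lam \<and> sets lam = sets lam0 then
        (let f = (\<lambda>x. enn2real (RN_deriv lam0 lam x)) in
           enn2ereal (\<integral>\<^sup>+x. ennreal (f x * ln (f x)) \<partial>lam0)
         - enn2ereal (\<integral>\<^sup>+x. ennreal (- (f x * ln (f x))) \<partial>lam0))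
      else \<infinity>)"

definition emp :: "nat \<Rightarrow> (nat \<Rightarrow> 'w::topological_space) \<Rightarrow> (nat \<Rightarrow> 'x::topological_space)
     \<Rightarrow> ('w \<times> 'x) measure" where
  "emp n w x = distr (measure_pmf (pmf_of_set {..<n})) borel (\<lambda>k. (w k, x k))"

definition nash ::
  "(('w \<times> 'x) measure \<Rightarrow> 'w::topological_space \<Rightarrow> 'x::topological_space \<Rightarrow> real) \<Rightarrow>
   ('w \<Rightarrow> 'x set) \<Rightarrow> nat \<Rightarrow> (nat \<Rightarrow> 'w) \<Rightarrow> (nat \<Rightarrow> 'x) \<Rightarrow> bool" where
  "nash F C n w x \<longleftrightarrow>
     (\<forall>i<n. x i \<in> C (w i) \<and>
        F (emp n w x) (w i) (x i) = (INF y\<in>C (w i). F (emp n w (x(i := y))) (w i) y))"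

definition MFE :: "(('w \<times> 'x) measure \<Rightarrow> 'w::topological_space \<Rightarrow> 'x::topological_space \<Rightarrow> real)
     \<Rightarrow> ('w \<Rightarrow> 'x set) \<Rightarrow> 'w measure \<Rightarrow> ('w \<times> 'x) measure set" where
  "MFE F C lam = {m \<in> probs_on euclidean. distr m borel fst = lam \<and>
      (AE p in m. snd p \<in> C (fst p) \<and> F m (fst p) (snd p) = (INF y\<in>C (fst p). F m (fst p) y))}"

definition MFE_all :: "(('w \<times> 'x) measure \<Rightarrow> 'w::topological_space \<Rightarrow> 'x::topological_space \<Rightarrow> real)
     \<Rightarrow> ('w \<Rightarrow> 'x set) \<Rightarrow> ('w \<times> 'x) measure set" where
  "MFE_all F C = (\<Union>lam\<in>probs_on euclidean. MFE F C lam)"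

definition rate_cl :: "(('w \<times> 'x) measure \<Rightarrow> 'w::topological_space \<Rightarrow> 'x::topological_space \<Rightarrow> real)
     \<Rightarrow> ('w \<Rightarrow> 'x set) \<Rightarrow> 'w measure \<Rightarrow> ('w \<times> 'x) measure set \<Rightarrow> ereal" where
  "rate_cl F C lam0 A = (INF lam\<in>{lam \<in> probs_on euclidean. absolutely_continuous lam0 lam \<and>
        (weak_top euclidean closure_of A) \<inter> MFE F C lam \<noteq> {}}. relent lam0 lam)"

definition rate_int :: "(('w \<times> 'x) measure \<Rightarrow> 'w::topological_space \<Rightarrow> 'x::topological_space \<Rightarrow> real)
     \<Rightarrow> ('w \<Rightarrow> 'x set) \<Rightarrow> 'w measure \<Rightarrow> ('w \<times> 'x) measure set \<Rightarrow> ereal" where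
  "rate_int F C lam0 A = (INF lam\<in>{lam \<in> probs_on euclidean. absolutely_continuous lam0 lam \<and>
        MFE F C lam \<subseteq> weak_top euclidean interior_of A}. relent lam0 lam)"

definition minset :: "(('w \<times> 'x) measure \<Rightarrow> 'w::topological_space \<Rightarrow> 'x::topological_space \<Rightarrow> real)
     \<Rightarrow> ('w \<Rightarrow> 'x set) \<Rightarrow> 'w measure \<Rightarrow> ('w \<times> 'x) measure set \<Rightarrow> ('w \<times> 'x) measure set" where
  "minset F C lam0 A = {m \<in> (weak_top euclidean closure_of A) \<inter> MFE_all F C.
        relent lam0 (distr m borel fst) = rate_cl F C lam0 A}"

text \<open>mu_n(omega) = (1/n) sum_{i<n} delta_(W_i, xhat^n_i(W_1..W_n)); type vectors in W^n are
  represented as extensional functions on {..<n}.\<close>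
definition mu_n :: "(nat \<Rightarrow> 'o \<Rightarrow> 'w::topological_space) \<Rightarrow> (nat \<Rightarrow> nat \<Rightarrow> (nat \<Rightarrow> 'w) \<Rightarrow> 'x::topological_space)
     \<Rightarrow> nat \<Rightarrow> 'o \<Rightarrow> ('w \<times> 'x) measure" where
  "mu_n W xh n \<omega> = emp n (\<lambda>k. W k \<omega>) (\<lambda>i. xh n i (restrict (\<lambda>k. W k \<omega>) {..<n}))"

definition cond_law :: "'o measure \<Rightarrow> 'a topology \<Rightarrow> ('o \<Rightarrow> 'a) \<Rightarrow> 'o set \<Rightarrow> 'a measure" where
  "cond_law Pr T X E = distr (uniform_measure Pr E) (borel_of T) X"

end

theory Submission
  imports Defs
begin

text \<open>
  By Donsker and Varadhan, H(lam|lam0) is the supremum of the integral of f under lam minus the logarithm of the integral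
  of exp f under lam0, over bounded continuous f. So the sublevel sets of H(-|lam0) are closed; they are also uniformly
  tight, hence compact by Prokhorov, and a minimizing sequence over the closed set of equilibria has a limit.

  For the conditional limit, cover an exponentially tight compact set by small open sets. Near an equilibrium m
  whose first marginal has large entropy, Chernoff's inequality for a nearly optimal f bounds the probability that the
  empirical measure falls there. Near a measure that is not an equilibrium, there are no empirical measures of
  Nash equilibria at all once n is large: some player would have a profitable deviation. This gives the upper bound
  without passing through Sanov's theorem. Applied with lam in place of lam0 and level 0, the same bound
  shows that under lam the empirical measures lie in a given open neighbourhood of M(lam) with probability tending
  to 1; tensorizing the entropy inequality to n samples and testing it on the indicator of this event converts that
  into the lower bound exp(-n(H(lam|lam0) + d)) under lam0, for every d > 0.
\<close>

subsection \<open>The weak topology\<close>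

text \<open>The weak topology has to be iterated: conditional laws of \<open>mu_n\<close> are
  measures on \<open>weak_top euclidean\<close>, which is a topology without a distinguished metric.
  It is therefore treated as an initial topology, and arguments on measures that would use sequences
  become arguments on open covers and finitely many test integrals. Compactness comes from
  Tychonoff's theorem; the limit functional is represented by a Caratheodory construction in which
  tightness takes the place of local compactness. The countability properties of the action space
  all stem from its compactness, which is why countable bases of open boxes recur in the
  measurability proofs. Two margins decide the final estimate: the upper bound has an exponent
  strictly above the entropy level, because a finite cover has a least exponent, and the lower bound
  loses an arbitrarily small amount. What is left between them is the rate \<open>c\<close>.
  Densities of n-fold product laws never occur; the variational inequality for bounded measurable
  test functions replaces them.\<close>

lemma borel_of_euclidean [simp]: "borel_of euclidean = borel"
  unfolding borel_of_def borel_def by simp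

lemma sets_borel_of: "sets (borel_of X) = sigma_sets (topspace X) {U. openin X U}"
  unfolding borel_of_def by (rule sets_measure_of) (auto dest: openin_subset)

lemma space_borel_of [simp]: "space (borel_of X) = topspace X"
  unfolding borel_of_def by (rule space_measure_of) (auto dest: openin_subset)

lemma openin_borel_of: "openin X U \<Longrightarrow> U \<in> sets (borel_of X)"
  unfolding sets_borel_of by (auto intro: sigma_sets.Basic)

lemma closedin_borel_of:
  assumes "closedin X U" shows "U \<in> sets (borel_of X)"
proof -
  have "U = topspace X - (topspace X - U)"
    using closedin_subset[OF assms] by auto
  moreover have "topspace X - U \<in> sets (borel_of X)"
    using assms by (intro openin_borel_of) auto
  ultimately show ?thesis
    by (metis sets.compl_sets space_borel_of)
qed

lemma measurable_borel_of:
  assumes "f \<in> space M \<rightarrow> topspace X"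
    and "\<And>U. openin X U \<Longrightarrow> f -` U \<inter> space M \<in> sets M"
  shows "f \<in> measurable M (borel_of X)"
  unfolding borel_of_def using assms
  by (intro measurable_measure_of) (auto dest: openin_subset)

lemma continuous_map_borel_measurable:
  assumes "continuous_map X euclidean f"
  shows "f \<in> borel_measurable (borel_of X)"
proof -
  have "f \<in> measurable (borel_of X) (borel_of euclidean)"
  proof (rule measurable_borel_of)
    show "f \<in> space (borel_of X) \<rightarrow> topspace euclidean" by simp
    fix U :: "'b set" assume "openin euclidean U"
    then have "openin X {x \<in> topspace X. f x \<in> U}"
      using assms by (simp add: continuous_map_def)
    then show "f -` U \<inter> space (borel_of X) \<in> sets (borel_of X)"
      by (auto dest!: openin_borel_of simp: vimage_def Int_def conj_commute)
  qed
  then show ?thesis by simp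
qed

lemma bcont_euclidean: "f \<in> bcont euclidean \<longleftrightarrow> continuous_on UNIV f \<and> bounded (range f)"
  unfolding bcont_def by simp

lemma probs_on_euclidean: "m \<in> probs_on euclidean \<longleftrightarrow> prob_space m \<and> sets m = sets borel"
  unfolding probs_on_def by simp

lemma topspace_weak_top [simp]: "topspace (weak_top X) = probs_on X"
  unfolding weak_top_def topspace_pullback_topology by auto

lemma bcont_bounded:
  assumes "f \<in> bcont X"
  obtains B where "B > 0" "\<And>x. x \<in> topspace X \<Longrightarrow> \<bar>f x\<bar> \<le> B"
proof -
  obtain B where "\<And>x. x \<in> topspace X \<Longrightarrow> \<bar>f x\<bar> \<le> B"
    using assms unfolding bcont_def bounded_iff by (auto simp: real_norm_def)
  then have "\<And>x. x \<in> topspace X \<Longrightarrow> \<bar>f x\<bar> \<le> max B 1" by (meson max.coboundedI1)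
  then show ?thesis by (intro that[of "max B 1"]) auto
qed

lemma bcont_borel_measurable:
  assumes "f \<in> bcont X" "sets m = sets (borel_of X)"
  shows "f \<in> borel_measurable m"
  using continuous_map_borel_measurable[of X f] assms
  by (simp add: bcont_def measurable_cong_sets[OF assms(2) refl])

lemma bcont_integrable:
  assumes "f \<in> bcont X" "m \<in> probs_on X"
  shows "integrable m f"
proof -
  interpret prob_space m using assms unfolding probs_on_def by auto
  obtain B where "B > 0" and B: "\<And>x. x \<in> topspace X \<Longrightarrow> \<bar>f x\<bar> \<le> B"
    using bcont_bounded[OF assms(1)] by metis
  have *: "sets m = sets (borel_of X)" using assms unfolding probs_on_def by auto
  have "space m = topspace X" using sets_eq_imp_space_eq[OF *] by simp
  then show ?thesis
    using bcont_borel_measurable[OF assms(1) *] B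
    by (intro integrable_const_bound[of _ B]) auto
qed

lemma continuous_map_integral:
  assumes "f \<in> bcont X"
  shows "continuous_map (weak_top X) euclideanreal (\<lambda>m. \<integral>x. f x \<partial>m)"
proof -
  have "continuous_map (product_topology (\<lambda>_. euclideanreal) (bcont X)) euclideanreal (\<lambda>z. z f)"
    by (rule continuous_map_product_projection[OF assms])
  then have "continuous_map (weak_top X) euclideanreal ((\<lambda>z. z f) \<circ> (\<lambda>m. restrict (\<lambda>f. \<integral>x. f x \<partial>m) (bcont X)))"
    unfolding weak_top_def by (rule continuous_map_pullback)
  then show ?thesis using assms by (simp add: o_def)
qed

text \<open>An open set of a product topology constrains only finitely many coordinates, so the
  least of finitely many radii serves as a common \<epsilon>. This is the form in which weak
  openness is exploited from here on.\<close>

lemma weak_top_nbhd: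
  assumes "openin (weak_top X) U" "m \<in> U"
  obtains J \<epsilon> where "finite J" "J \<subseteq> bcont X" "\<epsilon> > 0"
    "\<And>m'. m' \<in> probs_on X \<Longrightarrow> (\<And>f. f \<in> J \<Longrightarrow> \<bar>(\<integral>x. f x \<partial>m') - (\<integral>x. f x \<partial>m)\<bar> < \<epsilon>) \<Longrightarrow> m' \<in> U"
proof -
  define \<Psi> :: "'a measure \<Rightarrow> _" where "\<Psi> = (\<lambda>m. restrict (\<lambda>f. \<integral>x. f x \<partial>m) (bcont X))"
  obtain V where V: "openin (product_topology (\<lambda>_. euclideanreal) (bcont X)) V" and U: "U = \<Psi> -` V \<inter> probs_on X"
    using assms(1) unfolding weak_top_def openin_pullback_topology \<Psi>_def by auto
  have "\<Psi> m \<in> V" using assms U by auto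
  with V[unfolded openin_product_topology_alt topspace_euclidean, THEN bspec]
  have "\<exists>O'. finite {i \<in> bcont X. O' i \<noteq> UNIV} \<and> (\<forall>i\<in>bcont X. openin euclideanreal (O' i)) \<and>
      \<Psi> m \<in> PiE (bcont X) O' \<and> PiE (bcont X) O' \<subseteq> V" .
  then obtain O' where O': "finite {i \<in> bcont X. O' i \<noteq> UNIV}" "\<And>i. i \<in> bcont X \<Longrightarrow> open (O' i)"
      "\<Psi> m \<in> PiE (bcont X) O'" "PiE (bcont X) O' \<subseteq> V"
    unfolding open_openin[symmetric] by blast
  define J where "J = {i \<in> bcont X. O' i \<noteq> UNIV}"
  have "\<exists>e>0. \<forall>y. \<bar>y - (\<integral>x. f x \<partial>m)\<bar> < e \<longrightarrow> y \<in> O' f" if "f \<in> J" for f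
  proof -
    have "open (O' f)" "(\<integral>x. f x \<partial>m) \<in> O' f"
      using O'(2)[of f] O'(3) that by (auto simp: J_def \<Psi>_def PiE_def Pi_def)
    then show ?thesis unfolding open_dist dist_real_def by metis
  qed
  then obtain e where e: "\<And>f. f \<in> J \<Longrightarrow> e f > 0"
      "\<And>f y. f \<in> J \<Longrightarrow> \<bar>y - (\<integral>x. f x \<partial>m)\<bar> < e f \<Longrightarrow> y \<in> O' f" by metis
  \<comment> \<open>The inserted 1 keeps the minimum defined and positive when \<open>J\<close> is
    empty.\<close>
  define \<epsilon> where "\<epsilon> = Min (insert 1 (e ` J))"
  have fin: "finite J" using O'(1) by (simp add: J_def)
  have "\<epsilon> > 0" using fin e(1) by (auto simp: \<epsilon>_def)
  have le: "\<epsilon> \<le> e f" if "f \<in> J" for f using fin that by (auto simp: \<epsilon>_def)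
  show ?thesis
  proof (rule that[OF fin _ \<open>\<epsilon> > 0\<close>])
    show "J \<subseteq> bcont X" by (auto simp: J_def)
    fix m' assume m': "m' \<in> probs_on X" "\<And>f. f \<in> J \<Longrightarrow> \<bar>(\<integral>x. f x \<partial>m') - (\<integral>x. f x \<partial>m)\<bar> < \<epsilon>"
    have "(\<integral>x. f x \<partial>m') \<in> O' f" if "f \<in> bcont X" for f
      using m'(2)[of f] e(2)[of f] le[of f] that by (cases "f \<in> J") (force simp: J_def)+
    then have "\<Psi> m' \<in> PiE (bcont X) O'" by (auto simp: \<Psi>_def)
    then show "m' \<in> U" using O'(4) m'(1) U by auto
  qed
qed

section \<open>Closure properties of bounded continuous functions\<close>

lemma bcont_add: "f \<in> bcont euclidean \<Longrightarrow> g \<in> bcont euclidean \<Longrightarrow> (\<lambda>x. f x + g x) \<in> bcont euclidean"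
  unfolding bcont_euclidean by (auto intro!: continuous_intros bounded_plus_comp)

lemma bcont_cmult: "f \<in> bcont euclidean \<Longrightarrow> (\<lambda>x. c * f x) \<in> bcont euclidean"
  for f :: "'a::topological_space \<Rightarrow> real"
  unfolding bcont_euclidean
  using bounded_scaleR_comp[of f UNIV c] by (auto intro!: continuous_intros)

lemma bcont_const: "(\<lambda>x. c) \<in> bcont euclidean"
  unfolding bcont_euclidean by (auto intro!: continuous_intros)

lemma bcont_uminus: "f \<in> bcont euclidean \<Longrightarrow> (\<lambda>x. - f x) \<in> bcont euclidean"
  for f :: "'a::topological_space \<Rightarrow> real"
  using bcont_cmult[of f "-1"] by simp

lemma bcont_diff: "f \<in> bcont euclidean \<Longrightarrow> g \<in> bcont euclidean \<Longrightarrow> (\<lambda>x. f x - g x) \<in> bcont euclidean"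
  for f :: "'a::topological_space \<Rightarrow> real"
  using bcont_add[OF _ bcont_uminus, of f g] by simp

lemma bcontI:
  assumes "continuous_on UNIV f" "\<And>x. \<bar>f x\<bar> \<le> B"
  shows "f \<in> bcont euclidean"
  using assms unfolding bcont_euclidean bounded_iff by (auto simp: real_norm_def)

lemma bcont_sum: "(\<And>i. i \<in> I \<Longrightarrow> f i \<in> bcont euclidean) \<Longrightarrow> (\<lambda>x. \<Sum>i\<in>I. f i x) \<in> bcont euclidean"
  for f :: "'i \<Rightarrow> 'a::topological_space \<Rightarrow> real"
  by (induction I rule: infinite_finite_induct) (auto intro: bcont_add bcont_const)

lemma bcont_max: "f \<in> bcont euclidean \<Longrightarrow> g \<in> bcont euclidean \<Longrightarrow> (\<lambda>x. max (f x) (g x)) \<in> bcont euclidean"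
  for f :: "'a::topological_space \<Rightarrow> real"
proof -
  assume f: "f \<in> bcont euclidean" and g: "g \<in> bcont euclidean"
  obtain B where B: "\<And>x. \<bar>f x\<bar> \<le> B" using bcont_bounded[OF f] by auto
  obtain D where D: "\<And>x. \<bar>g x\<bar> \<le> D" using bcont_bounded[OF g] by auto
  show ?thesis
  proof (rule bcontI)
    show "continuous_on UNIV (\<lambda>x. max (f x) (g x))"
      using f g by (auto simp: bcont_euclidean intro!: continuous_intros)
    show "\<bar>max (f x) (g x)\<bar> \<le> max B D" for x using B[of x] D[of x] by linarith
  qed
qed

lemma bcont_min: "f \<in> bcont euclidean \<Longrightarrow> g \<in> bcont euclidean \<Longrightarrow> (\<lambda>x. min (f x) (g x)) \<in> bcont euclidean"
  for f :: "'a::topological_space \<Rightarrow> real"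
  using bcont_uminus[OF bcont_max[OF bcont_uminus[of f] bcont_uminus[of g]]]
  by (simp add: minus_max_eq_min)

text \<open>The truncated distance to the complement of \<open>G\<close> has all these properties,
  except when the complement is empty: \<open>infdist\<close> to the empty set is 0, so
  \<open>G = UNIV\<close> is treated with the constant 1.\<close>

lemma open_indicator_approx:
  fixes G :: "'a::metric_space set"
  assumes "open G"
  obtains u where "continuous_on UNIV u" "\<And>x. 0 \<le> u x" "\<And>x. u x \<le> (1::real)" "\<And>x. u x > 0 \<longleftrightarrow> x \<in> G"
proof (cases "G = UNIV")
  case True
  show ?thesis by (rule that[of "\<lambda>_. 1"]) (use True in auto)
next
  case False
  then have ne: "- G \<noteq> {}" by auto
  have cl: "closed (- G)" using assms by auto
  show ?thesis
  proof (rule that[of "\<lambda>x. min 1 (infdist x (- G))"])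
    show "continuous_on UNIV (\<lambda>x. min 1 (infdist x (- G)))"
      by (intro continuous_intros)
    show "(min 1 (infdist x (- G)) > 0) \<longleftrightarrow> x \<in> G" for x
      using in_closed_iff_infdist_zero[OF cl ne, of x] infdist_nonneg[of x "- G"] by auto
  qed (auto simp: infdist_nonneg)
qed

subsection \<open>Representation of tight functionals and compactness\<close>

text \<open>The setting of a Riesz-Daniell representation on a space that need not be locally
  compact. \<open>L_tight\<close> speaks only of functions vanishing on \<open>K j\<close>, because
  a condition on integrals of continuous functions survives a pointwise limit of functionals. The
  bound \<open>1 / Suc j\<close> is one convenient sequence tending to 0.\<close>

locale tight_mean =
  fixes L :: "('s::metric_space \<Rightarrow> real) \<Rightarrow> real" and K :: "nat \<Rightarrow> 's set"
  assumes L_add: "f \<in> bcont euclidean \<Longrightarrow> g \<in> bcont euclidean \<Longrightarrow> L (\<lambda>x. f x + g x) = L f + L g"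
    and L_cmult: "f \<in> bcont euclidean \<Longrightarrow> L (\<lambda>x. c * f x) = c * L f"
    and L_nonneg: "f \<in> bcont euclidean \<Longrightarrow> (\<And>x. 0 \<le> f x) \<Longrightarrow> 0 \<le> L f"
    and L_one: "L (\<lambda>_. 1) = 1"
    and K_compact: "compact (K j)"
    and L_tight: "f \<in> bcont euclidean \<Longrightarrow> (\<And>x. 0 \<le> f x) \<Longrightarrow> (\<And>x. f x \<le> 1) \<Longrightarrow> (\<And>x. x \<in> K j \<Longrightarrow> f x = 0)
        \<Longrightarrow> L f \<le> 1 / real (Suc j)"
begin

lemma L_const: "L (\<lambda>_. c) = c"
  using L_cmult[OF bcont_const, of c 1] by (simp add: L_one)

lemma L_diff:
  assumes "f \<in> bcont euclidean" "g \<in> bcont euclidean"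
  shows "L (\<lambda>x. f x - g x) = L f - L g"
  using L_add[OF assms(1) bcont_uminus[OF assms(2)]] L_cmult[OF assms(2), of "-1"] by simp

lemma L_mono:
  assumes "f \<in> bcont euclidean" "g \<in> bcont euclidean" "\<And>x. f x \<le> g x"
  shows "L f \<le> L g"
  using L_nonneg[OF bcont_diff[OF assms(2,1)]] L_diff[OF assms(2,1)] assms(3) by simp

lemma L_sum:
  assumes "\<And>i. i \<in> I \<Longrightarrow> f i \<in> bcont euclidean"
  shows "L (\<lambda>x. \<Sum>i\<in>I. f i x) = (\<Sum>i\<in>I. L (f i))"
  using assms
proof (induction I rule: infinite_finite_induct)
  case (insert i I)
  then show ?case using L_add[OF _ bcont_sum, of "f i" I f] by simp
qed (use L_const[of 0] in auto)

definition tests :: "'s set \<Rightarrow> ('s \<Rightarrow> real) set" where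
  "tests G = {f \<in> bcont euclidean. \<forall>x. 0 \<le> f x \<and> f x \<le> 1 \<and> (x \<notin> G \<longrightarrow> f x = 0)}"

text \<open>The value that a representing measure is forced to take on an open set: the supremum of
  the integrals of continuous functions below its indicator.\<close>

definition open_mass :: "'s set \<Rightarrow> ennreal" where
  "open_mass G = (SUP f\<in>tests G. ennreal (L f))"

definition outer :: "'s set \<Rightarrow> ennreal" where
  "outer A = (INF G\<in>{G. open G \<and> A \<subseteq> G}. open_mass G)"

lemma tests_mono: "G \<subseteq> H \<Longrightarrow> tests G \<subseteq> tests H"
  unfolding tests_def by auto

lemma zero_tests: "(\<lambda>_. 0) \<in> tests G"
  unfolding tests_def by (auto intro: bcont_const)

lemma open_mass_mono: "G \<subseteq> H \<Longrightarrow> open_mass G \<le> open_mass H"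
  unfolding open_mass_def by (rule SUP_subset_mono[OF tests_mono]) auto

lemma outer_open: "open G \<Longrightarrow> outer G = open_mass G"
  unfolding outer_def by (rule antisym[OF INF_lower INF_greatest]) (auto intro: open_mass_mono)

lemma outer_mono: "A \<subseteq> B \<Longrightarrow> outer A \<le> outer B"
  unfolding outer_def by (rule INF_superset_mono) auto

lemma open_mass_le_1: "open_mass G \<le> 1"
  unfolding open_mass_def
proof (rule SUP_least)
  fix f assume "f \<in> tests G"
  then have "L f \<le> L (\<lambda>_. 1)" by (intro L_mono bcont_const) (auto simp: tests_def)
  then show "ennreal (L f) \<le> 1" by (simp add: L_one ennreal_le_1)
qed

text \<open>Countable subadditivity is the one point where tightness enters. A test function
  \<open>f\<close> of the union is at least \<delta> on a compact part of \<open>K j\<close>, which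
  finitely many of the \<open>G i\<close> cover; there a finite sum of test functions
  \<open>h i\<close> dominates \<open>f\<close>. What remains is at most \<delta> plus a function
  vanishing on \<open>K j\<close>, whose value under \<open>L\<close> is controlled by
  \<open>L_tight\<close>.\<close>

lemma open_mass_UN:
  fixes G :: "nat \<Rightarrow> 's set"
  assumes G: "\<And>i. open (G i)"
  shows "open_mass (\<Union>i. G i) \<le> (\<Sum>i. open_mass (G i))"
  unfolding open_mass_def[of "\<Union>i. G i"]
proof (rule SUP_least)
  fix f assume f: "f \<in> tests (\<Union>i. G i)"
  then have fb: "f \<in> bcont euclidean" and f01: "\<And>x. 0 \<le> f x" "\<And>x. f x \<le> 1"
    and f0: "\<And>x. (\<And>i. x \<notin> G i) \<Longrightarrow> f x = 0"
    by (auto simp: tests_def)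
  have fc: "continuous_on UNIV f" using fb by (simp add: bcont_euclidean)
  show "ennreal (L f) \<le> (\<Sum>i. open_mass (G i))"
  proof (rule ennreal_le_epsilon)
    fix e :: real assume "0 < e"
    then obtain j where j: "1 / real (Suc j) < e / 2"
      using nat_approx_posE[of "e/2"] by auto
    define \<delta> where "\<delta> = e / 2"
    have "\<delta> > 0" using \<open>0 < e\<close> by (simp add: \<delta>_def)
    have "\<forall>i. \<exists>u. continuous_on UNIV u \<and> (\<forall>x. 0 \<le> u x \<and> u x \<le> (1::real) \<and> (u x > 0 \<longleftrightarrow> x \<in> G i))"
      using open_indicator_approx[OF G] by metis
    then obtain u :: "nat \<Rightarrow> 's \<Rightarrow> real" where uc: "\<And>i. continuous_on UNIV (u i)"
      and u: "\<And>i x. 0 \<le> u i x" "\<And>i x. u i x \<le> 1" "\<And>i x. u i x > 0 \<longleftrightarrow> x \<in> G i"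
      by metis
    define Q where "Q = K j \<inter> {x. \<delta> \<le> f x}"
    have "closed {x. \<delta> \<le> f x}"
      by (intro closed_Collect_le continuous_intros fc)
    then have "compact Q" unfolding Q_def using K_compact by (simp add: compact_Int_closed)
    \<comment> \<open>\<open>N\<close> counts the sets used and is also the slope of the cut-offs,
      so \<open>V N\<close> increases with \<open>N\<close> and compactness of \<open>Q\<close>
      yields a single \<open>N\<close>.\<close>
    define V where "V N = (\<Union>i<N. {x. 1 < real N * u i x})" for N :: nat
    have Vo: "open (V N)" for N
      unfolding V_def by (intro open_UN ballI open_Collect_less continuous_intros uc)
    have "Q \<subseteq> (\<Union>N. V N)"
    proof
      fix x assume "x \<in> Q"
      then have "f x \<noteq> 0" using \<open>\<delta> > 0\<close> by (auto simp: Q_def)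
      then obtain i where "x \<in> G i" using f0 by blast
      then have "u i x > 0" using u by auto
      then obtain N0 where N0: "1 < real N0 * u i x" using reals_Archimedean3 by blast
      have "real N0 * u i x \<le> real (N0 + Suc i) * u i x" using u by (intro mult_right_mono) auto
      then have "x \<in> V (N0 + Suc i)" using N0 by (auto simp: V_def intro!: bexI[of _ i])
      then show "x \<in> (\<Union>N. V N)" by blast
    qed
    then obtain D where D: "finite D" "Q \<subseteq> (\<Union>N\<in>D. V N)"
      using compactE_image[OF \<open>compact Q\<close>, of UNIV V] Vo by auto
    define N where "N = Max (insert 0 D)"
    have VN: "V n \<subseteq> V N" if "n \<in> D" for n
    proof
      fix x assume "x \<in> V n"
      then obtain i where i: "i < n" "1 < real n * u i x" by (auto simp: V_def)
      have "n \<le> N" using that D by (simp add: N_def)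
      then have "real n * u i x \<le> real N * u i x" using u by (intro mult_right_mono) auto
      then show "x \<in> V N" using i \<open>n \<le> N\<close> by (auto simp: V_def intro!: bexI[of _ i])
    qed
    then have QN: "Q \<subseteq> V N" using D by blast
    define h where "h i x = min 1 (real N * u i x)" for i x
    have hb: "h i \<in> bcont euclidean" for i
      unfolding h_def using u
      by (intro bcontI[of _ 1] continuous_intros uc) (simp add: abs_of_nonneg)
    have hG: "h i \<in> tests (G i)" for i
    proof -
      have "u i x = 0" if "x \<notin> G i" for x
        using u(1)[of i x] u(3)[of i x] that by simp
      then show ?thesis
        using hb[of i] u(1)[of i] unfolding tests_def by (simp add: h_def)
    qed
    define r where "r x = max 0 (f x - \<delta> - (\<Sum>i<N. h i x))" for x
    have h0: "0 \<le> h i x" for i x using u by (simp add: h_def)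
    have rb: "r \<in> bcont euclidean"
      unfolding r_def by (intro bcont_max bcont_diff bcont_const fb bcont_sum hb)
    have r1: "r x \<le> 1" for x
      using f01(2)[of x] \<open>\<delta> > 0\<close> sum_nonneg[of "{..<N}" "\<lambda>i. h i x"] h0 by (auto simp: r_def)
    have rK: "r x = 0" if "x \<in> K j" for x
    proof (cases "\<delta> \<le> f x")
      case True
      then have "x \<in> V N" using that QN by (auto simp: Q_def)
      then obtain i where i: "i < N" "1 < real N * u i x" by (auto simp: V_def)
      then have "h i x = 1" by (simp add: h_def)
      then have "1 \<le> (\<Sum>i<N. h i x)"
        using member_le_sum[of i "{..<N}" "\<lambda>i. h i x"] i h0 by auto
      then show ?thesis using f01(2)[of x] \<open>\<delta> > 0\<close> by (auto simp: r_def)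
    next
      case False
      then show ?thesis using sum_nonneg[of "{..<N}" "\<lambda>i. h i x"] h0 by (auto simp: r_def)
    qed
    have Lr: "L r \<le> 1 / real (Suc j)"
      by (rule L_tight[OF rb _ r1 rK]) (auto simp: r_def)
    have "L f \<le> L (\<lambda>x. (\<delta> + (\<Sum>i<N. h i x)) + r x)"
      by (intro L_mono fb bcont_add bcont_const bcont_sum hb rb) (auto simp: r_def)
    also have "\<dots> = \<delta> + (\<Sum>i<N. L (h i)) + L r"
      by (simp add: L_add L_sum bcont_add bcont_const bcont_sum hb rb L_const)
    also have "\<dots> \<le> (\<Sum>i<N. L (h i)) + e" using Lr j by (simp add: \<delta>_def)
    finally have "ennreal (L f) \<le> ennreal ((\<Sum>i<N. L (h i)) + e)" by (rule ennreal_leI)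
    also have "\<dots> = (\<Sum>i<N. ennreal (L (h i))) + ennreal e"
      using L_nonneg[OF hb] h0 \<open>0 < e\<close> by (subst ennreal_plus) (auto intro!: sum_nonneg simp: sum_ennreal)
    also have "\<dots> \<le> (\<Sum>i<N. open_mass (G i)) + ennreal e"
      unfolding open_mass_def by (intro add_mono sum_mono SUP_upper hG) auto
    also have "\<dots> \<le> (\<Sum>i. open_mass (G i)) + ennreal e"
      by (intro add_mono sum_le_suminf) auto
    finally show "ennreal (L f) \<le> (\<Sum>i. open_mass (G i)) + ennreal e" .
  qed
qed

lemma outer_le_1: "outer A \<le> 1"
  by (metis (mono_tags) open_mass_le_1 outer_mono outer_open open_UNIV subset_UNIV order_trans)

lemma outer_empty: "outer {} = 0"
proof -
  have "open_mass {} \<le> 0"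
    unfolding open_mass_def
  proof (rule SUP_least)
    fix f assume "f \<in> tests {}"
    then have "f = (\<lambda>_. 0)" by (auto simp: tests_def)
    then show "ennreal (L f) \<le> 0" using L_const[of 0] by simp
  qed
  then show ?thesis by (simp add: outer_open)
qed

lemma outer_UN: "outer (\<Union>i. A i) \<le> (\<Sum>i. outer (A i))" for A :: "nat \<Rightarrow> 's set"
proof (rule ennreal_le_epsilon)
  fix e :: real assume "0 < e"
  have "\<exists>G. open G \<and> A i \<subseteq> G \<and> open_mass G < outer (A i) + ennreal (e * (1/2)^Suc i)" for i
  proof -
    have "outer (A i) < outer (A i) + ennreal (e * (1/2)^Suc i)"
      using outer_le_1[of "A i"] \<open>0 < e\<close> ennreal_add_left_cancel_less[of "outer (A i)" 0]
      by (auto simp: top_unique infinity_ennreal_def)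
    then show ?thesis
      unfolding outer_def[of "A i"] INF_less_iff by auto
  qed
  then obtain G where G: "\<And>i. open (G i)" "\<And>i. A i \<subseteq> G i"
    "\<And>i. open_mass (G i) < outer (A i) + ennreal (e * (1/2)^Suc i)" by metis
  have "outer (\<Union>i. A i) \<le> outer (\<Union>i. G i)" using G by (intro outer_mono) blast
  also have "\<dots> = open_mass (\<Union>i. G i)" using G by (intro outer_open) blast
  also have "\<dots> \<le> (\<Sum>i. open_mass (G i))" by (rule open_mass_UN[OF G(1)])
  also have "\<dots> \<le> (\<Sum>i. outer (A i) + ennreal (e * (1/2)^Suc i))"
    using G by (intro suminf_le) (auto intro: less_imp_le)
  also have "\<dots> = (\<Sum>i. outer (A i)) + (\<Sum>i. ennreal (e * (1/2)^Suc i))"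
    by (intro suminf_add[symmetric]) auto
  also have "(\<Sum>i. ennreal (e * (1/2)^Suc i)) = ennreal e"
    using \<open>0 < e\<close> sums_mult[OF power_half_series, of e] by (intro suminf_ennreal_eq) auto
  finally show "outer (\<Union>i. A i) \<le> (\<Sum>i. outer (A i)) + ennreal e" .
qed

lemma outer_measure_space: "outer_measure_space (Pow UNIV) outer"
  unfolding outer_measure_space_def positive_def increasing_def countably_subadditive_def
  using outer_empty outer_mono outer_UN by auto

text \<open>It suffices to split an open set \<open>U\<close>. A nearly optimal test function
  \<open>f\<close> of \<open>U \<inter> G\<close> is at least \<delta> only on a closed set
  \<open>T\<close> inside \<open>G\<close>, so \<open>U - T\<close> is open and contains
  \<open>U - G\<close>. Lowering \<open>f\<close> by \<delta> makes it vanish off \<open>T\<close>;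
  any test function of \<open>U - T\<close> can then be added, and the sum is still a test function
  of \<open>U\<close>.\<close>

lemma open_lambda_system:
  assumes "open G"
  shows "G \<in> lambda_system UNIV (Pow UNIV) outer"
proof -
  have sub: "outer (A \<inter> G) + outer (A - G) \<ge> outer A" for A
  proof -
    interpret sigma_algebra UNIV "Pow UNIV :: 's set set" by (rule sigma_algebra_Pow)
    have "subadditive (Pow UNIV) outer"
      using outer_measure_space countably_subadditive_subadditive
      unfolding outer_measure_space_def by blast
    then have "outer ((A \<inter> G) \<union> (A - G)) \<le> outer (A \<inter> G) + outer (A - G)"
      by (rule subadditiveD) auto
    then show ?thesis by (simp add: Int_Diff_Un)
  qed
  have main: "open_mass (U \<inter> G) + outer (U - G) \<le> open_mass U" if U: "open U" for U
  proof (rule ennreal_le_epsilon)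
    fix e :: real assume "0 < e"
    have "\<exists>f\<in>tests (U \<inter> G). open_mass (U \<inter> G) < ennreal (L f) + ennreal (e/2)"
    proof (rule ccontr)
      assume "\<not> ?thesis"
      then have *: "\<And>f. f \<in> tests (U \<inter> G) \<Longrightarrow> ennreal (L f) + ennreal (e/2) \<le> open_mass (U \<inter> G)" by force
      have "open_mass (U \<inter> G) + ennreal (e/2) = (SUP f\<in>tests (U \<inter> G). ennreal (L f) + ennreal (e/2))"
        unfolding open_mass_def using zero_tests by (subst ennreal_SUP_add_left) auto
      also have "\<dots> \<le> open_mass (U \<inter> G)" using * by (rule SUP_least)
      finally show False using open_mass_le_1[of "U \<inter> G"] \<open>0 < e\<close>
        by (metis ennreal_add_left_cancel_le add.right_neutral ennreal_eq_0_iff half_gt_zero_iff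
            ennreal_top_neq_one infinity_ennreal_def le_zero_eq linorder_not_le neq_top_trans)
    qed
    then obtain f where f: "f \<in> tests (U \<inter> G)" "open_mass (U \<inter> G) < ennreal (L f) + ennreal (e/2)" by auto
    then have fb: "f \<in> bcont euclidean" and f01: "\<And>x. 0 \<le> f x" "\<And>x. f x \<le> 1"
      and f0: "\<And>x. x \<notin> U \<inter> G \<Longrightarrow> f x = 0" by (auto simp: tests_def)
    define \<delta> where "\<delta> = e / 2"
    have \<delta>: "\<delta> > 0" using \<open>0 < e\<close> by (simp add: \<delta>_def)
    define f' where "f' x = max 0 (f x - \<delta>)" for x
    have f'b: "f' \<in> bcont euclidean" unfolding f'_def by (intro bcont_max bcont_diff bcont_const fb)
    define T where "T = {x. \<delta> \<le> f x}"
    have "closed T" unfolding T_def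
      using fb by (intro closed_Collect_le continuous_intros) (auto simp: bcont_euclidean)
    then have oUT: "open (U - T)" using U by auto
    have "U - G \<subseteq> U - T" using f0 \<delta> by (fastforce simp: T_def)
    then have "outer (U - G) \<le> open_mass (U - T)"
      using outer_mono outer_open[OF oUT] by metis
    moreover have "ennreal (L f) + open_mass (U - T) \<le> open_mass U + ennreal (e/2)"
    proof -
      have "ennreal (L f) + open_mass (U - T) = (SUP g\<in>tests (U - T). ennreal (L f) + ennreal (L g))"
        unfolding open_mass_def using zero_tests by (subst ennreal_SUP_add_right) auto
      also have "\<dots> \<le> open_mass U + ennreal (e/2)"
      proof (rule SUP_least)
        fix g assume g: "g \<in> tests (U - T)"
        then have gb: "g \<in> bcont euclidean" and g01: "\<And>x. 0 \<le> g x" "\<And>x. g x \<le> 1"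
          and g0: "\<And>x. x \<notin> U - T \<Longrightarrow> g x = 0" by (auto simp: tests_def)
        have t: "(\<lambda>x. f' x + g x) \<in> tests U"
        proof -
          have "f' x + g x \<le> 1" for x
            using f01(2)[of x] g01(2)[of x] g0[of x] \<delta> by (auto simp: f'_def T_def max_def)
          moreover have "f' x + g x = 0" if "x \<notin> U" for x
            using f0[of x] g0[of x] that \<delta> by (auto simp: f'_def)
          moreover have "0 \<le> f' x + g x" for x using g01(1)[of x] by (simp add: f'_def)
          ultimately show ?thesis unfolding tests_def by (auto intro: bcont_add f'b gb)
        qed
        have "L f \<le> L (\<lambda>x. f' x + \<delta>)"
          by (intro L_mono fb bcont_add f'b bcont_const) (auto simp: f'_def)
        then have "L f + L g \<le> L (\<lambda>x. f' x + g x) + e/2"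
          by (simp add: L_add f'b gb bcont_const L_const \<delta>_def)
        then have "ennreal (L f + L g) \<le> ennreal (L (\<lambda>x. f' x + g x) + e/2)" by (rule ennreal_leI)
        then have "ennreal (L f) + ennreal (L g) \<le> ennreal (L (\<lambda>x. f' x + g x)) + ennreal (e/2)"
          using L_nonneg[OF fb f01(1)] L_nonneg[OF gb g01(1)] L_nonneg[of "\<lambda>x. f' x + g x"] t \<open>0 < e\<close>
          by (simp add: ennreal_plus tests_def)
        also have "\<dots> \<le> open_mass U + ennreal (e/2)"
          unfolding open_mass_def by (intro add_mono SUP_upper t) auto
        finally show "ennreal (L f) + ennreal (L g) \<le> open_mass U + ennreal (e/2)" .
      qed
      finally show ?thesis .
    qed
    ultimately have "open_mass (U \<inter> G) + outer (U - G) \<le> open_mass U + ennreal (e/2) + ennreal (e/2)"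
    proof -
      have "open_mass (U \<inter> G) + outer (U - G) \<le> (ennreal (L f) + ennreal (e/2)) + open_mass (U - T)"
        using f(2) \<open>outer (U - G) \<le> open_mass (U - T)\<close> by (intro add_mono) auto
      also have "\<dots> = (ennreal (L f) + open_mass (U - T)) + ennreal (e/2)" by (simp add: ac_simps)
      also have "\<dots> \<le> (open_mass U + ennreal (e/2)) + ennreal (e/2)"
        using \<open>ennreal (L f) + open_mass (U - T) \<le> open_mass U + ennreal (e/2)\<close> by (rule add_right_mono)
      finally show ?thesis .
    qed
    also have "\<dots> = open_mass U + ennreal e"
      using \<open>0 < e\<close> by (simp add: add.assoc flip: ennreal_plus)
    finally show "open_mass (U \<inter> G) + outer (U - G) \<le> open_mass U + ennreal e" .
  qed
  have "outer (A \<inter> G) + outer (A - G) \<le> outer A" for A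
    unfolding outer_def[of A]
  proof (rule INF_greatest)
    fix U assume "U \<in> {U. open U \<and> A \<subseteq> U}"
    then have U: "open U" "A \<subseteq> U" by auto
    have "outer (A \<inter> G) + outer (A - G) \<le> outer (U \<inter> G) + outer (U - G)"
      using U by (intro add_mono outer_mono) auto
    then show "outer (A \<inter> G) + outer (A - G) \<le> open_mass U"
      using main[OF U(1)] U(1) assms by (simp add: outer_open open_Int)
  qed
  then have "outer (A \<inter> G) + outer (A - G) = outer A" for A using sub by (intro antisym) auto
  then have "outer (G \<inter> A) + outer ((UNIV - G) \<inter> A) = outer A" for A
    using Diff_eq[of A G] by (metis Compl_eq_Diff_UNIV Int_commute)
  then show ?thesis unfolding lambda_system_def by blast
qed

text \<open>After Caratheodory's theorem the integral is compared with \<open>L\<close> by cutting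
  \<open>n * f\<close> into \<open>n\<close> layers of height 1: the layer \<open>f' i\<close> is a
  test function of the set \<open>G i\<close> where \<open>n * f\<close> exceeds \<open>i\<close>,
  and the indicators of these sets add up to at most \<open>n * f + 1\<close>. Hence
  \<open>L f\<close> exceeds the integral by at most \<open>1 / n\<close> when \<open>f\<close> has
  values in [0,1]; applying this also to \<open>1 - f\<close> gives equality, and an affine change
  of scale covers all bounded \<open>f\<close>.\<close>

lemma representation:
  obtains m where "m \<in> probs_on euclidean" "\<And>f. f \<in> bcont euclidean \<Longrightarrow> (\<integral>x. f x \<partial>m) = L f"
proof -
  interpret sigma_algebra UNIV "Pow UNIV :: 's set set" by (rule sigma_algebra_Pow)
  have ms: "measure_space UNIV (lambda_system UNIV (Pow UNIV) outer) outer"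
    by (rule caratheodory_lemma[OF outer_measure_space])
  then have "sigma_algebra UNIV (lambda_system UNIV (Pow UNIV) outer)"
    by (simp add: measure_space_def)
  then have "sigma_sets UNIV {G. open G} \<subseteq> lambda_system UNIV (Pow UNIV) outer"
    using open_lambda_system by (intro sigma_algebra.sigma_sets_subset) blast+
  then have msb: "measure_space UNIV (sets borel) outer"
    using measure_down[OF ms, of "sets borel"] sets.sigma_algebra_axioms[of "borel :: 's measure"]
    by (simp add: borel_def)
  define m where "m = measure_of UNIV (sets borel) outer"
  have sm: "sets m = sets borel"
    unfolding m_def using sets.sigma_sets_eq[of "borel :: 's measure"] by (subst sets_measure_of) auto
  have em: "emeasure m B = outer B" if "B \<in> sets borel" for B
    using msb that unfolding m_def measure_space_def
    by (intro emeasure_measure_of_sigma) auto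
  have "outer UNIV = 1"
  proof (rule antisym[OF outer_le_1])
    have "(\<lambda>_. 1) \<in> tests UNIV" by (auto simp: tests_def bcont_const)
    then have "ennreal (L (\<lambda>_. 1)) \<le> open_mass UNIV" unfolding open_mass_def by (rule SUP_upper)
    then show "1 \<le> outer UNIV" by (simp add: outer_open L_one)
  qed
  then interpret m: prob_space m
    using em[of UNIV] sets_eq_imp_space_eq[OF sm] by (intro prob_spaceI) auto
  have mP: "m \<in> probs_on euclidean" using sm m.prob_space_axioms by (simp add: probs_on_euclidean)
  have le: "L f \<le> (\<integral>x. f x \<partial>m)" if fb: "f \<in> bcont euclidean" and f01: "\<And>x. 0 \<le> f x" "\<And>x. f x \<le> 1" for f
  proof (rule field_le_epsilon)
    fix e :: real assume "0 < e"
    then obtain n' where n': "1 / real (Suc n') < e" using nat_approx_posE by blast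
    define n where "n = Suc n'"
    define f' where "f' i x = max 0 (min 1 (real n * f x - real i))" for i :: nat and x
    have f'b: "f' i \<in> bcont euclidean" for i
      unfolding f'_def by (intro bcont_max bcont_min bcont_diff bcont_const bcont_cmult fb)
    have id1: "(\<Sum>i<k. max 0 (min 1 (t - real i))) = min t (real k)" if "0 \<le> t" for t k
      using that by (induction k) (auto simp: min_def max_def)
    have id2: "(\<Sum>i<k. of_bool (real i < t)) \<le> t + (1::real)" if "0 \<le> t" for t and k :: nat
    proof (induction k)
      case (Suc k)
      show ?case
      proof (cases "real k < t")
        case True
        have "(\<Sum>i<Suc k. of_bool (real i < t)) \<le> (\<Sum>i<Suc k. 1::real)" by (intro sum_mono) auto
        then show ?thesis using True by simp
      qed (use Suc in simp)
    qed (use that in auto)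
    define G where "G i = {x. real i < real n * f x}" for i :: nat
    have Go: "open (G i)" for i unfolding G_def
      using fb by (intro open_Collect_less continuous_intros) (auto simp: bcont_euclidean)
    have nf: "real n * f x = (\<Sum>i<n. f' i x)" for x
    proof -
      have "real n * f x \<le> real n" using f01(2)[of x] by (simp add: mult_left_le)
      then show ?thesis unfolding f'_def using id1[of "real n * f x" n] f01(1)[of x] by simp
    qed
    have "real n * L f = L (\<lambda>x. \<Sum>i<n. f' i x)" using L_cmult[OF fb, of "real n"] by (simp add: nf)
    also have "\<dots> = (\<Sum>i<n. L (f' i))" by (intro L_sum f'b)
    also have "\<dots> \<le> (\<Sum>i<n. m.prob (G i))"
    proof (rule sum_mono)
      fix i
      have "f' i \<in> tests (G i)" using f'b by (auto simp: tests_def f'_def G_def)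
      then have "ennreal (L (f' i)) \<le> open_mass (G i)" unfolding open_mass_def by (rule SUP_upper)
      also have "\<dots> = emeasure m (G i)" using Go by (simp add: em outer_open)
      finally have "ennreal (L (f' i)) \<le> ennreal (m.prob (G i))" by (simp add: m.emeasure_eq_measure)
      then show "L (f' i) \<le> m.prob (G i)" by simp
    qed
    also have "\<dots> = (\<integral>x. (\<Sum>i<n. indicator (G i) x) \<partial>m)"
      using Go sm by (subst Bochner_Integration.integral_sum) (auto simp: integrable_indicator_iff less_top[symmetric])
    also have "\<dots> \<le> (\<integral>x. real n * f x + 1 \<partial>m)"
    proof (rule integral_mono)
      show "integrable m (\<lambda>x. \<Sum>i<n. indicat_real (G i) x)"
        using Go sm by (intro Bochner_Integration.integrable_sum integrable_real_indicator) (auto simp: less_top[symmetric])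
      show "integrable m (\<lambda>x. real n * f x + 1)"
        using bcont_integrable[OF fb mP] by auto
      show "(\<Sum>i<n. indicat_real (G i) x) \<le> real n * f x + 1" for x
        using id2[of "real n * f x" n] f01(1)[of x] by (simp add: G_def indicator_def of_bool_def)
    qed
    also have "\<dots> = real n * (\<integral>x. f x \<partial>m) + 1"
      using bcont_integrable[OF fb mP] by (simp add: m.prob_space)
    finally have "L f \<le> (\<integral>x. f x \<partial>m) + 1 / real n"
      by (simp add: n_def field_simps)
    then show "L f \<le> (\<integral>x. f x \<partial>m) + e" using n' by (simp add: n_def)
  qed
  have eq01: "L f = (\<integral>x. f x \<partial>m)" if fb: "f \<in> bcont euclidean" and f01: "\<And>x. 0 \<le> f x" "\<And>x. f x \<le> 1" for f
  proof -
    have "L (\<lambda>x. 1 - f x) \<le> (\<integral>x. 1 - f x \<partial>m)"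
      using f01 by (intro le bcont_diff bcont_const fb) auto
    then have "1 - L f \<le> 1 - (\<integral>x. f x \<partial>m)"
      using bcont_integrable[OF fb mP] fb by (simp add: L_diff bcont_const L_one m.prob_space)
    then show ?thesis using le[OF that] by simp
  qed
  have "L f = (\<integral>x. f x \<partial>m)" if fb: "f \<in> bcont euclidean" for f
  proof -
    obtain B where B: "B > 0" "\<And>x. \<bar>f x\<bar> \<le> B" using bcont_bounded[OF fb] by auto
    define g where "g x = (1/(2*B)) * (f x + B)" for x
    have gb: "g \<in> bcont euclidean" unfolding g_def by (intro bcont_cmult bcont_add bcont_const fb)
    have "L g = (\<integral>x. g x \<partial>m)"
    proof (rule eq01[OF gb])
      show "0 \<le> g x" for x using B(2)[of x] B(1) by (auto simp: g_def)
      show "g x \<le> 1" for x using B(2)[of x] B(1) by (auto simp: g_def divide_simps)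
    qed
    moreover have "L g = (1/(2*B)) * (L f + B)"
      unfolding g_def by (subst L_cmult) (auto simp: L_add L_const fb bcont_const bcont_add)
    moreover have "(\<integral>x. g x \<partial>m) = (1/(2*B)) * ((\<integral>x. f x \<partial>m) + B)"
      unfolding g_def using bcont_integrable[OF fb mP] by (simp add: m.prob_space)
    ultimately show ?thesis using B(1) by simp
  qed
  then show ?thesis using mP by (intro that[of m]) auto
qed

end

text \<open>The integrals of a measure form a point of a product of compact intervals. A point of
  the closure of the image of \<open>S\<close> is a functional \<open>L\<close> matched by members
  of \<open>S\<close> on any finite set of test functions; if each such functional is integration
  against an element of \<open>S\<close>, the image is closed, hence compact.\<close>

lemma compactin_weak_top_I:
  assumes S: "S \<subseteq> probs_on X"
    and lim: "\<And>L. L \<in> extensional (bcont X) \<Longrightarrow>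
        (\<And>J \<epsilon>. finite J \<Longrightarrow> J \<subseteq> bcont X \<Longrightarrow> \<epsilon> > 0 \<Longrightarrow> \<exists>m\<in>S. \<forall>f\<in>J. \<bar>(\<integral>x. f x \<partial>m) - L f\<bar> < \<epsilon>)
        \<Longrightarrow> \<exists>m\<in>S. \<forall>f\<in>bcont X. (\<integral>x. f x \<partial>m) = L f"
  shows "compactin (weak_top X) S"
proof -
  define P where "P = product_topology (\<lambda>_::'a \<Rightarrow> real. euclideanreal) (bcont X)"
  define \<Psi> :: "'a measure \<Rightarrow> ('a \<Rightarrow> real) \<Rightarrow> real" where "\<Psi> = (\<lambda>m. restrict (\<lambda>f. \<integral>x. f x \<partial>m) (bcont X))"
  have "\<forall>f\<in>bcont X. \<exists>B. \<forall>x\<in>topspace X. \<bar>f x\<bar> \<le> B" using bcont_bounded by metis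
  then obtain B where B: "\<And>f x. f \<in> bcont X \<Longrightarrow> x \<in> topspace X \<Longrightarrow> \<bar>f x\<bar> \<le> B f" by metis
  have box: "\<Psi> ` S \<subseteq> PiE (bcont X) (\<lambda>f. {- B f..B f})"
  proof (intro image_subsetI, unfold \<Psi>_def, intro restrict_PiE_iff[THEN iffD2] ballI)
    fix m f assume m: "m \<in> S" and f: "f \<in> bcont X"
    then have mP: "m \<in> probs_on X" using S by auto
    then interpret prob_space m by (simp add: probs_on_def)
    have "space m = topspace X" using mP sets_eq_imp_space_eq[of m "borel_of X"] by (simp add: probs_on_def)
    then have b: "\<And>x. x \<in> space m \<Longrightarrow> \<bar>f x\<bar> \<le> B f" using B[OF f] by auto
    have i: "integrable m f" by (rule bcont_integrable[OF f mP])
    have "(\<integral>x. f x \<partial>m) \<le> (\<integral>x. B f \<partial>m)" using b i by (intro integral_mono) (auto simp: abs_le_iff)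
    moreover have "(\<integral>x. - B f \<partial>m) \<le> (\<integral>x. f x \<partial>m)" using b i by (intro integral_mono) (auto simp: abs_le_iff minus_le_iff)
    ultimately show "(\<integral>x. f x \<partial>m) \<in> {- B f..B f}" by (simp add: prob_space)
  qed
  have "compactin P (PiE (bcont X) (\<lambda>f. {- B f..B f}))"
    unfolding P_def compactin_PiE by simp
  moreover have "closedin P (\<Psi> ` S)"
  proof -
    have "z \<in> \<Psi> ` S" if z: "z \<in> P closure_of (\<Psi> ` S)" for z
    proof -
      have ze: "z \<in> extensional (bcont X)"
        using z unfolding in_closure_of by (simp add: P_def PiE_def)
      have "\<exists>m\<in>S. \<forall>f\<in>J. \<bar>(\<integral>x. f x \<partial>m) - z f\<bar> < \<epsilon>"
        if J: "finite J" "J \<subseteq> bcont X" "\<epsilon> > 0" for J \<epsilon>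
      proof -
        define U where "U = PiE (bcont X) (\<lambda>f. if f \<in> J then {z f - \<epsilon><..<z f + \<epsilon>} else UNIV)"
        have "openin P U"
          unfolding P_def U_def
        proof (subst openin_PiE_gen, intro disjI2 conjI)
          show "finite {f \<in> bcont X. (if f \<in> J then {z f - \<epsilon><..<z f + \<epsilon>} else UNIV) \<noteq> topspace euclideanreal}"
            by (rule finite_subset[OF _ J(1)]) auto
        qed auto
        moreover have "z \<in> U" using ze J(3) by (auto simp: U_def PiE_def)
        ultimately obtain m where "m \<in> S" "\<Psi> m \<in> U"
          using z unfolding in_closure_of by auto
        then have "\<bar>(\<integral>x. f x \<partial>m) - z f\<bar> < \<epsilon>" if "f \<in> J" for f
          using that J(2) by (fastforce simp: U_def \<Psi>_def PiE_def Pi_def abs_less_iff split: if_splits)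
        then show ?thesis using \<open>m \<in> S\<close> by auto
      qed
      then obtain m where m: "m \<in> S" "\<forall>f\<in>bcont X. (\<integral>x. f x \<partial>m) = z f" using lim[OF ze] by blast
      have "\<Psi> m = z"
        using m ze unfolding \<Psi>_def by (intro extensionalityI[of _ "bcont X"]) auto
      then show ?thesis using m(1) by auto
    qed
    moreover have "\<Psi> ` S \<subseteq> topspace P" unfolding P_def \<Psi>_def by auto
    moreover have "P closure_of (\<Psi> ` S) \<subseteq> \<Psi> ` S" using calculation(1) by (rule subsetI)
    ultimately show ?thesis unfolding closure_of_subset_eq[symmetric] by blast
  qed
  ultimately have comp: "compactin P (\<Psi> ` S)" using box by (blast intro: closed_compactin)
  show ?thesis
    unfolding compactin_def
  proof (intro conjI allI impI)
    show "S \<subseteq> topspace (weak_top X)" using S by simp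
    fix \<U> assume \<U>: "Ball \<U> (openin (weak_top X)) \<and> S \<subseteq> \<Union> \<U>"
    \<comment> \<open>The open sets of an initial topology are preimages, so a cover of
      \<open>S\<close> comes from a cover of its image and a finite subcover is carried
      back.\<close>
    have "openin (weak_top X) U \<longleftrightarrow> (\<exists>V. openin P V \<and> U = \<Psi> -` V \<inter> probs_on X)" for U
      unfolding weak_top_def P_def \<Psi>_def by (rule openin_pullback_topology)
    note weak = this
    have "\<exists>V. openin P V \<and> U = \<Psi> -` V \<inter> probs_on X" if "U \<in> \<U>" for U
      by (rule iffD1[OF weak]) (use \<U> that in blast)
    then have "\<exists>V. \<forall>U\<in>\<U>. openin P (V U) \<and> U = \<Psi> -` V U \<inter> probs_on X"
      by (intro bchoice ballI)
    then obtain V where V0: "\<forall>U\<in>\<U>. openin P (V U) \<and> U = \<Psi> -` V U \<inter> probs_on X" ..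
    note V = V0[THEN bspec, THEN conjunct1] V0[THEN bspec, THEN conjunct2]
    have "\<Psi> m \<in> \<Union> (V ` \<U>)" if m: "m \<in> S" for m
    proof -
      obtain U where U: "U \<in> \<U>" "m \<in> U" using \<U> m by blast
      have "m \<in> \<Psi> -` V U \<inter> probs_on X" using U(2) by (subst (asm) V(2)[OF U(1)])
      then show ?thesis using U(1) by blast
    qed
    then have "\<Psi> ` S \<subseteq> \<Union> (V ` \<U>)" by (rule image_subsetI)
    moreover have "\<forall>U\<in>V ` \<U>. openin P U" using V(1) by blast
    ultimately have "\<exists>\<F>. finite \<F> \<and> \<F> \<subseteq> V ` \<U> \<and> \<Psi> ` S \<subseteq> \<Union> \<F>"
      using comp unfolding compactin_def by metis
    then obtain \<F> where \<F>: "finite \<F>" "\<F> \<subseteq> V ` \<U>" "\<Psi> ` S \<subseteq> \<Union> \<F>" by blast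
    then obtain D where D: "D \<subseteq> \<U>" "finite D" "\<F> = V ` D" by (meson finite_subset_image)
    have "S \<subseteq> \<Union> D"
    proof
      fix m assume m: "m \<in> S"
      then obtain U where U: "U \<in> D" "\<Psi> m \<in> V U" using \<F>(3) D(3) by blast
      have "m \<in> \<Psi> -` V U \<inter> probs_on X" using U m S by auto
      then have "m \<in> U" by (subst V(2)[of U]) (use U(1) D(1) in auto)
      then show "m \<in> \<Union> D" using U(1) by blast
    qed
    then show "\<exists>\<F>. finite \<F> \<and> \<F> \<subseteq> \<U> \<and> S \<subseteq> \<Union> \<F>" using D by blast
  qed
qed

lemma open_indicator_limit:
  fixes G :: "'s::metric_space set"
  assumes G: "open G"
  obtains f :: "nat \<Rightarrow> 's \<Rightarrow> real" where "\<And>n. f n \<in> bcont euclidean" "\<And>n x. 0 \<le> f n x" "\<And>n x. f n x \<le> 1"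
    "\<And>n x. x \<notin> G \<Longrightarrow> f n x = 0" "\<And>x. (\<lambda>n. f n x) \<longlonglongrightarrow> indicator G x"
proof -
  obtain u :: "'s \<Rightarrow> real" where uc: "continuous_on UNIV u"
    and u: "\<And>x. 0 \<le> u x" "\<And>x. u x \<le> 1" "\<And>x. u x > 0 \<longleftrightarrow> x \<in> G"
    using open_indicator_approx[OF G] by metis
  have u0: "u x = 0" if "x \<notin> G" for x using u(1)[of x] u(3)[of x] that by auto
  show ?thesis
  proof (rule that[of "\<lambda>n x. min 1 (real n * u x)"])
    show "(\<lambda>x. min 1 (real n * u x)) \<in> bcont euclidean" for n
      using u(1) by (intro bcontI[of _ 1] continuous_intros uc) (simp add: abs_of_nonneg)
    show "(\<lambda>n. min 1 (real n * u x)) \<longlonglongrightarrow> indicator G x" for x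
    proof (cases "x \<in> G")
      case True
      then obtain N :: nat where N: "1 < real N * u x" using u(3)[of x] reals_Archimedean3 by blast
      have "min 1 (real n * u x) = 1" if "n \<ge> N" for n
      proof -
        have "real N * u x \<le> real n * u x" using that u(1) by (intro mult_right_mono) auto
        then show ?thesis using N by simp
      qed
      then show ?thesis using True by (auto intro!: tendsto_eventually eventually_sequentiallyI[of N])
    qed (use u0 in simp)
  qed (use u(1) u0 in auto)
qed

text \<open>The mass of an open set is a limit of integrals of continuous functions below its
  indicator, so a bound on all of these carries over. It transfers tightness to limits and underlies
  lower semicontinuity in \<open>openin_measure_gt\<close>.\<close>

lemma measure_open_le:
  fixes m :: "'s::metric_space measure"
  assumes m: "m \<in> probs_on euclidean" and G: "open G"
    and le: "\<And>f. f \<in> bcont euclidean \<Longrightarrow> (\<And>x. 0 \<le> f x) \<Longrightarrow> (\<And>x. f x \<le> 1) \<Longrightarrow> (\<And>x. x \<notin> G \<Longrightarrow> f x = 0)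
        \<Longrightarrow> (\<integral>x. f x \<partial>m) \<le> c"
  shows "measure m G \<le> c"
proof -
  interpret prob_space m using m by (simp add: probs_on_euclidean)
  have sm: "sets m = sets borel" using m by (simp add: probs_on_euclidean)
  obtain f where f: "\<And>n. f n \<in> bcont euclidean" "\<And>n x. 0 \<le> f n x" "\<And>n x. f n x \<le> 1"
    "\<And>n x. x \<notin> G \<Longrightarrow> f n x = 0" "\<And>x. (\<lambda>n. f n x) \<longlonglongrightarrow> indicator G x"
    using open_indicator_limit[OF G] by metis
  have "(\<lambda>n. \<integral>x. f n x \<partial>m) \<longlonglongrightarrow> (\<integral>x. indicator G x \<partial>m)"
  proof (rule integral_dominated_convergence[where w = "\<lambda>_. 1"])
    show "indicat_real G \<in> borel_measurable m" using G sm by (intro borel_measurable_indicator) auto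
    show "f n \<in> borel_measurable m" for n using bcont_borel_measurable[OF f(1)[of n]] sm by simp
  qed (use f in \<open>auto simp: abs_of_nonneg\<close>)
  moreover have "(\<integral>x. f n x \<partial>m) \<le> c" for n
    using f by (intro le) auto
  ultimately have "(\<integral>x. indicator G x \<partial>m) \<le> c" by (intro LIMSEQ_le_const2) auto
  then show ?thesis using G sm by simp
qed

text \<open>The sufficiency half of Prokhorov's theorem, for an explicit rate of tightness. Each
  property that \<open>tight_mean\<close> asks of the limit functional involves at most three test
  functions, so approximation on finite sets passes it on; the representing measure inherits the
  tightness bound through \<open>measure_open_le\<close>.\<close>

theorem tight_compactin_weak_top:
  fixes K :: "nat \<Rightarrow> 's::metric_space set"
  assumes K: "\<And>j. compact (K j)"
  shows "compactin (weak_top euclidean) {m \<in> probs_on euclidean. \<forall>j. measure m (- K j) \<le> 1 / real (Suc j)}"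
    (is "compactin _ ?S")
proof (rule compactin_weak_top_I)
  show "?S \<subseteq> probs_on euclidean" by auto
  fix L :: "('s \<Rightarrow> real) \<Rightarrow> real"
  assume L: "L \<in> extensional (bcont euclidean)"
    and ap: "\<And>J \<epsilon>. finite J \<Longrightarrow> J \<subseteq> bcont euclidean \<Longrightarrow> \<epsilon> > 0 \<Longrightarrow> \<exists>m\<in>?S. \<forall>f\<in>J. \<bar>(\<integral>x. f x \<partial>m) - L f\<bar> < \<epsilon>"
  have L01: "L f \<le> 1 / real (Suc j)" if fb: "f \<in> bcont euclidean" and f: "\<And>x. 0 \<le> f x" "\<And>x. f x \<le> 1"
    "\<And>x. x \<in> K j \<Longrightarrow> f x = 0" for f j
  proof (rule field_le_epsilon)
    fix e :: real assume "0 < e"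
    then obtain m where m: "m \<in> ?S" "\<bar>(\<integral>x. f x \<partial>m) - L f\<bar> < e" using ap[of "{f}" e] fb by auto
    then interpret prob_space m by (simp add: probs_on_euclidean)
    have sm: "sets m = sets borel" using m by (simp add: probs_on_euclidean)
    have Kb: "- K j \<in> sets m" using K[of j] sm
      by (simp add: borel_open open_Compl compact_imp_closed)
    have "(\<integral>x. f x \<partial>m) \<le> (\<integral>x. indicator (- K j) x \<partial>m)"
    proof (rule integral_mono)
      show "integrable m f" using fb m by (intro bcont_integrable) auto
      show "integrable m (indicat_real (- K j))" using Kb by (simp add: less_top[symmetric])
      show "f x \<le> indicat_real (- K j) x" for x using f by (simp add: indicator_def)
    qed
    also have "\<dots> = prob (- K j)" using Kb by simp
    finally show "L f \<le> 1 / real (Suc j) + e" using m by (auto dest: spec[of _ j])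
  qed
  interpret tight_mean L K
  proof
    fix f g :: "'s \<Rightarrow> real" assume f: "f \<in> bcont euclidean" and g: "g \<in> bcont euclidean"
    note fg = bcont_add[OF f g]
    have "\<bar>L (\<lambda>x. f x + g x) - (L f + L g)\<bar> \<le> 0 + e" if "0 < e" for e
    proof -
      have "\<exists>m\<in>?S. \<forall>h\<in>{f, g, \<lambda>x. f x + g x}. \<bar>(\<integral>x. h x \<partial>m) - L h\<bar> < e / 3"
        by (rule ap) (use f g fg that in auto)
      then obtain m where m: "m \<in> ?S" "\<forall>h\<in>{f, g, \<lambda>x. f x + g x}. \<bar>(\<integral>x. h x \<partial>m) - L h\<bar> < e / 3"
        by blast
      have "(\<integral>x. f x + g x \<partial>m) = (\<integral>x. f x \<partial>m) + (\<integral>x. g x \<partial>m)"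
        using m f g by (intro Bochner_Integration.integral_add bcont_integrable) auto
      moreover have "\<bar>(\<integral>x. f x \<partial>m) - L f\<bar> < e / 3" "\<bar>(\<integral>x. g x \<partial>m) - L g\<bar> < e / 3"
        "\<bar>(\<integral>x. f x + g x \<partial>m) - L (\<lambda>x. f x + g x)\<bar> < e / 3" using m(2) by blast+
      ultimately show ?thesis by linarith
    qed
    then show "L (\<lambda>x. f x + g x) = L f + L g"
      using field_le_epsilon[of "\<bar>L (\<lambda>x. f x + g x) - (L f + L g)\<bar>" 0] by auto
  next
    fix f :: "'s \<Rightarrow> real" and c :: real assume f: "f \<in> bcont euclidean"
    note cf = bcont_cmult[OF f, of c]
    have "\<bar>L (\<lambda>x. c * f x) - c * L f\<bar> \<le> 0 + e" if "0 < e" for e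
    proof -
      \<comment> \<open>The two approximation errors, \<open>d\<close> and
        \<open>\<bar>c\<bar> * d\<close>, add up to exactly \<open>e\<close>.\<close>
      define d where "d = e / (1 + \<bar>c\<bar>)"
      have d: "d > 0" using that by (simp add: d_def add_pos_nonneg)
      obtain m where m: "\<bar>(\<integral>x. f x \<partial>m) - L f\<bar> < d" "\<bar>(\<integral>x. c * f x \<partial>m) - L (\<lambda>x. c * f x)\<bar> < d"
        using ap[of "{f, \<lambda>x. c * f x}" d] f cf d by auto
      have "\<bar>L (\<lambda>x. c * f x) - c * L f\<bar> \<le> \<bar>L (\<lambda>x. c * f x) - (\<integral>x. c * f x \<partial>m)\<bar> + \<bar>c * ((\<integral>x. f x \<partial>m) - L f)\<bar>"
        by (simp add: algebra_simps abs_if)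
      also have "\<dots> \<le> d + \<bar>c\<bar> * d"
        unfolding abs_mult using m by (intro add_mono mult_left_mono) auto
      also have "\<dots> = e" unfolding d_def by (simp add: field_simps add_nonneg_eq_0_iff)
      finally show ?thesis by simp
    qed
    then show "L (\<lambda>x. c * f x) = c * L f"
      using field_le_epsilon[of "\<bar>L (\<lambda>x. c * f x) - c * L f\<bar>" 0] by auto
  next
    fix f :: "'s \<Rightarrow> real" assume f: "f \<in> bcont euclidean" "\<And>x. 0 \<le> f x"
    have "0 \<le> L f + e" if "0 < e" for e
    proof -
      have "\<exists>m\<in>?S. \<forall>h\<in>{f}. \<bar>(\<integral>x. h x \<partial>m) - L h\<bar> < e" by (rule ap) (use f that in auto)
      then obtain m where m: "\<bar>(\<integral>x. f x \<partial>m) - L f\<bar> < e" by blast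
      have "0 \<le> (\<integral>x. f x \<partial>m)" using f(2) by simp
      then show ?thesis using m by simp
    qed
    then show "0 \<le> L f" by (rule field_le_epsilon)
  next
    have "\<bar>L (\<lambda>_. 1) - 1\<bar> \<le> 0 + e" if "0 < e" for e
    proof -
      have "\<exists>m\<in>?S. \<forall>h\<in>{\<lambda>_. 1}. \<bar>(\<integral>x. h x \<partial>m) - L h\<bar> < e"
        by (rule ap) (use bcont_const that in auto)
      then obtain m where m: "m \<in> ?S" "\<bar>(\<integral>x. 1 \<partial>m) - L (\<lambda>_. 1)\<bar> < e" by blast
      then interpret prob_space m by (simp add: probs_on_euclidean)
      show ?thesis using m(2) by (simp add: prob_space)
    qed
    then show "L (\<lambda>_. 1) = 1"
      using field_le_epsilon[of "\<bar>L (\<lambda>_. 1) - 1\<bar>" 0] by auto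
  qed (use K L01 in auto)
  obtain m where m: "m \<in> probs_on euclidean" "\<And>f. f \<in> bcont euclidean \<Longrightarrow> (\<integral>x. f x \<partial>m) = L f"
    using representation by metis
  have "measure m (- K j) \<le> 1 / real (Suc j)" for j
    using K[of j] m(2) L01[of _ j]
    by (intro measure_open_le[OF m(1)]) (auto simp: compact_imp_closed open_Compl)
  then show "\<exists>m\<in>?S. \<forall>f\<in>bcont euclidean. (\<integral>x. f x \<partial>m) = L f" using m by auto
qed

subsection \<open>Relative entropy\<close>

text \<open>Young's inequality for the conjugate pair \<open>y * ln y - y\<close> and
  \<open>exp a\<close>, from \<open>1 + t \<le> exp t\<close> at \<open>t = a - ln y\<close>. At
  \<open>y = 0\<close> the logarithm is multiplied by 0.\<close>

lemma young_exp: 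
  fixes y a :: real assumes "y \<ge> 0"
  shows "y * a \<le> y * ln y - y + exp a"
proof (cases "y = 0")
  case False
  then have y: "y > 0" using assms by simp
  have "1 + (a - ln y) \<le> exp (a - ln y)" by (rule exp_ge_add_one_self)
  also have "\<dots> = exp a / y" using y by (simp add: exp_diff)
  finally show ?thesis using y by (simp add: field_simps)
qed simp

lemma neg_xlnx_le:
  fixes y :: real assumes "y \<ge> 0" shows "- (y * ln y) \<le> 1"
  using young_exp[OF assms, of 0] assms by simp

text \<open>The Radon-Nikodym derivative of a finite measure is finite almost everywhere, which
  gives a real-valued density. The last bound, from \<open>neg_xlnx_le\<close>, ensures that the
  difference defining \<open>relent\<close> is never \<infinity> - \<infinity>.\<close>

lemma relent_density:
  assumes p0: "prob_space lam0" and p: "prob_space lam"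
    and ac: "absolutely_continuous lam0 lam" and sets: "sets lam = sets lam0"
    and f_def: "f = (\<lambda>x. enn2real (RN_deriv lam0 lam x))"
  shows "f \<in> borel_measurable lam0" "lam = density lam0 (\<lambda>x. ennreal (f x))"
    "relent lam0 lam = enn2ereal (\<integral>\<^sup>+x. ennreal (f x * ln (f x)) \<partial>lam0)
         - enn2ereal (\<integral>\<^sup>+x. ennreal (- (f x * ln (f x))) \<partial>lam0)"
    "(\<integral>\<^sup>+x. ennreal (- (f x * ln (f x))) \<partial>lam0) \<le> 1"
proof -
  interpret prob_space lam0 by fact
  interpret l: prob_space lam by fact
  show f: "f \<in> borel_measurable lam0" unfolding f_def by measurable
  have "AE x in lam0. RN_deriv lam0 lam x \<noteq> \<infinity>"
    using ac sets by (intro RN_deriv_finite) (auto simp: l.sigma_finite_measure_axioms)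
  then have "density lam0 (RN_deriv lam0 lam) = density lam0 (\<lambda>x. ennreal (f x))"
    using f by (intro density_cong) (auto simp: f_def less_top)
  then show "lam = density lam0 (\<lambda>x. ennreal (f x))"
    using density_RN_deriv[OF ac sets] by simp
  show "relent lam0 lam = enn2ereal (\<integral>\<^sup>+x. ennreal (f x * ln (f x)) \<partial>lam0)
         - enn2ereal (\<integral>\<^sup>+x. ennreal (- (f x * ln (f x))) \<partial>lam0)"
    using ac sets by (simp add: relent_def f_def Let_def)
  have "(\<integral>\<^sup>+x. ennreal (- (f x * ln (f x))) \<partial>lam0) \<le> (\<integral>\<^sup>+x. 1 \<partial>lam0)"
    using neg_xlnx_le by (intro nn_integral_mono) (auto simp: f_def ennreal_le_1)
  then show "(\<integral>\<^sup>+x. ennreal (- (f x * ln (f x))) \<partial>lam0) \<le> 1" by (simp add: emeasure_space_1)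
qed

text \<open>Integrate \<open>young_exp\<close> with \<open>y\<close> the density and
  \<open>a = \<phi> - ln Z\<close>, where \<open>Z\<close> is the exponential integral: the last two
  terms integrate to -1 and 1 and cancel. Test functions are merely measurable so that indicators of
  events and of complements of compact sets can be inserted.\<close>

theorem donsker_varadhan_le:
  fixes \<phi> :: "'a \<Rightarrow> real"
  assumes p0: "prob_space lam0" and p: "prob_space lam"
    and H: "relent lam0 lam \<le> ereal h"
    and \<phi>: "\<phi> \<in> borel_measurable lam0" "\<And>x. \<bar>\<phi> x\<bar> \<le> B"
  shows "(\<integral>x. \<phi> x \<partial>lam) \<le> h + ln (\<integral>x. exp (\<phi> x) \<partial>lam0)"
proof -
  interpret prob_space lam0 by fact
  interpret l: prob_space lam by fact
  have ac: "absolutely_continuous lam0 lam" and sets: "sets lam = sets lam0"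
    using H by (auto simp: relent_def split: if_splits)
  define f where "f = (\<lambda>x. enn2real (RN_deriv lam0 lam x))"
  note d = relent_density[OF p0 p ac sets f_def]
  have f0: "f x \<ge> 0" for x by (simp add: f_def)
  have [measurable]: "f \<in> borel_measurable lam0" "\<phi> \<in> borel_measurable lam0" by fact+
  define P where "P = (\<integral>\<^sup>+x. ennreal (f x * ln (f x)) \<partial>lam0)"
  define N where "N = (\<integral>\<^sup>+x. ennreal (- (f x * ln (f x))) \<partial>lam0)"
  have N: "N < top" using d(4) unfolding N_def by (simp add: order_le_less_trans[OF _ ennreal_one_less_top])
  have H': "enn2ereal P - enn2ereal N \<le> ereal h" using H d(3) by (simp add: P_def N_def)
  have P: "P < top"
  proof (rule ccontr)
    assume "\<not> P < top"
    then have "P = top" by (metis less_top)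
    moreover have "enn2ereal N \<noteq> \<infinity>" using N by (cases N) auto
    ultimately show False using H' by (cases "enn2ereal N") (auto simp: top_ennreal.rep_eq)
  qed
  have i1: "integrable lam0 (\<lambda>x. f x * ln (f x))"
    using P N by (auto simp: real_integrable_def P_def N_def)
  have "(\<integral>x. f x * ln (f x) \<partial>lam0) = enn2real P - enn2real N"
    using real_lebesgue_integral_def[OF i1] by (simp add: P_def N_def)
  moreover have "enn2real P - enn2real N \<le> h"
    using H' P N by (cases P; cases N) auto
  ultimately have ih: "(\<integral>x. f x * ln (f x) \<partial>lam0) \<le> h" by simp
  have fint: "integrable lam0 f" and f1: "(\<integral>x. f x \<partial>lam0) = 1"
  proof -
    have "(\<integral>\<^sup>+x. ennreal (f x) \<partial>lam0) = emeasure lam (space lam0)"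
      by (subst d(2)) (simp add: emeasure_density cong: nn_integral_cong)
    also have "\<dots> = 1" using l.emeasure_space_1 sets_eq_imp_space_eq[OF sets] by simp
    finally have *: "(\<integral>\<^sup>+x. ennreal (f x) \<partial>lam0) = 1" .
    then show "integrable lam0 f" using f0 by (intro integrableI_nonneg) auto
    then show "(\<integral>x. f x \<partial>lam0) = 1" using * f0 by (simp add: integral_eq_nn_integral)
  qed
  define Z where "Z = (\<integral>x. exp (\<phi> x) \<partial>lam0)"
  have ie: "integrable lam0 (\<lambda>x. exp (\<phi> x))"
    using \<phi>(2) by (intro integrable_const_bound[of _ "exp B"]) (auto simp: abs_le_iff)
  have "exp (- B) \<le> Z"
  proof -
    have "(\<integral>x. exp (- B) \<partial>lam0) \<le> Z" unfolding Z_def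
      using \<phi>(2) ie by (intro integral_mono) (auto simp: abs_le_iff minus_le_iff)
    then show ?thesis by (simp add: prob_space)
  qed
  then have Z: "Z > 0" using exp_gt_zero[of "- B"] by linarith
  have ifp: "integrable lam0 (\<lambda>x. f x * \<phi> x)"
  proof (rule Bochner_Integration.integrable_bound[of _ "\<lambda>x. B * f x"])
    show "AE x in lam0. norm (f x * \<phi> x) \<le> norm (B * f x)"
      using f0 \<phi>(2) by (auto simp: abs_mult mult.commute[of B] intro!: mult_left_mono order_trans[OF \<phi>(2) abs_ge_self])
  qed (use fint in auto)
  have "(\<integral>x. f x * \<phi> x - ln Z * f x \<partial>lam0) \<le> (\<integral>x. f x * ln (f x) - f x + exp (\<phi> x) / Z \<partial>lam0)"
  proof (rule integral_mono)
    show "f x * \<phi> x - ln Z * f x \<le> f x * ln (f x) - f x + exp (\<phi> x) / Z" for x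
      using young_exp[OF f0, of x "\<phi> x - ln Z"] Z by (simp add: exp_diff algebra_simps)
  qed (use ifp i1 fint ie in auto)
  also have "\<dots> = (\<integral>x. f x * ln (f x) \<partial>lam0) - 1 + Z / Z"
    using i1 fint ie by (simp add: f1 Z_def)
  finally have "(\<integral>x. f x * \<phi> x \<partial>lam0) - ln Z \<le> h"
    using ifp fint f1 Z ih by simp
  moreover have "(\<integral>x. \<phi> x \<partial>lam) = (\<integral>x. f x * \<phi> x \<partial>lam0)"
    using f0 by (subst d(2)) (simp add: integral_density)
  ultimately show ?thesis by (simp add: Z_def)
qed

lemma relent_nonneg:
  assumes "prob_space lam0" "prob_space lam"
  shows "0 \<le> relent lam0 lam"
proof (rule ccontr)
  assume "\<not> ?thesis"
  then obtain h where h: "relent lam0 lam \<le> ereal h" "h < 0"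
    by (metis ereal_dense2 ereal_less(2) less_imp_le linorder_not_le less_ereal.simps(1) zero_ereal_def)
  interpret prob_space lam0 by fact
  have "(\<integral>x. (0::real) \<partial>lam) \<le> h + ln (\<integral>x. exp 0 \<partial>lam0)"
    by (rule donsker_varadhan_le[OF assms h(1), where B = 0]) auto
  then show False using h(2) by (simp add: prob_space)
qed

text \<open>Induction over integrable functions, where only indicators need an idea: outer
  regularity of finite Borel measures on Polish spaces encloses a Borel set in an open
  \<open>G\<close> of nearly the same mass, and the indicator of \<open>G\<close> is a bounded
  pointwise limit of continuous functions.\<close>

lemma bcont_L1_dense:
  fixes \<nu> :: "'w::polish_space measure" and f :: "'w \<Rightarrow> real"
  assumes \<nu>: "finite_measure \<nu>" and sb: "sets \<nu> = sets borel" and "integrable \<nu> f" and "e > 0"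
  shows "\<exists>g\<in>bcont euclidean. (\<integral>x. \<bar>f x - g x\<bar> \<partial>\<nu>) < e"
proof -
  interpret finite_measure \<nu> by fact
  have bi: "integrable \<nu> g" if g: "g \<in> bcont euclidean" for g
  proof -
    obtain B where "\<And>x. \<bar>g x\<bar> \<le> B" using bcont_bounded[OF g] by auto
    then show ?thesis using bcont_borel_measurable[OF g, of \<nu>] sb
      by (intro integrable_const_bound[of _ B]) auto
  qed
  have "\<forall>e>0. \<exists>g\<in>bcont euclidean. (\<integral>x. \<bar>f x - g x\<bar> \<partial>\<nu>) < e"
    using \<open>integrable \<nu> f\<close>
  proof (induction rule: integrable_induct)
    case (base A c)
    show ?case
    proof (intro allI impI)
      fix e :: real assume "0 < e"
      \<comment> \<open>The errors from passing to \<open>G\<close> and from \<open>h n\<close> are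
        each below \<open>d\<close> and are multiplied by \<open>\<bar>c\<bar>\<close>; the added 1
        covers \<open>c = 0\<close> and makes the final inequality strict.\<close>
      define d where "d = e / (2 * (1 + \<bar>c\<bar>))"
      have d: "d > 0" using \<open>0 < e\<close> by (simp add: d_def add_pos_nonneg)
      have Ab: "A \<in> sets borel" using base sb by simp
      have "emeasure \<nu> A < emeasure \<nu> A + ennreal d"
        using base(2) d ennreal_add_left_cancel_less[of "emeasure \<nu> A" 0] by auto
      then obtain G where G: "A \<subseteq> G" "open G" "emeasure \<nu> G < emeasure \<nu> A + ennreal d"
        unfolding outer_regular[OF sb _ Ab, unfolded infinity_ennreal_def, OF emeasure_finite] INF_less_iff by auto
      have [measurable]: "G \<in> sets \<nu>" "A \<in> sets \<nu>" using G sb base by auto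
      have GA: "measure \<nu> G - measure \<nu> A < d"
        using G(3) d by (simp add: emeasure_eq_measure ennreal_less_iff flip: ennreal_plus)
      obtain h where h: "\<And>n. h n \<in> bcont euclidean" "\<And>n x. 0 \<le> h n x" "\<And>n x. h n x \<le> 1"
          "\<And>x. (\<lambda>n. h n x) \<longlonglongrightarrow> (indicator G x :: real)"
        using open_indicator_limit[OF G(2)] by metis
      have hm [measurable]: "h n \<in> borel_measurable \<nu>" for n
        using bcont_borel_measurable[OF h(1)[of n], of \<nu>] sb by simp
      have "(\<lambda>n. \<integral>x. \<bar>indicator G x - h n x\<bar> \<partial>\<nu>) \<longlonglongrightarrow> (\<integral>x. \<bar>indicator G x - indicator G x\<bar> \<partial>\<nu>)"
      proof (rule integral_dominated_convergence[where w = "\<lambda>_. 1"])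
        show "AE x in \<nu>. (\<lambda>n. \<bar>indicator G x - h n x\<bar>) \<longlonglongrightarrow> \<bar>indicator G x - indicator G x\<bar>"
          by (intro AE_I2 tendsto_intros h)
        show "AE x in \<nu>. norm \<bar>indicator G x - h n x\<bar> \<le> 1" for n
        proof (rule AE_I2)
          fix x show "norm \<bar>indicator G x - h n x\<bar> \<le> 1"
            using h(2,3)[of n x] by (simp add: indicator_def)
        qed
      qed auto
      then have "(\<lambda>n. \<integral>x. \<bar>indicator G x - h n x\<bar> \<partial>\<nu>) \<longlonglongrightarrow> 0" by simp
      then obtain n where n: "(\<integral>x. \<bar>indicator G x - h n x\<bar> \<partial>\<nu>) < d"
        using order_tendstoD(2)[OF _ d] eventually_sequentially by (metis (no_types, lifting) order_refl)
      have "(\<integral>x. \<bar>indicator A x *\<^sub>R c - c * h n x\<bar> \<partial>\<nu>)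
          \<le> (\<integral>x. \<bar>c\<bar> * ((indicator G x - indicator A x) + \<bar>indicator G x - h n x\<bar>) \<partial>\<nu>)"
      proof (rule integral_mono)
        show "integrable \<nu> (\<lambda>x. \<bar>indicator A x *\<^sub>R c - c * h n x\<bar>)"
          using bi[OF h(1)] by (auto simp: less_top[symmetric])
        show "integrable \<nu> (\<lambda>x. \<bar>c\<bar> * ((indicator G x - indicator A x) + \<bar>indicator G x - h n x\<bar>))"
          using bi[OF h(1)] by (auto simp: less_top[symmetric])
        fix x
        have "\<bar>indicator A x - h n x\<bar> \<le> (indicator G x - indicator A x) + \<bar>indicator G x - h n x\<bar>"
          using G(1) by (auto simp: indicator_def)
        then have "\<bar>c\<bar> * \<bar>indicator A x - h n x\<bar> \<le> \<bar>c\<bar> * ((indicator G x - indicator A x) + \<bar>indicator G x - h n x\<bar>)"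
          by (rule mult_left_mono) simp
        then show "\<bar>indicator A x *\<^sub>R c - c * h n x\<bar> \<le> \<bar>c\<bar> * ((indicator G x - indicator A x) + \<bar>indicator G x - h n x\<bar>)"
          by (simp add: abs_mult[symmetric] algebra_simps)
      qed
      also have "\<dots> = \<bar>c\<bar> * ((measure \<nu> G - measure \<nu> A) + (\<integral>x. \<bar>indicator G x - h n x\<bar> \<partial>\<nu>))"
        using bi[OF h(1)] by (simp add: less_top[symmetric])
      also have "\<dots> \<le> \<bar>c\<bar> * (d + d)" using n GA by (intro mult_left_mono) auto
      also have "\<dots> < e"
      proof -
        define c1 where "c1 = 1 + \<bar>c\<bar>"
        have "c1 > 0" by (simp add: c1_def add_pos_nonneg)
        then have "c1 * (d + d) = e" by (simp add: d_def flip: c1_def)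
        then show ?thesis using d by (simp add: c1_def algebra_simps)
      qed
      finally show "\<exists>g\<in>bcont euclidean. (\<integral>x. \<bar>indicator A x *\<^sub>R c - g x\<bar> \<partial>\<nu>) < e"
        using bcont_cmult[OF h(1)] by (intro bexI[of _ "\<lambda>x. c * h n x"])
    qed
  next
    case (add f g)
    show ?case
    proof (intro allI impI)
      fix e :: real assume "0 < e"
      then obtain f' g' where 1: "f' \<in> bcont euclidean" "(\<integral>x. \<bar>f x - f' x\<bar> \<partial>\<nu>) < e/2"
        "g' \<in> bcont euclidean" "(\<integral>x. \<bar>g x - g' x\<bar> \<partial>\<nu>) < e/2" using add.IH
        by (metis half_gt_zero)
      have "(\<integral>x. \<bar>(f x + g x) - (f' x + g' x)\<bar> \<partial>\<nu>) \<le> (\<integral>x. \<bar>f x - f' x\<bar> + \<bar>g x - g' x\<bar> \<partial>\<nu>)"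
        using add.hyps bi[OF 1(1)] bi[OF 1(3)] by (intro integral_mono) auto
      also have "\<dots> < e" using 1 add.hyps bi[OF 1(1)] bi[OF 1(3)] by simp
      finally show "\<exists>h\<in>bcont euclidean. (\<integral>x. \<bar>(f x + g x) - h x\<bar> \<partial>\<nu>) < e"
        using bcont_add[OF 1(1,3)] by (intro bexI[of _ "\<lambda>x. f' x + g' x"])
    qed
  next
    case (lim f s)
    show ?case
    proof (intro allI impI)
      fix e :: real assume "0 < e"
      have [measurable]: "f \<in> borel_measurable \<nu>" "\<And>n. s n \<in> borel_measurable \<nu>" using lim.hyps by auto
      have "(\<lambda>n. \<integral>x. \<bar>f x - s n x\<bar> \<partial>\<nu>) \<longlonglongrightarrow> (\<integral>x. \<bar>f x - f x\<bar> \<partial>\<nu>)"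
      \<comment> \<open>The approximants satisfy
        \<open>\<bar>s n x\<bar> \<le> 2 * \<bar>f x\<bar>\<close>, whence the factor 3 = 1 +
        2.\<close>
      proof (rule integral_dominated_convergence[where w = "\<lambda>x. 3 * \<bar>f x\<bar>"])
        show "AE x in \<nu>. (\<lambda>n. \<bar>f x - s n x\<bar>) \<longlonglongrightarrow> \<bar>f x - f x\<bar>"
          by (intro AE_I2 tendsto_intros lim.hyps)
        show "AE x in \<nu>. norm \<bar>f x - s n x\<bar> \<le> 3 * \<bar>f x\<bar>" for n
        proof (rule AE_I2)
          fix x assume "x \<in> space \<nu>"
          then have "\<bar>s n x\<bar> \<le> 2 * \<bar>f x\<bar>" using lim.hyps(3)[of x n] by simp
          then show "norm \<bar>f x - s n x\<bar> \<le> 3 * \<bar>f x\<bar>" by simp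
        qed
      qed (use lim.hyps in auto)
      then have "(\<lambda>n. \<integral>x. \<bar>f x - s n x\<bar> \<partial>\<nu>) \<longlonglongrightarrow> 0" by simp
      then obtain n where n: "(\<integral>x. \<bar>f x - s n x\<bar> \<partial>\<nu>) < e/2"
        using order_tendstoD(2)[of _ 0 sequentially "e/2"] \<open>0 < e\<close> eventually_sequentially
        by (metis (no_types, lifting) half_gt_zero order_refl)
      obtain g where g: "g \<in> bcont euclidean" "(\<integral>x. \<bar>s n x - g x\<bar> \<partial>\<nu>) < e/2"
        using lim.IH[of n] \<open>0 < e\<close> by (metis half_gt_zero)
      have "(\<integral>x. \<bar>f x - g x\<bar> \<partial>\<nu>) \<le> (\<integral>x. \<bar>f x - s n x\<bar> + \<bar>s n x - g x\<bar> \<partial>\<nu>)"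
        using lim.hyps bi[OF g(1)] by (intro integral_mono) auto
      also have "\<dots> < e" using n g lim.hyps bi[OF g(1)] by simp
      finally show "\<exists>g\<in>bcont euclidean. (\<integral>x. \<bar>f x - g x\<bar> \<partial>\<nu>) < e" using g(1) by blast
    qed
  qed
  then show ?thesis using \<open>e > 0\<close> by blast
qed


text \<open>A single \<open>g\<close> must be close to \<open>f\<close> under both measures, so
  density is applied in the L1 space of their average \<nu>. Truncating at \<open>B\<close> cannot
  increase the distance to \<open>f\<close>, and it keeps the exponential of \<open>g\<close>
  bounded.\<close>

lemma bounded_L1_dense_two:
  fixes M N :: "'w::polish_space measure" and f :: "'w \<Rightarrow> real"
  assumes M: "M \<in> probs_on euclidean" and N: "N \<in> probs_on euclidean"
    and f: "f \<in> borel_measurable borel" "\<And>x. \<bar>f x\<bar> \<le> B" and e: "e > 0"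
  obtains g where "g \<in> bcont euclidean" "\<And>x. \<bar>g x\<bar> \<le> B"
    "(\<integral>x. \<bar>f x - g x\<bar> \<partial>M) < e" "(\<integral>x. \<bar>f x - g x\<bar> \<partial>N) < e"
proof -
  define \<kappa> where "\<kappa> b = (if b then M else N)" for b :: bool
  have \<kappa>P: "\<kappa> b \<in> probs_on euclidean" for b using M N by (simp add: \<kappa>_def)
  \<comment> \<open>The average of \<open>M\<close> and \<open>N\<close>, realized by choosing one
    of them with a fair coin; an error below \<open>e / 2\<close> under \<nu> is below
    \<open>e\<close> under each.\<close>
  define \<nu> where "\<nu> = measure_pmf (bernoulli_pmf (1/2)) \<bind> \<kappa>"
  have \<kappa>: "\<kappa> \<in> measurable (measure_pmf (bernoulli_pmf (1/2))) (subprob_algebra borel)"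
    using \<kappa>P by (auto simp: probs_on_euclidean space_subprob_algebra prob_space_imp_subprob_space)
  have sb: "sets \<nu> = sets borel"
    unfolding \<nu>_def using \<kappa>P by (intro sets_bind) (auto simp: probs_on_euclidean)
  have nn: "(\<integral>\<^sup>+x. u x \<partial>\<nu>) = (\<integral>\<^sup>+x. u x \<partial>M) * ennreal (1/2) + (\<integral>\<^sup>+x. u x \<partial>N) * ennreal (1/2)"
    if "u \<in> borel_measurable borel" for u
    unfolding \<nu>_def using nn_integral_bind[OF that \<kappa>]
    by (simp add: nn_integral_bernoulli_pmf \<kappa>_def)
  have half: "ennreal (1/2) + ennreal (1/2) = 1" by (subst ennreal_plus[symmetric]) auto
  have "emeasure \<nu> (space \<nu>) = 1"
    using half nn[of "\<lambda>_. 1"] M N prob_space.emeasure_space_1[of M] prob_space.emeasure_space_1[of N]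
    by (simp add: probs_on_euclidean)
  then interpret \<nu>: prob_space \<nu> by (rule prob_spaceI)
  have fi: "integrable \<nu> f" using f sb by (intro \<nu>.integrable_const_bound[of _ B]) (auto simp: measurable_cong_sets[OF sb refl])
  obtain g0 where g0: "g0 \<in> bcont euclidean" "(\<integral>x. \<bar>f x - g0 x\<bar> \<partial>\<nu>) < e / 2"
    using bcont_L1_dense[OF \<nu>.finite_measure_axioms sb fi, of "e/2"] e by auto
  define g where "g x = max (-B) (min B (g0 x))" for x
  have B0: "0 \<le> B" using f(2)[of undefined] by linarith
  have gb: "g \<in> bcont euclidean" unfolding g_def by (intro bcont_max bcont_min bcont_const g0)
  have gB: "\<bar>g x\<bar> \<le> B" for x using B0 by (auto simp: g_def abs_le_iff)
  have [measurable]: "f \<in> borel_measurable borel" "g \<in> borel_measurable borel" "g0 \<in> borel_measurable borel"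
    using f gb g0 bcont_borel_measurable[of _ euclidean borel] by auto
  have im: "integrable K (\<lambda>x. \<bar>f x - h x\<bar>)" if h: "h \<in> bcont euclidean" and K: "K \<in> probs_on euclidean" for h K
  proof -
    interpret K: prob_space K using K by (simp add: probs_on_euclidean)
    have "sets K = sets borel" using K by (simp add: probs_on_euclidean)
    then have "integrable K f" using f
      by (intro K.integrable_const_bound[of _ B]) (auto simp: measurable_cong_sets[of K borel])
    then show ?thesis using bcont_integrable[OF h K] by auto
  qed
  have \<nu>P: "\<nu> \<in> probs_on euclidean" using sb \<nu>.prob_space_axioms by (simp add: probs_on_euclidean)
  have "(\<integral>x. \<bar>f x - g x\<bar> \<partial>\<nu>) \<le> (\<integral>x. \<bar>f x - g0 x\<bar> \<partial>\<nu>)"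
  proof (rule integral_mono)
    show "\<bar>f x - g x\<bar> \<le> \<bar>f x - g0 x\<bar>" for x
      using f(2)[of x] unfolding g_def by linarith
  qed (use im[OF gb \<nu>P] im[OF g0(1) \<nu>P] in auto)
  then have small: "(\<integral>x. \<bar>f x - g x\<bar> \<partial>\<nu>) < e / 2" using g0 by linarith
  define a where "a = (\<integral>x. \<bar>f x - g x\<bar> \<partial>M)"
  define b where "b = (\<integral>x. \<bar>f x - g x\<bar> \<partial>N)"
  have ab: "0 \<le> a" "0 \<le> b" by (auto simp: a_def b_def)
  have "ennreal (\<integral>x. \<bar>f x - g x\<bar> \<partial>\<nu>) = ennreal a * ennreal (1/2) + ennreal b * ennreal (1/2)"
    unfolding a_def b_def using nn[of "\<lambda>x. ennreal \<bar>f x - g x\<bar>"]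
      nn_integral_eq_integral[OF im[OF gb M]] nn_integral_eq_integral[OF im[OF gb N]]
      nn_integral_eq_integral[OF im[OF gb \<nu>P]] by simp
  also have "\<dots> = ennreal (a * (1/2) + b * (1/2))"
    using ab by (simp only: ennreal_plus ennreal_mult mult_nonneg_nonneg zero_le_divide_1_iff zero_le_numeral)
  also have "a * (1/2) + b * (1/2) = a / 2 + b / 2" by simp
  finally have "(\<integral>x. \<bar>f x - g x\<bar> \<partial>\<nu>) = a / 2 + b / 2" using ab by (subst (asm) ennreal_inj) auto
  then have "a < e" "b < e" using small ab by linarith+
  then show ?thesis using gb gB by (intro that[of g]) (auto simp: a_def b_def)
qed

text \<open>Both sides are stable under bounded L1 approximation: on functions bounded by
  \<open>B\<close>, \<open>exp\<close> is Lipschitz with constant \<open>exp B\<close>, and the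
  exponential integral stays above \<open>exp (- B)\<close>, which keeps the logarithm under
  control.\<close>

lemma dv_bounded_measurable:
  fixes lam0 lam :: "'w::polish_space measure"
  assumes l0: "lam0 \<in> probs_on euclidean" and l: "lam \<in> probs_on euclidean"
    and dv: "\<And>\<phi>. \<phi> \<in> bcont euclidean \<Longrightarrow> (\<integral>x. \<phi> x \<partial>lam) \<le> L + ln (\<integral>x. exp (\<phi> x) \<partial>lam0)"
    and \<phi>: "\<phi> \<in> borel_measurable borel" "\<And>x. \<bar>\<phi> x\<bar> \<le> B"
  shows "(\<integral>x. \<phi> x \<partial>lam) \<le> L + ln (\<integral>x. exp (\<phi> x) \<partial>lam0)"
proof (rule field_le_epsilon)
  fix e :: real assume "0 < e"
  interpret l0: prob_space lam0 using l0 by (simp add: probs_on_euclidean)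
  interpret l: prob_space lam using l by (simp add: probs_on_euclidean)
  have s0: "sets lam0 = sets borel" and s: "sets lam = sets borel" using l0 l by (auto simp: probs_on_euclidean)
  have B0: "0 \<le> B" using \<phi>(2)[of undefined] by linarith
  have ei: "integrable lam0 (\<lambda>x. exp (h x)) \<and> exp (-B) \<le> (\<integral>x. exp (h x) \<partial>lam0)"
    if h: "h \<in> borel_measurable borel" "\<And>x. \<bar>h x\<bar> \<le> B" for h
  proof
    have [measurable]: "h \<in> borel_measurable lam0" using h(1) by (simp add: measurable_cong_sets[OF s0 refl])
    show i: "integrable lam0 (\<lambda>x. exp (h x))"
      using h by (intro l0.integrable_const_bound[of _ "exp B"]) (auto simp: abs_le_iff)
    have "(\<integral>x. exp (- B) \<partial>lam0) \<le> (\<integral>x. exp (h x) \<partial>lam0)"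
      using h i by (intro integral_mono) (auto simp: abs_le_iff minus_le_iff)
    then show "exp (-B) \<le> (\<integral>x. exp (h x) \<partial>lam0)" by (simp add: l0.prob_space)
  qed
  define Z where "Z = (\<integral>x. exp (\<phi> x) \<partial>lam0)"
  have Z: "exp (-B) \<le> Z" using ei[OF \<phi>] by (simp add: Z_def)
  then have Z0: "0 < Z" using exp_gt_zero[of "-B"] by linarith
  \<comment> \<open>Passing to \<open>g\<close> costs at most \<open>d\<close> in the integral of
    \<phi> and at most \<open>exp B * d / Z\<close> in the logarithm; together this is
    \<open>e\<close>.\<close>
  define d where "d = e / (1 + exp B / Z)"
  have dd: "0 < 1 + exp B / Z" using Z0 by (simp add: add_pos_pos)
  have d: "d > 0" using \<open>0 < e\<close> dd by (simp add: d_def)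
  obtain g where g: "g \<in> bcont euclidean" "\<And>x. \<bar>g x\<bar> \<le> B"
    "(\<integral>x. \<bar>\<phi> x - g x\<bar> \<partial>lam) < d" "(\<integral>x. \<bar>\<phi> x - g x\<bar> \<partial>lam0) < d"
    using bounded_L1_dense_two[OF l l0 \<phi> d] by metis
  have gm: "g \<in> borel_measurable borel" using bcont_borel_measurable[OF g(1), of borel] by simp
  have \<phi>i: "integrable lam \<phi>" using \<phi> by (intro l.integrable_const_bound[of _ B]) (auto simp: measurable_cong_sets[OF s refl])
  have \<phi>i0: "integrable lam0 \<phi>" using \<phi> by (intro l0.integrable_const_bound[of _ B]) (auto simp: measurable_cong_sets[OF s0 refl])
  have gi: "integrable lam g" "integrable lam0 g" using bcont_integrable g(1) l l0 by auto
  have "(\<integral>x. \<phi> x \<partial>lam) - (\<integral>x. g x \<partial>lam) = (\<integral>x. \<phi> x - g x \<partial>lam)" using \<phi>i gi by simp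
  also have "\<dots> \<le> (\<integral>x. \<bar>\<phi> x - g x\<bar> \<partial>lam)" using \<phi>i gi by (intro integral_mono) auto
  finally have 1: "(\<integral>x. \<phi> x \<partial>lam) \<le> (\<integral>x. g x \<partial>lam) + d" using g by linarith
  have lip: "exp (g x) - exp (\<phi> x) \<le> exp B * \<bar>\<phi> x - g x\<bar>" for x
  proof (cases "g x \<le> \<phi> x")
    case True
    then have "exp (g x) - exp (\<phi> x) \<le> 0" by simp
    also have "0 \<le> exp B * \<bar>\<phi> x - g x\<bar>" by simp
    finally show ?thesis .
  next
    case False
    have "exp (g x) - exp (\<phi> x) = exp (g x) * (1 - exp (\<phi> x - g x))" by (simp add: exp_diff field_simps)
    also have "\<dots> \<le> exp (g x) * (g x - \<phi> x)"
    proof (rule mult_left_mono)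
      show "1 - exp (\<phi> x - g x) \<le> g x - \<phi> x" using exp_ge_add_one_self[of "\<phi> x - g x"] by linarith
    qed simp
    also have "\<dots> \<le> exp B * (g x - \<phi> x)" using g(2)[of x] False by (intro mult_right_mono) auto
    finally show ?thesis using False by simp
  qed
  have "(\<integral>x. exp (g x) \<partial>lam0) - Z = (\<integral>x. exp (g x) - exp (\<phi> x) \<partial>lam0)"
    using ei[OF \<phi>] ei[OF gm g(2)] by (simp add: Z_def)
  also have "\<dots> \<le> (\<integral>x. exp B * \<bar>\<phi> x - g x\<bar> \<partial>lam0)"
    using lip ei[OF \<phi>] ei[OF gm g(2)] \<phi>i0 gi by (intro integral_mono) auto
  also have "\<dots> \<le> exp B * d" using g(4) by simp
  finally have "(\<integral>x. exp (g x) \<partial>lam0) \<le> Z + exp B * d" by simp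
  also have "\<dots> = Z * (1 + exp B * d / Z)" using Z0 by (simp add: field_simps)
  finally have 2: "(\<integral>x. exp (g x) \<partial>lam0) \<le> Z * (1 + exp B * d / Z)" .
  have gpos: "0 < (\<integral>x. exp (g x) \<partial>lam0)" using ei[OF gm g(2)] exp_gt_zero[of "-B"] by linarith
  have p1: "0 < 1 + exp B * d / Z" using Z0 d by (simp add: add_pos_pos)
  have "ln (\<integral>x. exp (g x) \<partial>lam0) \<le> ln (Z * (1 + exp B * d / Z))" using 2 gpos by (subst ln_le_cancel_iff) auto
  also have "\<dots> = ln Z + ln (1 + exp B * d / Z)" using Z0 p1 by (simp add: ln_mult)
  also have "\<dots> \<le> ln Z + exp B * d / Z" using Z0 d ln_add_one_self_le_self[of "exp B * d / Z"] by simp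
  finally have 3: "ln (\<integral>x. exp (g x) \<partial>lam0) \<le> ln Z + exp B * d / Z" .
  have "(\<integral>x. \<phi> x \<partial>lam) \<le> L + ln Z + (d + exp B * d / Z)" using 1 3 dv[OF g(1)] by linarith
  also have "d + exp B * d / Z = d * (1 + exp B / Z)" by (simp add: algebra_simps)
  also have "\<dots> = e" unfolding d_def using dd by simp
  finally show "(\<integral>x. \<phi> x \<partial>lam) \<le> L + ln (\<integral>x. exp (\<phi> x) \<partial>lam0) + e" by (simp add: Z_def)
qed

text \<open>Testing with \<open>n\<close> times the indicator of a null set \<open>B\<close> gives
  \<open>n * measure lam B \<le> L\<close> for all \<open>n\<close>, hence absolute continuity. The
  optimal test function would be the logarithm of the density; it is truncated to [-n, n], and
  Fatou's lemma removes the truncation.\<close>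

theorem relent_le_of_dv:
  fixes lam0 lam :: "'w::polish_space measure"
  assumes l0: "lam0 \<in> probs_on euclidean" and l: "lam \<in> probs_on euclidean"
    and dv: "\<And>\<phi>. \<phi> \<in> bcont euclidean \<Longrightarrow> (\<integral>x. \<phi> x \<partial>lam) \<le> L + ln (\<integral>x. exp (\<phi> x) \<partial>lam0)"
  shows "relent lam0 lam \<le> ereal L"
proof -
  interpret l0: prob_space lam0 using l0 by (simp add: probs_on_euclidean)
  interpret l: prob_space lam using l by (simp add: probs_on_euclidean)
  have s0: "sets lam0 = sets borel" and s: "sets lam = sets borel" using l0 l by (auto simp: probs_on_euclidean)
  have dvm: "(\<integral>x. \<phi> x \<partial>lam) \<le> L + ln (\<integral>x. exp (\<phi> x) \<partial>lam0)"
    if "\<phi> \<in> borel_measurable borel" "\<And>x. \<bar>\<phi> x\<bar> \<le> B" for \<phi> B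
    by (rule dv_bounded_measurable[OF l0 l dv that])
  have ac: "absolutely_continuous lam0 lam"
    unfolding absolutely_continuous_def
  proof
    fix B assume B: "B \<in> null_sets lam0"
    then have Bb: "B \<in> sets borel" using s0 by auto
    have "real n * measure lam B \<le> L" for n :: nat
    proof -
      have "(\<integral>x. real n * indicator B x \<partial>lam) \<le> L + ln (\<integral>x. exp (real n * indicator B x) \<partial>lam0)"
        using Bb by (intro dvm[of _ "real n"]) (auto simp: indicator_def)
      also have "(\<integral>x. exp (real n * indicator B x) \<partial>lam0) = (\<integral>x. 1 \<partial>lam0)"
      proof (rule integral_cong_AE)
        show "AE x in lam0. exp (real n * indicator B x) = 1"
          using AE_not_in[OF B] by eventually_elim (simp add: indicator_def)
      qed (use Bb in \<open>auto simp: measurable_cong_sets[OF s0 refl]\<close>)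
      finally show ?thesis using Bb s by (simp add: l0.prob_space)
    qed
    then have "measure lam B \<le> 0"
      using reals_Archimedean3[of "measure lam B"] by (metis linorder_not_le)
    then have "measure lam B = 0" using measure_nonneg[of lam B] by linarith
    then show "B \<in> null_sets lam" using Bb s by (auto simp: null_sets_def l.emeasure_eq_measure)
  qed
  have sets: "sets lam = sets lam0" using s s0 by simp
  define f where "f = (\<lambda>x. enn2real (RN_deriv lam0 lam x))"
  note d = relent_density[OF l0.prob_space_axioms l.prob_space_axioms ac sets f_def]
  have f0: "f x \<ge> 0" for x by (simp add: f_def)
  have [measurable]: "f \<in> borel_measurable borel" using d(1) by (simp add: measurable_cong_sets[OF s0 refl])
  note [measurable] = d(1)
  define P where "P = (\<integral>\<^sup>+x. ennreal (f x * ln (f x)) \<partial>lam0)"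
  define N where "N = (\<integral>\<^sup>+x. ennreal (- (f x * ln (f x))) \<partial>lam0)"
  have N: "N < top" using d(4) unfolding N_def by (simp add: order_le_less_trans[OF _ ennreal_one_less_top])
  have fint: "integrable lam0 f" and f1: "(\<integral>x. f x \<partial>lam0) = 1"
  proof -
    have "(\<integral>\<^sup>+x. ennreal (f x) \<partial>lam0) = emeasure lam (space lam0)"
      by (subst d(2)) (simp add: emeasure_density cong: nn_integral_cong)
    also have "\<dots> = 1" using l.emeasure_space_1 sets_eq_imp_space_eq[OF sets] by simp
    finally have *: "(\<integral>\<^sup>+x. ennreal (f x) \<partial>lam0) = 1" .
    then show "integrable lam0 f" using f0 by (intro integrableI_nonneg) auto
    then show "(\<integral>x. f x \<partial>lam0) = 1" using * f0 by (simp add: integral_eq_nn_integral)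
  qed
  have nint: "integrable lam0 (\<lambda>x. max 0 (- (f x * ln (f x))))"
    using neg_xlnx_le[OF f0] by (intro l0.integrable_const_bound[of _ 1]) auto
  define N' where "N' = (\<integral>x. max 0 (- (f x * ln (f x))) \<partial>lam0)"
  have NN': "N = ennreal N'"
    unfolding N_def N'_def using nint by (subst nn_integral_eq_integral[symmetric]) (auto simp: ennreal_max_0)
  \<comment> \<open>Where the density vanishes \<psi> takes its lowest value -n, so that
    \<open>exp (\<psi> n x) \<le> f x + exp (- real n)\<close> holds everywhere and the logarithmic
    term is at most \<open>exp (- real n)\<close>.\<close>
  define \<psi> where "\<psi> n x = (if f x = 0 then - real n else max (- real n) (min (real n) (ln (f x))))" for n x
  have \<psi>m [measurable]: "\<psi> n \<in> borel_measurable borel" for n unfolding \<psi>_def by measurable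
  have \<psi>m0 [measurable]: "\<psi> n \<in> borel_measurable lam0" for n using \<psi>m by (simp add: measurable_cong_sets[OF s0 refl])
  have \<psi>b: "\<bar>\<psi> n x\<bar> \<le> real n" for n x by (auto simp: \<psi>_def abs_le_iff)
  \<comment> \<open>Fatou's lemma needs nonnegative integrands, hence the positive part of \<psi>.
    The cost is at most the integral \<open>N'\<close> of the negative part of
    \<open>f ln f\<close>, which cancels at the end against the negative part in
    \<open>relent\<close>.\<close>
  have up: "(\<integral>x. f x * max 0 (\<psi> n x) \<partial>lam0) \<le> L + exp (- real n) + N'" for n
  proof -
    have fi: "integrable lam0 (\<lambda>x. f x * h x)" if "h \<in> borel_measurable lam0" "\<And>x. \<bar>h x\<bar> \<le> real n" for h
    proof (rule Bochner_Integration.integrable_bound[of _ "\<lambda>x. real n * f x"])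
      show "AE x in lam0. norm (f x * h x) \<le> norm (real n * f x)"
        using f0 that(2) by (auto simp: abs_mult mult.commute[of "real n"] intro!: mult_left_mono)
    qed (use fint that in auto)
    have ei: "integrable lam0 (\<lambda>x. exp (\<psi> n x))"
      using \<psi>b[of n] by (intro l0.integrable_const_bound[of _ "exp (real n)"]) (auto simp: abs_le_iff)
    have "(\<integral>x. exp (\<psi> n x) \<partial>lam0) \<le> (\<integral>x. f x + exp (- real n) \<partial>lam0)"
    proof (rule integral_mono)
      fix x
      show "exp (\<psi> n x) \<le> f x + exp (- real n)"
      proof (cases "f x = 0")
        case False
        then have fp: "f x > 0" using f0[of x] by simp
        have "exp (\<psi> n x) \<le> exp (max (- real n) (ln (f x)))" using False by (auto simp: \<psi>_def)
        also have "\<dots> \<le> f x + exp (- real n)" using fp by (auto simp: max_def)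
        finally show ?thesis .
      qed (simp add: \<psi>_def)
    qed (use ei fint in auto)
    also have "\<dots> = 1 + exp (- real n)" using fint f1 by (simp add: l0.prob_space)
    finally have e1: "(\<integral>x. exp (\<psi> n x) \<partial>lam0) \<le> 1 + exp (- real n)" .
    have "0 < exp (- real n)" by simp
    also have "exp (- real n) \<le> (\<integral>x. exp (\<psi> n x) \<partial>lam0)"
    proof -
      have "(\<integral>x. exp (- real n) \<partial>lam0) \<le> (\<integral>x. exp (\<psi> n x) \<partial>lam0)"
        using \<psi>b[of n] ei by (intro integral_mono) (auto simp: abs_le_iff minus_le_iff)
      then show ?thesis by (simp add: l0.prob_space)
    qed
    finally have "ln (\<integral>x. exp (\<psi> n x) \<partial>lam0) \<le> ln (1 + exp (- real n))"
      using e1 by (subst ln_le_cancel_iff) (auto intro: add_pos_pos)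
    also have "\<dots> \<le> exp (- real n)" by (rule ln_add_one_self_le_self) simp
    finally have "(\<integral>x. \<psi> n x \<partial>lam) \<le> L + exp (- real n)"
      using dvm[OF \<psi>m \<psi>b, of n] by linarith
    moreover have "(\<integral>x. \<psi> n x \<partial>lam) = (\<integral>x. f x * \<psi> n x \<partial>lam0)"
      using f0 by (subst d(2)) (simp add: integral_density)
    moreover have "(\<integral>x. f x * max 0 (\<psi> n x) \<partial>lam0) \<le> (\<integral>x. f x * \<psi> n x + max 0 (- (f x * ln (f x))) \<partial>lam0)"
    proof (rule integral_mono)
      show "integrable lam0 (\<lambda>x. f x * max 0 (\<psi> n x))" using \<psi>b[of n] by (intro fi) (auto simp: abs_le_iff)
      show "integrable lam0 (\<lambda>x. f x * \<psi> n x + max 0 (- (f x * ln (f x))))"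
        using fi[OF \<psi>m0 \<psi>b] nint by auto
      fix x
      show "f x * max 0 (\<psi> n x) \<le> f x * \<psi> n x + max 0 (- (f x * ln (f x)))"
      proof (cases "f x = 0 \<or> 0 \<le> \<psi> n x")
        case False
        then have "ln (f x) \<le> \<psi> n x" by (auto simp: \<psi>_def max_def min_def split: if_splits)
        then have "f x * ln (f x) \<le> f x * \<psi> n x" using f0 by (intro mult_left_mono) auto
        then show ?thesis using False by (auto simp: max_def)
      qed (auto simp: max_def)
    qed
    ultimately show ?thesis using fi[OF \<psi>m0 \<psi>b] nint by (simp add: N'_def)
  qed
  have P_le: "P \<le> ennreal (L + N')"
  proof -
    \<comment> \<open>At each point the truncation is inactive as soon as \<open>n\<close> exceeds
      the absolute value of \<open>ln (f x)\<close>.\<close>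
    have "P \<le> (\<integral>\<^sup>+x. liminf (\<lambda>n. ennreal (f x * max 0 (\<psi> n x))) \<partial>lam0)"
      unfolding P_def
    proof (rule nn_integral_mono)
      fix x
      obtain k :: nat where k: "\<bar>ln (f x)\<bar> \<le> real k" using real_arch_simple by blast
      have "f x * ln (f x) \<le> f x * max 0 (\<psi> n x)" if "n \<ge> k" for n
      proof (cases "f x = 0")
        case False
        have "\<bar>ln (f x)\<bar> \<le> real n" using k that by linarith
        then have "\<psi> n x = ln (f x)" using False by (auto simp: \<psi>_def max_def min_def)
        then show ?thesis using f0[of x] by (simp add: mult_left_mono)
      qed simp
      then have "\<forall>\<^sub>F n in sequentially. ennreal (f x * ln (f x)) \<le> ennreal (f x * max 0 (\<psi> n x))"
        by (intro eventually_sequentiallyI[of k] ennreal_leI)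
      then show "ennreal (f x * ln (f x)) \<le> liminf (\<lambda>n. ennreal (f x * max 0 (\<psi> n x)))"
        by (rule Liminf_bounded)
    qed
    also have "\<dots> \<le> liminf (\<lambda>n. \<integral>\<^sup>+x. ennreal (f x * max 0 (\<psi> n x)) \<partial>lam0)"
      by (rule nn_integral_liminf) measurable
    also have "\<dots> \<le> liminf (\<lambda>n. ennreal (L + exp (- real n) + N'))"
    proof (intro Liminf_mono always_eventually allI)
      fix n
      have "integrable lam0 (\<lambda>x. f x * max 0 (\<psi> n x))"
      proof (rule Bochner_Integration.integrable_bound[of _ "\<lambda>x. real n * f x"])
        show "AE x in lam0. norm (f x * max 0 (\<psi> n x)) \<le> norm (real n * f x)"
          using f0 \<psi>b[of n] by (auto simp: abs_mult mult.commute[of "real n"] abs_le_iff intro!: mult_left_mono)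
      qed (use fint in auto)
      then show "(\<integral>\<^sup>+x. ennreal (f x * max 0 (\<psi> n x)) \<partial>lam0) \<le> ennreal (L + exp (- real n) + N')"
        using up[of n] f0 by (subst nn_integral_eq_integral) (auto intro!: ennreal_leI)
    qed
    also have "\<dots> = ennreal (L + N')"
    proof (intro lim_imp_Liminf tendsto_ennrealI)
      have "(\<lambda>n. exp (- real n)) \<longlonglongrightarrow> 0"
        using filterlim_compose[OF exp_at_bot filterlim_compose[OF filterlim_uminus_at_bot_at_top filterlim_real_sequentially]] .
      then have "(\<lambda>n. L + exp (- real n) + N') \<longlonglongrightarrow> L + 0 + N'" by (intro tendsto_intros)
      then show "(\<lambda>n. L + exp (- real n) + N') \<longlonglongrightarrow> L + N'" by simp
    qed simp
    finally show ?thesis .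
  qed
  have "0 \<le> L" using dv[OF bcont_const, of 0] by (simp add: l0.prob_space)
  moreover have "0 \<le> N'" unfolding N'_def by simp
  ultimately have "enn2ereal P - enn2ereal N \<le> ereal (L + N') - ereal N'"
    using P_le unfolding NN' by (intro ereal_minus_mono) (auto simp: less_eq_ennreal.rep_eq enn2ereal_ennreal simp del: ennreal_plus)
  then show ?thesis using d(3) by (simp add: P_def N_def)
qed

text \<open>Tensorization by integrating out one coordinate at a time: the inequality for a single
  factor, applied in coordinate \<open>i\<close>, costs \<open>h\<close> and replaces \<phi> by the
  logarithm \<phi>' of its exponential integral over that coordinate; by Fubini the exponential
  integral of \<phi>' equals that of \<phi>.\<close>

lemma donsker_varadhan_PiM:
  fixes lam0 lam :: "'a measure"
  assumes p0: "prob_space lam0" and p: "prob_space lam" and H: "relent lam0 lam \<le> ereal h"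
    and I: "finite I"
    and \<phi>: "\<phi> \<in> borel_measurable (PiM I (\<lambda>_. lam0))" "\<And>x. \<bar>\<phi> x\<bar> \<le> (B::real)"
  shows "(\<integral>x. \<phi> x \<partial>PiM I (\<lambda>_. lam)) \<le> real (card I) * h + ln (\<integral>x. exp (\<phi> x) \<partial>PiM I (\<lambda>_. lam0))"
  using I \<phi>
proof (induction I arbitrary: \<phi>)
  case empty
  show ?case by (simp add: PiM_empty lebesgue_integral_count_space_finite)
next
  case (insert i I)
  have sets: "sets lam = sets lam0" using H by (auto simp: relent_def split: if_splits)
  interpret l0: prob_space lam0 by fact
  interpret l: prob_space lam by fact
  interpret P0: product_prob_space "\<lambda>_. lam0" I by unfold_locales
  interpret P: product_prob_space "\<lambda>_. lam" I by unfold_locales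
  interpret Q0: product_prob_space "\<lambda>_. lam0" "insert i I" by unfold_locales
  interpret Q: product_prob_space "\<lambda>_. lam" "insert i I" by unfold_locales
  have sPiM: "sets (PiM J (\<lambda>_. lam)) = sets (PiM J (\<lambda>_. lam0))" for J
    by (intro sets_PiM_cong) (auto simp: sets)
  have upd: "(\<lambda>(x, y). \<phi> (x(i := y))) \<in> borel_measurable (PiM I (\<lambda>_. lam0) \<Otimes>\<^sub>M lam0)"
    using measurable_comp[OF measurable_add_dim insert.prems(1)] by (simp add: comp_def case_prod_beta)
  have upd': "(\<lambda>y. \<phi> (x(i := y))) \<in> borel_measurable lam0" if "x \<in> space (PiM I (\<lambda>_. lam0))" for x
    using measurable_comp[OF measurable_component_update[OF that insert.hyps(2)] insert.prems(1)]
    by (simp add: comp_def)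
  have ei: "integrable lam0 (\<lambda>y. exp (\<phi> (x(i := y)))) \<and> exp (-B) \<le> (\<integral>y. exp (\<phi> (x(i := y))) \<partial>lam0)
      \<and> (\<integral>y. exp (\<phi> (x(i := y))) \<partial>lam0) \<le> exp B" if x: "x \<in> space (PiM I (\<lambda>_. lam0))" for x
  proof (intro conjI)
    show i: "integrable lam0 (\<lambda>y. exp (\<phi> (x(i := y))))"
      using upd'[OF x] insert.prems(2) by (intro l0.integrable_const_bound[of _ "exp B"]) (auto simp: abs_le_iff)
    have "(\<integral>x. exp (- B) \<partial>lam0) \<le> (\<integral>y. exp (\<phi> (x(i := y))) \<partial>lam0)"
      using insert.prems(2) i by (intro integral_mono) (auto simp: abs_le_iff minus_le_iff)
    then show "exp (-B) \<le> (\<integral>y. exp (\<phi> (x(i := y))) \<partial>lam0)" by (simp add: l0.prob_space)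
    have "(\<integral>y. exp (\<phi> (x(i := y))) \<partial>lam0) \<le> (\<integral>x. exp B \<partial>lam0)"
      using insert.prems(2) i by (intro integral_mono) (auto simp: abs_le_iff minus_le_iff)
    then show "(\<integral>y. exp (\<phi> (x(i := y))) \<partial>lam0) \<le> exp B" by (simp add: l0.prob_space)
  qed
  \<comment> \<open>Clipping changes nothing on the product space, but the induction hypothesis asks
    for a bound at every function, also outside that space.\<close>
  define \<phi>' where "\<phi>' x = max (-B) (min B (ln (\<integral>y. exp (\<phi> (x(i := y))) \<partial>lam0)))" for x
  have \<phi>'eq: "\<phi>' x = ln (\<integral>y. exp (\<phi> (x(i := y))) \<partial>lam0)" if x: "x \<in> space (PiM I (\<lambda>_. lam0))" for x
  proof -
    have p: "0 < (\<integral>y. exp (\<phi> (x(i := y))) \<partial>lam0)"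
      using ei[OF x] exp_gt_zero[of "-B"] by linarith
    have "ln (\<integral>y. exp (\<phi> (x(i := y))) \<partial>lam0) \<le> B" "-B \<le> ln (\<integral>y. exp (\<phi> (x(i := y))) \<partial>lam0)"
      using ei[OF x] p ln_le_cancel_iff[of _ "exp B"] ln_le_cancel_iff[of "exp (-B)"] by auto
    then show ?thesis by (simp add: \<phi>'_def)
  qed
  have B0: "0 \<le> B" using insert.prems(2)[of undefined] by linarith
  have \<phi>'b: "\<bar>\<phi>' x\<bar> \<le> B" for x using B0 by (auto simp: \<phi>'_def abs_le_iff)
  have \<phi>'m: "\<phi>' \<in> borel_measurable (PiM I (\<lambda>_. lam0))"
  proof -
    have "(\<lambda>(x, y). exp (\<phi> (x(i := y)))) \<in> borel_measurable (PiM I (\<lambda>_. lam0) \<Otimes>\<^sub>M lam0)"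
      using measurable_compose[OF upd borel_measurable_exp] by (simp add: case_prod_beta)
    then have [measurable]: "(\<lambda>x. \<integral>y. exp (\<phi> (x(i := y))) \<partial>lam0) \<in> borel_measurable (PiM I (\<lambda>_. lam0))"
      by (rule l0.borel_measurable_lebesgue_integral)
    show ?thesis unfolding \<phi>'_def by measurable
  qed
  have \<phi>i: "integrable (PiM (insert i I) (\<lambda>_. lam)) \<phi>"
    using insert.prems by (intro Q.integrable_const_bound[of _ B]) (auto simp: measurable_cong_sets[OF sPiM refl])
  have \<phi>e: "integrable (PiM (insert i I) (\<lambda>_. lam0)) (\<lambda>x. exp (\<phi> x))"
    using insert.prems by (intro Q0.integrable_const_bound[of _ "exp B"]) (auto simp: abs_le_iff)
  have spI: "space (PiM I (\<lambda>_. lam)) = space (PiM I (\<lambda>_. lam0))" by (rule sets_eq_imp_space_eq[OF sPiM])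
  have "(\<integral>x. \<phi> x \<partial>PiM (insert i I) (\<lambda>_. lam)) = (\<integral>x. (\<integral>y. \<phi> (x(i := y)) \<partial>lam) \<partial>PiM I (\<lambda>_. lam))"
    by (rule P.product_integral_insert[OF insert.hyps \<phi>i])
  also have "\<dots> \<le> (\<integral>x. h + \<phi>' x \<partial>PiM I (\<lambda>_. lam))"
  proof (rule integral_mono)
    have "(\<lambda>(x, y). \<phi> (x(i := y))) \<in> borel_measurable (PiM I (\<lambda>_. lam) \<Otimes>\<^sub>M lam)"
      using upd measurable_cong_sets[OF sets_pair_measure_cong[OF sPiM sets] refl] by blast
    then have "(\<lambda>x. \<integral>y. \<phi> (x(i := y)) \<partial>lam) \<in> borel_measurable (PiM I (\<lambda>_. lam))"
      by (rule l.borel_measurable_lebesgue_integral)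
    moreover have "\<bar>\<integral>y. \<phi> (x(i := y)) \<partial>lam\<bar> \<le> B" for x
    proof -
      have "\<bar>\<integral>y. \<phi> (x(i := y)) \<partial>lam\<bar> \<le> (\<integral>y. B \<partial>lam)"
        using insert.prems(2) B0 by (intro integral_abs_bound_integral[THEN order_trans] order_refl integral_abs_bound[THEN order_trans] integral_mono') auto
      then show ?thesis by (simp add: l.prob_space)
    qed
    ultimately show "integrable (PiM I (\<lambda>_. lam)) (\<lambda>x. \<integral>y. \<phi> (x(i := y)) \<partial>lam)"
      by (intro P.integrable_const_bound[of _ B]) auto
    have "integrable (PiM I (\<lambda>_. lam)) \<phi>'"
      using \<phi>'m \<phi>'b by (intro P.integrable_const_bound[of _ B]) (auto simp: measurable_cong_sets[OF sPiM refl])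
    then show "integrable (PiM I (\<lambda>_. lam)) (\<lambda>x. h + \<phi>' x)" by auto
    fix x assume "x \<in> space (PiM I (\<lambda>_. lam))"
    then have x: "x \<in> space (PiM I (\<lambda>_. lam0))" using spI by simp
    show "(\<integral>y. \<phi> (x(i := y)) \<partial>lam) \<le> h + \<phi>' x"
      unfolding \<phi>'eq[OF x] by (rule donsker_varadhan_le[OF p0 p H upd'[OF x] insert.prems(2)])
  qed
  also have "\<dots> = h + (\<integral>x. \<phi>' x \<partial>PiM I (\<lambda>_. lam))"
  proof -
    have "integrable (PiM I (\<lambda>_. lam)) \<phi>'"
      using \<phi>'m \<phi>'b by (intro P.integrable_const_bound[of _ B]) (auto simp: measurable_cong_sets[OF sPiM refl])
    moreover have "prob_space (PiM I (\<lambda>_. lam))" using p by (intro prob_space_PiM)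
    ultimately show ?thesis by (simp add: prob_space.prob_space)
  qed
  also have "\<dots> \<le> h + (real (card I) * h + ln (\<integral>x. exp (\<phi>' x) \<partial>PiM I (\<lambda>_. lam0)))"
    using insert.IH[OF \<phi>'m \<phi>'b] by simp
  also have "(\<integral>x. exp (\<phi>' x) \<partial>PiM I (\<lambda>_. lam0)) = (\<integral>x. (\<integral>y. exp (\<phi> (x(i := y))) \<partial>lam0) \<partial>PiM I (\<lambda>_. lam0))"
  proof (intro Bochner_Integration.integral_cong refl)
    fix x assume x: "x \<in> space (PiM I (\<lambda>_. lam0))"
    have "0 < (\<integral>y. exp (\<phi> (x(i := y))) \<partial>lam0)" using ei[OF x] exp_gt_zero[of "-B"] by linarith
    then show "exp (\<phi>' x) = (\<integral>y. exp (\<phi> (x(i := y))) \<partial>lam0)" by (simp add: \<phi>'eq[OF x])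
  qed
  also have "\<dots> = (\<integral>x. exp (\<phi> x) \<partial>PiM (insert i I) (\<lambda>_. lam0))"
    by (rule P0.product_integral_insert[OF insert.hyps \<phi>e, symmetric])
  finally show ?case using insert.hyps by (simp add: algebra_simps)
qed

subsection \<open>Empirical measures\<close>

text \<open>Balls of radius \<open>1 / Suc n\<close> about a finite net, for every \<open>n\<close>.
  The class \<open>metric_space\<close> carries no countability, so compactness has to supply
  it.\<close>

lemma compact_countable_basis:
  assumes "compact (UNIV :: 'x::metric_space set)"
  obtains B :: "('x::metric_space) set set" where "countable B" "\<And>b. b \<in> B \<Longrightarrow> open b"
    "\<And>U x. open U \<Longrightarrow> x \<in> U \<Longrightarrow> \<exists>b\<in>B. x \<in> b \<and> b \<subseteq> U"
proof -
  have "\<exists>D. finite D \<and> (UNIV :: 'x set) \<subseteq> (\<Union>a\<in>D. ball a (1 / real (Suc n)))" for n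
    using compactE_image[OF assms, of UNIV "\<lambda>a. ball a (1 / real (Suc n))"]
    by (metis UNIV_I UN_I centre_in_ball open_ball subsetI of_nat_0_less_iff zero_less_Suc zero_less_divide_1_iff)
  then obtain D where D: "\<And>n. finite (D n)" "\<And>n. (UNIV :: 'x set) \<subseteq> (\<Union>a\<in>D n. ball a (1 / real (Suc n)))"
    by metis
  show ?thesis
  proof (rule that[of "\<Union>n. (\<lambda>a. ball a (1 / real (Suc n))) ` D n"])
    show "countable (\<Union>n. (\<lambda>a. ball a (1 / real (Suc n))) ` D n)"
      by (intro countable_UN countable_image countable_finite[OF D(1)]) simp
    show "\<And>b. b \<in> (\<Union>n. (\<lambda>a. ball a (1 / real (Suc n))) ` D n) \<Longrightarrow> open b" by auto
    fix U and x :: 'x assume "open U" "x \<in> U"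
    then obtain e where e: "e > 0" "ball x e \<subseteq> U" using open_contains_ball by blast
    obtain n where n: "1 / real (Suc n) < e / 2" using e(1) nat_approx_posE[of "e/2"] by auto
    obtain a where a: "a \<in> D n" "x \<in> ball a (1 / real (Suc n))" using D(2)[of n] by blast
    have "ball a (1 / real (Suc n)) \<subseteq> ball x e"
    proof
      fix z assume "z \<in> ball a (1 / real (Suc n))"
      then have "dist a z < e / 2" "dist a x < e / 2" using a(2) n by (auto simp: mem_ball simp del: of_nat_Suc)
      then show "z \<in> ball x e" using dist_triangle3[of x z a] by (simp add: mem_ball)
    qed
    then show "\<exists>b\<in>\<Union>n. (\<lambda>a. ball a (1 / real (Suc n))) ` D n. x \<in> b \<and> b \<subseteq> U"
      using a e(2) by blast
  qed
qed

text \<open>With a countable base of boxes every open set of the product is a countable union of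
  boxes. This links Borel sets of the product to those of the factors; measurability of pairs,
  supports and separating families all rest on it.\<close>

lemma countable_box_basis:
  assumes "compact (UNIV :: 'x::metric_space set)"
  obtains \<B> :: "('w::second_countable_topology \<times> ('x::metric_space)) set set" where "countable \<B>"
    "\<And>D. D \<in> \<B> \<Longrightarrow> \<exists>U V. open U \<and> open V \<and> D = U \<times> V"
    "\<And>S p. open S \<Longrightarrow> p \<in> S \<Longrightarrow> \<exists>D\<in>\<B>. p \<in> D \<and> D \<subseteq> S"
proof -
  obtain B :: "'x set set" where B: "countable B" "\<And>b. b \<in> B \<Longrightarrow> open b"
    "\<And>U x. open U \<Longrightarrow> x \<in> U \<Longrightarrow> \<exists>b\<in>B. x \<in> b \<and> b \<subseteq> U"
    using compact_countable_basis[OF assms] by metis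
  obtain E :: "'w set set" where E: "countable E" "topological_basis E"
    using ex_countable_basis by blast
  show ?thesis
  proof (rule that[of "(\<lambda>(U, V). U \<times> V) ` (E \<times> B)"])
    show "countable ((\<lambda>(U, V). U \<times> V) ` (E \<times> B))" using B(1) E(1) by auto
    show "\<And>D. D \<in> (\<lambda>(U, V). U \<times> V) ` (E \<times> B) \<Longrightarrow> \<exists>U V. open U \<and> open V \<and> D = U \<times> V"
      using B(2) topological_basis_open[OF E(2)] by auto
    fix S :: "('w \<times> 'x) set" and p assume S: "open S" "p \<in> S"
    obtain w x where p: "p = (w, x)" by force
    from S obtain U V where UV: "open U" "open V" "w \<in> U" "x \<in> V" "U \<times> V \<subseteq> S"
      by (auto elim!: open_prod_elim simp: p)
    obtain U' where "U' \<in> E" "w \<in> U'" "U' \<subseteq> U" using topological_basisE[OF E(2) UV(1,3)] by metis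
    moreover obtain V' where "V' \<in> B" "x \<in> V'" "V' \<subseteq> V" using B(3)[OF UV(2,4)] by metis
    ultimately show "\<exists>D\<in>(\<lambda>(U, V). U \<times> V) ` (E \<times> B). p \<in> D \<and> D \<subseteq> S"
      using UV(5) p by (intro bexI[of _ "U' \<times> V'"]) auto
  qed
qed

lemma borel_measurable_Pair_compact:
  fixes f :: "'a \<Rightarrow> 'w::second_countable_topology" and g :: "'a \<Rightarrow> 'x::metric_space"
  assumes cpt: "compact (UNIV :: 'x set)"
    and f: "f \<in> borel_measurable M" and g: "g \<in> borel_measurable M"
  shows "(\<lambda>\<omega>. (f \<omega>, g \<omega>)) \<in> borel_measurable M"
proof (rule borel_measurableI)
  fix S :: "('w \<times> 'x) set" assume S: "open S"
  obtain \<B> :: "('w \<times> 'x) set set" where \<B>: "countable \<B>"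
    "\<And>D. D \<in> \<B> \<Longrightarrow> \<exists>U V. open U \<and> open V \<and> D = U \<times> V"
    "\<And>S p. open S \<Longrightarrow> p \<in> S \<Longrightarrow> \<exists>D\<in>\<B>. p \<in> D \<and> D \<subseteq> S"
    using countable_box_basis[OF cpt] by metis
  have "(\<lambda>\<omega>. (f \<omega>, g \<omega>)) -` S \<inter> space M = (\<Union>D\<in>{D \<in> \<B>. D \<subseteq> S}. (\<lambda>\<omega>. (f \<omega>, g \<omega>)) -` D \<inter> space M)"
    using \<B>(3)[OF S] by fastforce
  also have "\<dots> \<in> sets M"
  proof (intro sets.countable_UN'')
    show "countable {D \<in> \<B>. D \<subseteq> S}" using \<B>(1) by simp
    fix D assume "D \<in> {D \<in> \<B>. D \<subseteq> S}"
    then have "D \<in> \<B>" by simp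
    then obtain U V where UV: "open U" "open V" "D = U \<times> V" using \<B>(2) by metis
    have "(\<lambda>\<omega>. (f \<omega>, g \<omega>)) -` D \<inter> space M = (f -` U \<inter> space M) \<inter> (g -` V \<inter> space M)"
      using UV by auto
    then show "(\<lambda>\<omega>. (f \<omega>, g \<omega>)) -` D \<inter> space M \<in> sets M"
      using measurable_sets[OF f, of U] measurable_sets[OF g, of V] UV by auto
  qed
  finally show "(\<lambda>\<omega>. (f \<omega>, g \<omega>)) -` S \<inter> space M \<in> sets M" .
qed

section \<open>Integrals and masses under empirical measures\<close>

lemma emp_probs: "emp n w x \<in> probs_on euclidean"
  unfolding probs_on_euclidean emp_def by (auto intro!: measure_pmf.prob_space_distr)

text \<open>\<open>n > 0\<close> matters: \<open>pmf_of_set\<close> is unspecified on the empty set,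
  so of \<open>emp 0\<close> it is known only that it is a probability measure.\<close>

lemma integral_emp:
  fixes f :: "_ \<Rightarrow> real"
  assumes "n > 0" "f \<in> borel_measurable borel"
  shows "(\<integral>p. f p \<partial>emp n w x) = (\<Sum>k<n. f (w k, x k)) / real n"
  unfolding emp_def using assms
  by (subst integral_distr) (auto simp: integral_pmf_of_set lessThan_empty_iff)

lemma emp_cong:
  assumes "\<And>k. k < n \<Longrightarrow> w k = w' k" "\<And>k. k < n \<Longrightarrow> x k = x' k" "n > 0"
  shows "emp n w x = emp n w' x'"
  unfolding emp_def using assms
  by (intro distr_cong_AE) (auto simp: AE_measure_pmf_iff set_pmf_of_set lessThan_empty_iff)

text \<open>This turns positive mass near a non-optimal pair into an actual player with such a type
  and action.\<close>

lemma emp_pos: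
  assumes "n > 0" "S \<in> sets borel" "measure (emp n w x) S > 0"
  obtains i where "i < n" "(w i, x i) \<in> S"
proof -
  have "measure (emp n w x) S = (\<integral>p. indicator S p \<partial>emp n w x)"
    using assms(2) by (simp add: emp_def)
  also have "\<dots> = (\<Sum>k<n. indicator S (w k, x k)) / real n"
    using assms by (intro integral_emp) auto
  finally have "(\<Sum>k<n. indicator S (w k, x k)) \<noteq> (0::real)" using assms(3) by auto
  then obtain i where "i < n" "indicator S (w i, x i) \<noteq> (0::real)"
    by (metis (no_types, lifting) lessThan_iff sum.neutral)
  then show ?thesis by (intro that[of i]) (auto simp: indicator_def split: if_splits)
qed

section \<open>Weakly open sets given by integrals and masses; supports\<close>

lemma openin_integral_nbhd:
  assumes "finite J" "J \<subseteq> bcont X"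
  shows "openin (weak_top X) {m' \<in> probs_on X. \<forall>f\<in>J. \<bar>(\<integral>x. f x \<partial>m') - c f\<bar> < \<epsilon>}"
  using assms
proof (induction J)
  case empty
  show ?case using openin_topspace[of "weak_top X"] by simp
next
  case (insert f J)
  have "openin (weak_top X) {m' \<in> topspace (weak_top X). (\<integral>x. f x \<partial>m') \<in> {c f - \<epsilon><..<c f + \<epsilon>}}"
    using insert.prems by (intro openin_continuous_map_preimage[OF continuous_map_integral]) auto
  then have "openin (weak_top X) ({m' \<in> topspace (weak_top X). (\<integral>x. f x \<partial>m') \<in> {c f - \<epsilon><..<c f + \<epsilon>}}
      \<inter> {m' \<in> probs_on X. \<forall>f\<in>J. \<bar>(\<integral>x. f x \<partial>m') - c f\<bar> < \<epsilon>})"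
    using insert by (intro openin_Int) auto
  also have "\<dots> = {m' \<in> probs_on X. \<forall>f\<in>insert f J. \<bar>(\<integral>x. f x \<partial>m') - c f\<bar> < \<epsilon>}"
    by (auto simp: abs_less_iff)
  finally show ?case .
qed

lemma openin_integral_gt:
  assumes "f \<in> bcont X"
  shows "openin (weak_top X) {m \<in> probs_on X. c < (\<integral>x. f x \<partial>m)}"
  using openin_continuous_map_preimage[OF continuous_map_integral[OF assms], of "{c<..}"] by simp

text \<open>Lower semicontinuity of the mass of an open set: by \<open>measure_open_le\<close> the
  superlevel set is a union of superlevel sets of integrals of test functions.\<close>

lemma openin_measure_gt:
  fixes G :: "'s::metric_space set"
  assumes G: "open G"
  shows "openin (weak_top euclidean) {m \<in> probs_on euclidean. c < measure m G}"
proof -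
  define T where "T = {f \<in> bcont euclidean. \<forall>x. 0 \<le> f x \<and> f x \<le> 1 \<and> (x \<notin> G \<longrightarrow> f x = (0::real))}"
  have le: "(\<integral>x. f x \<partial>m) \<le> measure m G" if f: "f \<in> T" and m: "m \<in> probs_on euclidean" for f and m :: "'s measure"
  proof -
    interpret prob_space m using m by (simp add: probs_on_euclidean)
    have Gm: "G \<in> sets m" using m G by (simp add: probs_on_euclidean)
    have "(\<integral>x. f x \<partial>m) \<le> (\<integral>x. indicator G x \<partial>m)"
    proof (rule integral_mono)
      show "integrable m f" using f m by (intro bcont_integrable) (auto simp: T_def)
      show "integrable m (indicat_real G)" using Gm by (simp add: less_top[symmetric])
      show "f x \<le> indicat_real G x" for x using f by (auto simp: T_def indicator_def)
    qed
    then show ?thesis using Gm by simp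
  qed
  have "{m \<in> probs_on euclidean. c < measure m G} = (\<Union>f\<in>T. {m \<in> probs_on euclidean. c < (\<integral>x. f x \<partial>m)})"
  proof (intro set_eqI iffI)
    fix m assume "m \<in> {m \<in> probs_on euclidean. c < measure m G}"
    then have m: "m \<in> probs_on euclidean" "c < measure m G" by auto
    have "\<exists>f\<in>T. c < (\<integral>x. f x \<partial>m)"
    proof (rule ccontr)
      assume "\<not> ?thesis"
      then have "measure m G \<le> c" by (intro measure_open_le[OF m(1) G]) (force simp: T_def not_less)
      then show False using m(2) by simp
    qed
    then show "m \<in> (\<Union>f\<in>T. {m \<in> probs_on euclidean. c < (\<integral>x. f x \<partial>m)})" using m by auto
  next
    fix m assume "m \<in> (\<Union>f\<in>T. {m \<in> probs_on euclidean. c < (\<integral>x. f x \<partial>m)})"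
    then show "m \<in> {m \<in> probs_on euclidean. c < measure m G}"
      using le by (auto intro: less_le_trans)
  qed
  also have "openin (weak_top euclidean) \<dots>"
    by (intro openin_Union) (auto simp: T_def intro!: openin_integral_gt)
  finally show ?thesis .
qed

text \<open>Otherwise every point of \<open>S\<close> would lie in a null box of the countable base,
  and \<open>S\<close> would be null. The lemma localizes non-optimality at a single pair all of
  whose neighbourhoods are charged.\<close>

lemma support_point:
  fixes m :: "('w::polish_space \<times> 'x::metric_space) measure"
  assumes cpt: "compact (UNIV :: 'x set)" and m: "m \<in> probs_on euclidean"
    and S: "open S" "measure m S > 0"
  obtains p where "p \<in> S" "\<And>G. open G \<Longrightarrow> p \<in> G \<Longrightarrow> measure m G > 0"
proof -
  interpret prob_space m using m by (simp add: probs_on_euclidean)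
  have sm: "sets m = sets borel" using m by (simp add: probs_on_euclidean)
  obtain \<B> :: "('w \<times> 'x) set set" where \<B>: "countable \<B>"
    "\<And>D. D \<in> \<B> \<Longrightarrow> \<exists>U V. open U \<and> open V \<and> D = U \<times> V"
    "\<And>S p. open S \<Longrightarrow> p \<in> S \<Longrightarrow> \<exists>D\<in>\<B>. p \<in> D \<and> D \<subseteq> S"
    using countable_box_basis[OF cpt] by metis
  have \<B>o: "open D" if "D \<in> \<B>" for D using \<B>(2)[OF that] by (auto intro: open_Times)
  have "\<exists>p\<in>S. \<forall>G. open G \<longrightarrow> p \<in> G \<longrightarrow> measure m G > 0"
  proof (rule ccontr)
    assume neg: "\<not> ?thesis"
    have "S \<subseteq> \<Union> {D \<in> \<B>. measure m D = 0}"
    proof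
      fix p assume "p \<in> S"
      then obtain G where G: "open G" "p \<in> G" "measure m G \<le> 0" using neg by (auto simp: not_less)
      then obtain D where D: "D \<in> \<B>" "p \<in> D" "D \<subseteq> G" using \<B>(3) by metis
      have "measure m D \<le> measure m G" using D G sm by (intro finite_measure_mono) auto
      then have "measure m D = 0" using G(3) measure_nonneg[of m D] by linarith
      then show "p \<in> \<Union> {D \<in> \<B>. measure m D = 0}" using D by auto
    qed
    moreover have "\<Union> {D \<in> \<B>. measure m D = 0} \<in> null_sets m"
    proof (rule null_sets_UN'[of "{D \<in> \<B>. measure m D = 0}" "\<lambda>D. D", simplified])
      show "countable {D \<in> \<B>. measure m D = 0}" using \<B>(1) by simp
      show "D \<in> null_sets m" if "D \<in> \<B> \<and> measure m D = 0" for D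
        using that \<B>o sm by (auto simp: null_sets_def emeasure_eq_measure)
    qed
    ultimately have "S \<in> null_sets m" using S sm by (auto intro: null_sets_subset)
    then show False using S by (simp add: null_sets_def emeasure_eq_measure)
  qed
  then show ?thesis using that by metis
qed

text \<open>As a function of the \<open>n\<close> pairs the empirical measure is weakly continuous,
  so the preimage of a weakly open set is open in the space of \<open>n\<close>-tuples;
  measurability follows by writing it as a countable union of products of basic boxes.\<close>

lemma emp_measurable:
  fixes w :: "'a \<Rightarrow> nat \<Rightarrow> 'w::polish_space" and x :: "'a \<Rightarrow> nat \<Rightarrow> 'x::metric_space"
  assumes cpt: "compact (UNIV :: 'x set)" and n: "n > 0"
    and w: "\<And>k. k < n \<Longrightarrow> (\<lambda>\<omega>. w \<omega> k) \<in> borel_measurable M"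
    and x: "\<And>k. k < n \<Longrightarrow> (\<lambda>\<omega>. x \<omega> k) \<in> borel_measurable M"
  shows "(\<lambda>\<omega>. emp n (w \<omega>) (x \<omega>)) \<in> measurable M (borel_of (weak_top euclidean))"
proof (rule measurable_borel_of)
  show "(\<lambda>\<omega>. emp n (w \<omega>) (x \<omega>)) \<in> space M \<rightarrow> topspace (weak_top euclidean)" by (simp add: emp_probs)
  fix U :: "('w \<times> 'x) measure set" assume U: "openin (weak_top euclidean) U"
  obtain \<B> :: "('w \<times> 'x) set set" where \<B>: "countable \<B>"
    "\<And>D. D \<in> \<B> \<Longrightarrow> \<exists>U V. open U \<and> open V \<and> D = U \<times> V"
    "\<And>S p. open S \<Longrightarrow> p \<in> S \<Longrightarrow> \<exists>D\<in>\<B>. p \<in> D \<and> D \<subseteq> S"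
    using countable_box_basis[OF cpt] by metis
  have \<B>o: "open D" if "D \<in> \<B>" for D using \<B>(2)[OF that] by (auto intro: open_Times)
  \<comment> \<open>Tuples of boxes whose product is mapped entirely into \<open>U\<close>.
    \<open>PiE\<close> makes them extensional, so that there are only countably many.\<close>
  define \<D> where "\<D> = {D \<in> PiE {..<n} (\<lambda>_. \<B>). \<forall>p q. (\<forall>k<n. (p k, q k) \<in> D k) \<longrightarrow> emp n p q \<in> U}"
  define pre where "pre D = (\<Inter>k\<in>{..<n}. (\<lambda>\<omega>. (w \<omega> k, x \<omega> k)) -` D k \<inter> space M)" for D
  have "(\<lambda>\<omega>. emp n (w \<omega>) (x \<omega>)) -` U \<inter> space M = (\<Union>D\<in>\<D>. pre D)"
  proof (intro set_eqI iffI)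
    fix \<omega> assume "\<omega> \<in> (\<lambda>\<omega>. emp n (w \<omega>) (x \<omega>)) -` U \<inter> space M"
    then have \<omega>: "\<omega> \<in> space M" "emp n (w \<omega>) (x \<omega>) \<in> U" by auto
    obtain J \<epsilon> where J: "finite J" "J \<subseteq> bcont euclidean" "\<epsilon> > 0"
      and JU: "\<And>m'. m' \<in> probs_on euclidean \<Longrightarrow>
        (\<And>f. f \<in> J \<Longrightarrow> \<bar>(\<integral>p. f p \<partial>m') - (\<integral>p. f p \<partial>emp n (w \<omega>) (x \<omega>))\<bar> < \<epsilon>) \<Longrightarrow> m' \<in> U"
      using weak_top_nbhd[OF U \<omega>(2)] by metis
    have "\<exists>D\<in>\<B>. (w \<omega> k, x \<omega> k) \<in> D \<and> (\<forall>p\<in>D. \<forall>f\<in>J. \<bar>f p - f (w \<omega> k, x \<omega> k)\<bar> < \<epsilon>)" for k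
    proof -
      define V where "V = (\<Inter>f\<in>J. {p. \<bar>f p - f (w \<omega> k, x \<omega> k)\<bar> < \<epsilon>})"
      have "open V" unfolding V_def
      proof (intro open_INT ballI open_Collect_less continuous_intros)
        show "finite J" by fact
        show "continuous_on UNIV f" if "f \<in> J" for f
          using J(2) that by (auto simp: bcont_euclidean)
      qed
      moreover have "(w \<omega> k, x \<omega> k) \<in> V" using J(3) by (simp add: V_def)
      ultimately obtain D where D: "D \<in> \<B>" "(w \<omega> k, x \<omega> k) \<in> D" "D \<subseteq> V"
        using \<B>(3) by metis
      have "\<forall>p\<in>D. \<forall>f\<in>J. \<bar>f p - f (w \<omega> k, x \<omega> k)\<bar> < \<epsilon>" using D(3) unfolding V_def by blast
      then show ?thesis using D(1,2) by blast
    qed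
    then obtain D where D: "\<And>k. D k \<in> \<B>" "\<And>k. (w \<omega> k, x \<omega> k) \<in> D k"
      "\<And>k p f. p \<in> D k \<Longrightarrow> f \<in> J \<Longrightarrow> \<bar>f p - f (w \<omega> k, x \<omega> k)\<bar> < \<epsilon>" by metis
    have "restrict D {..<n} \<in> \<D>"
      unfolding \<D>_def
    proof (intro CollectI conjI allI impI)
      show "restrict D {..<n} \<in> PiE {..<n} (\<lambda>_. \<B>)" using D(1) by auto
      fix p :: "nat \<Rightarrow> 'w" and q :: "nat \<Rightarrow> 'x" assume pq: "\<forall>k<n. (p k, q k) \<in> restrict D {..<n} k"
      show "emp n p q \<in> U"
      proof (rule JU[OF emp_probs])
        fix f assume f: "f \<in> J"
        then have fm: "f \<in> borel_measurable borel"
          using J(2) bcont_borel_measurable[of f euclidean borel] by auto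
        have "\<bar>(\<integral>p. f p \<partial>emp n p q) - (\<integral>p. f p \<partial>emp n (w \<omega>) (x \<omega>))\<bar>
            = \<bar>\<Sum>k<n. f (p k, q k) - f (w \<omega> k, x \<omega> k)\<bar> / real n"
          using n by (simp add: integral_emp[OF n fm] sum_subtractf diff_divide_distrib[symmetric])
        also have "\<dots> \<le> (\<Sum>k<n. \<bar>f (p k, q k) - f (w \<omega> k, x \<omega> k)\<bar>) / real n"
          by (intro divide_right_mono sum_abs) simp
        also have "\<dots> < (\<Sum>k<n. \<epsilon>) / real n"
          using n D(3)[OF _ f] pq by (intro divide_strict_right_mono sum_strict_mono) auto
        also have "\<dots> = \<epsilon>" using n by simp
        finally show "\<bar>(\<integral>p. f p \<partial>emp n p q) - (\<integral>p. f p \<partial>emp n (w \<omega>) (x \<omega>))\<bar> < \<epsilon>" .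
      qed
    qed
    moreover have "\<omega> \<in> pre (restrict D {..<n})" using \<omega>(1) D(2) by (auto simp: pre_def)
    ultimately show "\<omega> \<in> (\<Union>D\<in>\<D>. pre D)" by blast
  next
    fix \<omega> assume "\<omega> \<in> (\<Union>D\<in>\<D>. pre D)"
    then obtain D where D: "D \<in> \<D>" "\<omega> \<in> pre D" by blast
    have *: "(w \<omega> k, x \<omega> k) \<in> D k \<and> \<omega> \<in> space M" if "k < n" for k
    proof -
      have "\<omega> \<in> (\<lambda>\<omega>. (w \<omega> k, x \<omega> k)) -` D k \<inter> space M"
        using D(2)[unfolded pre_def] by (rule INT_D) (use that in simp)
      then show ?thesis by simp
    qed
    then have "emp n (w \<omega>) (x \<omega>) \<in> U" using D(1) by (simp add: \<D>_def)
    then show "\<omega> \<in> (\<lambda>\<omega>. emp n (w \<omega>) (x \<omega>)) -` U \<inter> space M" using *[OF n] by simp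
  qed
  also have "(\<Union>D\<in>\<D>. pre D) \<in> sets M"
  proof (rule sets.countable_UN'')
    have "countable (PiE {..<n} (\<lambda>_. \<B>))" using \<B>(1) by (intro countable_PiE) auto
    then show "countable \<D>" unfolding \<D>_def by (rule countable_subset[rotated]) auto
    fix D assume D: "D \<in> \<D>"
    show "pre D \<in> sets M" unfolding pre_def
    proof (rule sets.finite_INT)
      fix k assume k: "k \<in> {..<n}"
      have "open (D k)" using D k \<B>o by (auto simp: \<D>_def)
      then show "(\<lambda>\<omega>. (w \<omega> k, x \<omega> k)) -` D k \<inter> space M \<in> sets M"
        using measurable_sets[OF borel_measurable_Pair_compact[OF cpt w x]] k by auto
    qed (use n in auto)
  qed
  finally show "(\<lambda>\<omega>. emp n (w \<omega>) (x \<omega>)) -` U \<inter> space M \<in> sets M" .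
qed

text \<open>Finite intersections of basic boxes form a countable \<pi>-system generating the Borel
  sets, and each of their indicators is the limit of a sequence of continuous functions. The
  integrals of these functions map the probability measures injectively and continuously into a
  metrizable sequence space.\<close>

lemma countable_separating_family:
  assumes cpt: "compact (UNIV :: 'x::metric_space set)"
  obtains \<phi> :: "nat \<Rightarrow> ('w::polish_space \<times> ('x::metric_space)) \<Rightarrow> real" where "\<And>k. \<phi> k \<in> bcont euclidean"
    "\<And>m m'. m \<in> probs_on euclidean \<Longrightarrow> m' \<in> probs_on euclidean \<Longrightarrow>
       (\<And>k. (\<integral>p. \<phi> k p \<partial>m) = (\<integral>p. \<phi> k p \<partial>m')) \<Longrightarrow> m = m'"
proof -
  obtain \<B> :: "('w \<times> 'x) set set" where \<B>: "countable \<B>"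
    "\<And>D. D \<in> \<B> \<Longrightarrow> \<exists>U V. open U \<and> open V \<and> D = U \<times> V"
    "\<And>S p. open S \<Longrightarrow> p \<in> S \<Longrightarrow> \<exists>D\<in>\<B>. p \<in> D \<and> D \<subseteq> S"
    using countable_box_basis[OF cpt] by metis
  have \<B>o: "open D" if "D \<in> \<B>" for D using \<B>(2)[OF that] by (auto intro: open_Times)
  define \<E> where "\<E> = Inter ` {J. finite J \<and> J \<subseteq> \<B>}"
  have cE: "countable \<E>" unfolding \<E>_def using \<B>(1) by (intro countable_image countable_Collect_finite_subset)
  have Eo: "open E" if "E \<in> \<E>" for E using that \<B>o by (auto simp: \<E>_def intro!: open_Inter)
  have EU: "UNIV \<in> \<E>" unfolding \<E>_def by (rule image_eqI[of _ _ "{}"]) auto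
  have stable: "Int_stable \<E>"
  proof (rule Int_stableI)
    fix a b assume "a \<in> \<E>" "b \<in> \<E>"
    then obtain J K where "finite J" "J \<subseteq> \<B>" "a = \<Inter> J" "finite K" "K \<subseteq> \<B>" "b = \<Inter> K" by (auto simp: \<E>_def)
    then show "a \<inter> b \<in> \<E>" unfolding \<E>_def by (intro image_eqI[of _ _ "J \<union> K"]) auto
  qed
  have BE: "\<B> \<subseteq> \<E>" unfolding \<E>_def by (force intro: image_eqI[of _ _ "{D}" for D])
  have gen: "sets borel = sigma_sets UNIV \<E>"
  proof
    have "sigma_sets UNIV {S. open S} \<subseteq> sigma_sets UNIV \<E>"
    proof (rule sigma_sets_mono, rule subsetI)
      fix S :: "('w \<times> 'x) set" assume "S \<in> {S. open S}"
      then have "S = \<Union> {D \<in> \<B>. D \<subseteq> S}" using \<B>(3) by fastforce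
      moreover have "\<Union> {D \<in> \<B>. D \<subseteq> S} \<in> sigma_sets UNIV \<E>"
      proof (rule sigma_sets_UNION)
        show "countable {D \<in> \<B>. D \<subseteq> S}" using \<B>(1) by simp
        show "\<And>b. b \<in> {D \<in> \<B>. D \<subseteq> S} \<Longrightarrow> b \<in> sigma_sets UNIV \<E>"
          using BE by (auto intro: sigma_sets.Basic)
      qed
      ultimately show "S \<in> sigma_sets UNIV \<E>" by simp
    qed
    then show "sets borel \<subseteq> sigma_sets UNIV \<E>" by (simp add: borel_def)
    have "sigma_sets UNIV \<E> \<subseteq> sigma_sets UNIV {S. open S}"
      by (rule sigma_sets_mono') (use Eo in auto)
    then show "sigma_sets UNIV \<E> \<subseteq> sets borel" by (simp add: borel_def)
  qed
  have "\<forall>E\<in>\<E>. \<exists>f :: nat \<Rightarrow> _ \<Rightarrow> real. (\<forall>n. f n \<in> bcont euclidean) \<and> (\<forall>n x. 0 \<le> f n x \<and> f n x \<le> 1) \<and>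
      (\<forall>x. (\<lambda>n. f n x) \<longlonglongrightarrow> indicator E x)"
    using open_indicator_limit[OF Eo] by metis
  then obtain f :: "_ \<Rightarrow> nat \<Rightarrow> _ \<Rightarrow> real" where f: "\<And>E n. E \<in> \<E> \<Longrightarrow> f E n \<in> bcont euclidean"
    "\<And>E n x. E \<in> \<E> \<Longrightarrow> 0 \<le> f E n x" "\<And>E n x. E \<in> \<E> \<Longrightarrow> f E n x \<le> 1"
    "\<And>E x. E \<in> \<E> \<Longrightarrow> (\<lambda>n. f E n x) \<longlonglongrightarrow> indicator E x" by metis
  define \<phi> where "\<phi> k = (case prod_decode k of (i, n) \<Rightarrow> f (from_nat_into \<E> i) n)" for k
  have En: "from_nat_into \<E> i \<in> \<E>" for i using EU by (intro from_nat_into) auto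
  show ?thesis
  proof (rule that[of \<phi>])
    show "\<phi> k \<in> bcont euclidean" for k unfolding \<phi>_def using f(1)[OF En] by (simp split: prod.split)
    fix m m' :: "('w \<times> 'x) measure"
    assume m: "m \<in> probs_on euclidean" and m': "m' \<in> probs_on euclidean"
      and eq: "\<And>k. (\<integral>p. \<phi> k p \<partial>m) = (\<integral>p. \<phi> k p \<partial>m')"
    have eqf: "(\<integral>p. f E n p \<partial>m) = (\<integral>p. f E n p \<partial>m')" if E: "E \<in> \<E>" for E n
    proof -
      obtain i where "from_nat_into \<E> i = E" using from_nat_into_surj[OF cE E] by blast
      then have "\<phi> (prod_encode (i, n)) = f E n" by (simp add: \<phi>_def)
      then show ?thesis using eq[of "prod_encode (i, n)"] by simp
    qed
    have lim: "(\<lambda>n. \<integral>p. f E n p \<partial>\<mu>) \<longlonglongrightarrow> measure \<mu> E" if E: "E \<in> \<E>" and \<mu>: "\<mu> \<in> probs_on euclidean"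
      for E and \<mu> :: "('w \<times> 'x) measure"
    proof -
      interpret prob_space \<mu> using \<mu> by (simp add: probs_on_euclidean)
      have s: "sets \<mu> = sets borel" using \<mu> by (simp add: probs_on_euclidean)
      have "(\<lambda>n. \<integral>p. f E n p \<partial>\<mu>) \<longlonglongrightarrow> (\<integral>p. indicator E p \<partial>\<mu>)"
      proof (rule integral_dominated_convergence[where w = "\<lambda>_. 1"])
        show "indicat_real E \<in> borel_measurable \<mu>" using Eo[OF E] s by (intro borel_measurable_indicator) auto
        show "f E n \<in> borel_measurable \<mu>" for n using bcont_borel_measurable[OF f(1)[OF E]] s by simp
      qed (use f[OF E] in \<open>auto simp: abs_of_nonneg\<close>)
      then show ?thesis using Eo[OF E] s by simp
    qed
    interpret m: prob_space m using m by (simp add: probs_on_euclidean)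
    interpret m': prob_space m' using m' by (simp add: probs_on_euclidean)
    show "m = m'"
    proof (rule measure_eqI_generator_eq[OF stable, of UNIV, where A = "\<lambda>_. UNIV"])
      show "sets m = sigma_sets UNIV \<E>" "sets m' = sigma_sets UNIV \<E>"
        using m m' gen by (auto simp: probs_on_euclidean)
      show "emeasure m E = emeasure m' E" if "E \<in> \<E>" for E
        using LIMSEQ_unique[OF lim[OF that m]] lim[OF that m'] eqf[OF that]
        by (simp add: m.emeasure_eq_measure m'.emeasure_eq_measure)
    qed (use EU in auto)
  qed
qed

subsection \<open>Stability of Nash equilibria\<close>

lemma fst_measurable_probs:
  fixes m :: "('w::topological_space \<times> 'x::topological_space) measure"
  assumes "m \<in> probs_on euclidean"
  shows "fst \<in> measurable m borel"
proof -
  have "(fst :: 'w \<times> 'x \<Rightarrow> 'w) \<in> measurable borel borel"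
    by (rule borel_measurable_continuous_onI[OF continuous_on_fst[OF continuous_on_id]])
  moreover have "sets m = sets borel" using assms by (simp add: probs_on_euclidean)
  ultimately show ?thesis using measurable_cong_sets[of m borel borel borel] by blast
qed

lemma distr_fst_probs:
  fixes m :: "('w::topological_space \<times> 'x::topological_space) measure"
  assumes m: "m \<in> probs_on euclidean"
  shows "distr m borel fst \<in> probs_on euclidean"
proof -
  interpret prob_space m using m by (simp add: probs_on_euclidean)
  show ?thesis using prob_space_distr[OF fst_measurable_probs[OF m]] by (simp add: probs_on_euclidean)
qed

lemma measure_eq_0_AE_notin:
  "AE p in M. p \<notin> G \<Longrightarrow> G \<in> sets M \<Longrightarrow> measure M G = 0"
  by (simp add: AE_iff_null_sets[symmetric] measure_def null_sets_def)

lemma MFE_all_iff: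
  "m \<in> MFE_all F C \<longleftrightarrow> m \<in> probs_on euclidean \<and>
     (AE p in m. snd p \<in> C (fst p) \<and> F m (fst p) (snd p) = (INF y\<in>C (fst p). F m (fst p) y))"
  unfolding MFE_all_def MFE_def using distr_fst_probs by auto

lemma MFE_iff: "m \<in> MFE F C lam \<longleftrightarrow> m \<in> MFE_all F C \<and> distr m borel fst = lam"
  unfolding MFE_all_iff unfolding MFE_def by auto

locale nash_game =
  fixes F :: "('w::polish_space \<times> 'x::metric_space) measure \<Rightarrow> 'w \<Rightarrow> 'x \<Rightarrow> real"
    and C :: "'w \<Rightarrow> 'x set"
  assumes X_compact: "compact (UNIV :: 'x set)"
    and C_ne: "C w \<noteq> {}"
    and C_graph: "closed {(w, x). x \<in> C w}"
    and C_lower: "\<And>ws w x. ws \<longlonglongrightarrow> w \<Longrightarrow> x \<in> C w \<Longrightarrow>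
        \<exists>r xs. strict_mono (r :: nat \<Rightarrow> nat) \<and> (\<forall>k. xs k \<in> C (ws (r k))) \<and> xs \<longlonglongrightarrow> x"
    and F_cont: "continuous_map (prod_topology (weak_top euclidean) (prod_topology euclidean euclidean))
        euclideanreal (\<lambda>(m, w, x). F m w x)"
    and F_bdd: "\<exists>B. \<forall>m\<in>probs_on euclidean. \<forall>w x. \<bar>F m w x\<bar> \<le> B"
begin

lemma F_nbhd:
  assumes "m \<in> probs_on euclidean" "e > 0"
  obtains U V V' where "openin (weak_top euclidean) U" "m \<in> U" "open V" "open V'" "w \<in> V" "x \<in> V'"
    "\<And>m' w' x'. m' \<in> U \<Longrightarrow> w' \<in> V \<Longrightarrow> x' \<in> V' \<Longrightarrow> \<bar>F m' w' x' - F m w x\<bar> < e"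
proof -
  let ?T = "prod_topology (weak_top euclidean) (prod_topology euclidean euclidean)"
  define S where "S = {p \<in> topspace ?T. (case p of (m, w, x) \<Rightarrow> F m w x) \<in> {F m w x - e<..<F m w x + e}}"
  have "openin ?T S" unfolding S_def by (rule openin_continuous_map_preimage[OF F_cont]) auto
  moreover have "(m, w, x) \<in> S" using assms by (simp add: S_def)
  ultimately obtain U P where UP: "openin (weak_top euclidean) U" "openin (prod_topology euclidean euclidean) P"
    "m \<in> U" "(w, x) \<in> P" "U \<times> P \<subseteq> S"
    unfolding openin_prod_topology_alt[of "weak_top euclidean"] by metis
  obtain V V' where V: "open V" "open V'" "w \<in> V" "x \<in> V'" "V \<times> V' \<subseteq> P"
    using UP(2,4) unfolding openin_prod_topology_alt open_openin[symmetric] by metis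
  show ?thesis
  proof (rule that[OF UP(1,3) V(1-4)])
    fix m' w' x' assume "m' \<in> U" "w' \<in> V" "x' \<in> V'"
    then have "(m', w', x') \<in> S" using UP(5) V(5) by blast
    then show "\<bar>F m' w' x' - F m w x\<bar> < e" by (simp add: S_def abs_less_iff)
  qed
qed

lemma F_tendsto:
  assumes "m \<in> probs_on euclidean" "ws \<longlonglongrightarrow> w" "xs \<longlonglongrightarrow> x"
  shows "(\<lambda>k. F m (ws k) (xs k)) \<longlonglongrightarrow> F m w x"
proof (rule tendstoI)
  fix e :: real assume "0 < e"
  obtain U V V' where *: "m \<in> U" "open V" "open V'" "w \<in> V" "x \<in> V'"
    "\<And>m' w' x'. m' \<in> U \<Longrightarrow> w' \<in> V \<Longrightarrow> x' \<in> V' \<Longrightarrow> \<bar>F m' w' x' - F m w x\<bar> < e"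
    using F_nbhd[OF assms(1) \<open>0 < e\<close>, of w x] by metis
  show "\<forall>\<^sub>F k in sequentially. dist (F m (ws k) (xs k)) (F m w x) < e"
    using topological_tendstoD[OF assms(2) *(2,4)] topological_tendstoD[OF assms(3) *(3,5)]
    by eventually_elim (use * in \<open>auto simp: dist_real_def\<close>)
qed

text \<open>The measure may vary with \<open>y\<close>, because in \<open>nash\<close> a deviation
  also changes the empirical measure; the constant case serves \<open>MFE\<close>.\<close>

lemma F_bdd_below:
  assumes "\<And>y. y \<in> S \<Longrightarrow> M y \<in> probs_on euclidean"
  shows "bdd_below ((\<lambda>y. F (M y) w y) ` S)"
proof -
  obtain B where B: "\<forall>m\<in>probs_on euclidean. \<forall>w x. \<bar>F m w x\<bar> \<le> B" using F_bdd by blast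
  show ?thesis
  proof (rule bdd_belowI2)
    fix y assume "y \<in> S"
    then have "\<bar>F (M y) w y\<bar> \<le> B" using B assms by blast
    then show "- B \<le> F (M y) w y" by linarith
  qed
qed

lemma F_eq_INF_iff:
  assumes "m \<in> probs_on euclidean" "x \<in> C w"
  shows "F m w x = (INF y\<in>C w. F m w y) \<longleftrightarrow> (\<forall>y\<in>C w. F m w x \<le> F m w y)"
proof
  assume *: "F m w x = (INF y\<in>C w. F m w y)"
  show "\<forall>y\<in>C w. F m w x \<le> F m w y"
    unfolding * using assms F_bdd_below[of "C w" "\<lambda>_. m" w] by (auto intro: cINF_lower)
next
  assume *: "\<forall>y\<in>C w. F m w x \<le> F m w y"
  show "F m w x = (INF y\<in>C w. F m w y)"
  proof (rule antisym)
    show "F m w x \<le> (INF y\<in>C w. F m w y)" using * C_ne by (intro cINF_greatest) auto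
    show "(INF y\<in>C w. F m w y) \<le> F m w x"
      using assms F_bdd_below[of "C w" "\<lambda>_. m" w] by (intro cINF_lower) auto
  qed
qed

text \<open>The sequential condition on \<open>C\<close> in neighbourhood form: if it failed, points
  \<open>ws n\<close> within \<open>1 / Suc n\<close> of \<open>w\<close> would have no feasible
  action in \<open>G\<close>, against the subsequence of feasible actions converging to
  \<open>y\<close>. \<open>G\<close> lies in the product so that type and action are confined at
  once.\<close>

lemma C_lower_open:
  assumes y: "y \<in> C w" and G: "open G" "(w, y) \<in> G"
  obtains V where "open V" "w \<in> V" "\<And>w'. w' \<in> V \<Longrightarrow> \<exists>y'\<in>C w'. (w', y') \<in> G"
proof -
  have "\<exists>n. \<forall>w'\<in>ball w (1 / real (Suc n)). \<exists>y'\<in>C w'. (w', y') \<in> G"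
  proof (rule ccontr)
    assume "\<not> ?thesis"
    then obtain ws where ws: "\<And>n. ws n \<in> ball w (1 / real (Suc n))" "\<And>n y'. y' \<in> C (ws n) \<Longrightarrow> (ws n, y') \<notin> G"
      by metis
    have "ws \<longlonglongrightarrow> w"
    proof (rule metric_tendsto_imp_tendsto)
      show "(\<lambda>n. 1 / real (Suc n)) \<longlonglongrightarrow> 0" by (rule LIMSEQ_Suc[OF lim_1_over_n])
      show "\<forall>\<^sub>F n in sequentially. dist (ws n) w \<le> dist (1 / real (Suc n)) 0"
        using ws(1) by (auto simp: mem_ball dist_commute less_imp_le simp del: of_nat_Suc)
    qed
    then obtain r xs where rx: "strict_mono (r :: nat \<Rightarrow> nat)" "\<forall>k. xs k \<in> C (ws (r k))" "xs \<longlonglongrightarrow> y"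
      using C_lower[OF _ y] by blast
    have "(\<lambda>k. ws (r k)) \<longlonglongrightarrow> w" using LIMSEQ_subseq_LIMSEQ[OF \<open>ws \<longlonglongrightarrow> w\<close> rx(1)] by (simp add: comp_def)
    then have "(\<lambda>k. (ws (r k), xs k)) \<longlonglongrightarrow> (w, y)" using rx(3) by (rule tendsto_Pair)
    then have "\<forall>\<^sub>F k in sequentially. (ws (r k), xs k) \<in> G" using G by (rule topological_tendstoD)
    then show False using ws(2) rx(2) by (auto simp: eventually_sequentially)
  qed
  then obtain n where "\<forall>w'\<in>ball w (1 / real (Suc n)). \<exists>y'\<in>C w'. (w', y') \<in> G" by blast
  then show ?thesis by (intro that[of "ball w (1 / real (Suc n))"]) auto
qed

text \<open>The graph is closed, and any competitor at the limit type is approached by feasible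
  competitors along a subsequence, so the inequality passes to the limit. The non-optimal pairs thus
  form an open set, as \<open>support_point\<close> requires.\<close>

lemma closed_optimal:
  assumes m: "m \<in> probs_on euclidean"
  shows "closed {p. snd p \<in> C (fst p) \<and> F m (fst p) (snd p) = (INF y\<in>C (fst p). F m (fst p) y)}"
    (is "closed ?D")
  unfolding closed_sequential_limits
proof (intro allI impI, elim conjE)
  fix ps p assume ps: "\<forall>n. ps n \<in> ?D" and lim: "ps \<longlonglongrightarrow> p"
  have lw: "(\<lambda>n. fst (ps n)) \<longlonglongrightarrow> fst p" and lx: "(\<lambda>n. snd (ps n)) \<longlonglongrightarrow> snd p"
    using lim by (auto intro: tendsto_intros)
  have "ps n \<in> {(w, x). x \<in> C w}" for n using ps by (auto simp: case_prod_beta)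
  then have "p \<in> {(w, x). x \<in> C w}"
    using C_graph lim unfolding closed_sequential_limits by blast
  then have pC: "snd p \<in> C (fst p)" by (simp add: case_prod_beta)
  have "F m (fst p) (snd p) \<le> F m (fst p) y" if y: "y \<in> C (fst p)" for y
  proof -
    obtain r xs where rx: "strict_mono (r :: nat \<Rightarrow> nat)" "\<forall>k. xs k \<in> C (fst (ps (r k)))" "xs \<longlonglongrightarrow> y"
      using C_lower[OF lw y] by blast
    have lw': "(\<lambda>k. fst (ps (r k))) \<longlonglongrightarrow> fst p" "(\<lambda>k. snd (ps (r k))) \<longlonglongrightarrow> snd p"
      using LIMSEQ_subseq_LIMSEQ[OF lw rx(1)] LIMSEQ_subseq_LIMSEQ[OF lx rx(1)] by (simp_all add: comp_def)
    show ?thesis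
    proof (rule LIMSEQ_le[OF F_tendsto[OF m lw'] F_tendsto[OF m lw'(1) rx(3)]])
      have "F m (fst (ps (r k))) (snd (ps (r k))) \<le> F m (fst (ps (r k))) (xs k)" for k
        using ps rx(2) F_eq_INF_iff[OF m, of "snd (ps (r k))" "fst (ps (r k))"] by blast
      then show "\<exists>N. \<forall>n\<ge>N. F m (fst (ps (r n))) (snd (ps (r n))) \<le> F m (fst (ps (r n))) (xs n)" by blast
    qed
  qed
  then show "p \<in> ?D" using pC F_eq_INF_iff[OF m pC] by simp
qed

text \<open>Changing one action moves each of the finitely many test integrals by at most
  \<open>2 * B1 / n\<close>, uniformly in types and actions. The tolerance \<epsilon> is shared
  equally between this shift and the radius of \<open>V\<close>.\<close>

lemma emp_deviation_nbhd:
  assumes U: "openin (weak_top euclidean) U" "m \<in> U"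
  obtains V N where "openin (weak_top euclidean) V" "m \<in> V" "V \<subseteq> U"
    "\<And>n w x i y. n \<ge> N \<Longrightarrow> i < n \<Longrightarrow> emp n w x \<in> V \<Longrightarrow> emp n w (x(i := y)) \<in> U"
proof -
  have mP: "m \<in> probs_on euclidean" using openin_subset[OF U(1)] U(2) by auto
  obtain J \<epsilon> where J: "finite J" "J \<subseteq> bcont euclidean" "\<epsilon> > 0"
    and JU: "\<And>m'. m' \<in> probs_on euclidean \<Longrightarrow>
      (\<And>f. f \<in> J \<Longrightarrow> \<bar>(\<integral>p. f p \<partial>m') - (\<integral>p. f p \<partial>m)\<bar> < \<epsilon>) \<Longrightarrow> m' \<in> U"
    using weak_top_nbhd[OF U] by metis
  define V where "V = {m' \<in> probs_on euclidean. \<forall>f\<in>J. \<bar>(\<integral>p. f p \<partial>m') - (\<integral>p. f p \<partial>m)\<bar> < \<epsilon> / 2}"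
  have "\<forall>f\<in>J. \<exists>B. \<forall>p. \<bar>f p\<bar> \<le> B" using bcont_bounded J(2) by (metis UNIV_I subsetD topspace_euclidean)
  then obtain B where B: "\<And>f p. f \<in> J \<Longrightarrow> \<bar>f p\<bar> \<le> B f" by metis
  define B1 where "B1 = Max (insert 0 (B ` J))"
  have B1: "\<bar>f p\<bar> \<le> B1" if "f \<in> J" for f p
  proof -
    have "B f \<le> B1" using J(1) that by (auto simp: B1_def)
    then show ?thesis using B[OF that, of p] by linarith
  qed
  have B10: "B1 \<ge> 0" using J(1) by (simp add: B1_def)
  obtain N :: nat where N: "2 * B1 < real N * (\<epsilon> / 2)" using J(3) reals_Archimedean3[of "\<epsilon>/2"] by (meson half_gt_zero)
  show ?thesis
  proof (rule that[of V N])
    show "openin (weak_top euclidean) V" unfolding V_def by (rule openin_integral_nbhd[OF J(1,2)])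
    show "m \<in> V" using mP J(3) by (simp add: V_def)
    show "V \<subseteq> U" using JU J(3) by (fastforce simp: V_def)
    fix n w x i y assume n: "N \<le> n" and i: "i < n" and e: "emp n w x \<in> V"
    have n0: "n > 0" using i by simp
    show "emp n w (x(i := y)) \<in> U"
    proof (rule JU[OF emp_probs])
      fix f assume f: "f \<in> J"
      then have fm: "f \<in> borel_measurable borel" using J(2) bcont_borel_measurable[of f euclidean borel] by auto
      have "(\<Sum>k<n. f (w k, (x(i := y)) k)) - (\<Sum>k<n. f (w k, x k)) = f (w i, y) - f (w i, x i)"
        using i by (simp add: sum.remove[of "{..<n}" i])
      then have "(\<integral>p. f p \<partial>emp n w (x(i := y))) - (\<integral>p. f p \<partial>emp n w x) = (f (w i, y) - f (w i, x i)) / real n"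
        by (simp add: integral_emp[OF n0 fm] diff_divide_distrib[symmetric])
      then have "\<bar>(\<integral>p. f p \<partial>emp n w (x(i := y))) - (\<integral>p. f p \<partial>emp n w x)\<bar> = \<bar>f (w i, y) - f (w i, x i)\<bar> / real n"
        by simp
      also have "\<dots> \<le> 2 * B1 / real n"
        using B1[OF f, of "(w i, y)"] B1[OF f, of "(w i, x i)"] by (intro divide_right_mono) auto
      also have "\<dots> < \<epsilon> / 2"
      proof -
        have "real N * (\<epsilon> / 2) \<le> real n * (\<epsilon> / 2)" using n J(3) by (intro mult_right_mono) auto
        then show ?thesis using N n0 by (simp add: pos_divide_less_eq mult.commute)
      qed
      finally have "\<bar>(\<integral>p. f p \<partial>emp n w (x(i := y))) - (\<integral>p. f p \<partial>emp n w x)\<bar> < \<epsilon> / 2" .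
      moreover have "\<bar>(\<integral>p. f p \<partial>emp n w x) - (\<integral>p. f p \<partial>m)\<bar> < \<epsilon> / 2" using e f by (simp add: V_def)
      ultimately show "\<bar>(\<integral>p. f p \<partial>emp n w (x(i := y))) - (\<integral>p. f p \<partial>m)\<bar> < \<epsilon>" by linarith
    qed
  qed
qed

text \<open>If m charges a neighbourhood of a non-optimal pair, then so do nearby measures, and by joint continuity
  of F the players with types and actions in that neighbourhood still have a profitable deviation;
  a single deviation moves the empirical measure only by O(1/n).\<close>

theorem non_equilibrium_nbhd:
  assumes m: "m \<in> probs_on euclidean" "m \<notin> MFE_all F C"
  obtains U N where "openin (weak_top euclidean) U" "m \<in> U" "U \<inter> MFE_all F C = {}"
    "\<And>n w x. n \<ge> N \<Longrightarrow> n > 0 \<Longrightarrow> nash F C n w x \<Longrightarrow> emp n w x \<notin> U"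
proof -
  interpret prob_space m using m by (simp add: probs_on_euclidean)
  have sm: "sets m = sets borel" using m by (simp add: probs_on_euclidean)
  define D where "D = {p. snd p \<in> C (fst p) \<and> F m (fst p) (snd p) = (INF y\<in>C (fst p). F m (fst p) y)}"
  have Dc: "closed D" unfolding D_def by (rule closed_optimal[OF m(1)])
  have "measure m (- D) \<noteq> 0"
  proof
    assume "measure m (- D) = 0"
    then have "- D \<in> null_sets m" using Dc sm by (auto simp: null_sets_def emeasure_eq_measure)
    then have "AE p in m. p \<in> D" using AE_not_in[of "- D" m] by simp
    then show False using m by (simp add: MFE_all_iff D_def)
  qed
  then have "measure m (- D) > 0" by (simp add: zero_less_measure_iff)
  \<comment> \<open>A pair that is not optimal against \<open>m\<close> and all of whose
    neighbourhoods are charged by \<open>m\<close>; the sets below are built around it.\<close>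
  then obtain p0 where p0: "p0 \<in> - D" "\<And>G. open G \<Longrightarrow> p0 \<in> G \<Longrightarrow> measure m G > 0"
    using support_point[OF X_compact m(1), of "- D"] Dc by auto
  obtain w0 x0 where p0_eq: "p0 = (w0, x0)" by force
  show ?thesis
  proof (cases "x0 \<in> C w0")
    case False
    \<comment> \<open>The pair is infeasible: charging the complement of the closed graph already
      excludes equilibria, for every positive number of players.\<close>
    define G where "G = - {(w, x). x \<in> C w}"
    have Go: "open G" unfolding G_def using C_graph by (rule open_Compl)
    define U where "U = {m' \<in> probs_on euclidean. 0 < measure m' G}"
    have "p0 \<in> G" using False by (simp add: p0_eq G_def)
    show ?thesis
    proof (rule that[of U 0])
      show "openin (weak_top euclidean) U" unfolding U_def by (rule openin_measure_gt[OF Go])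
      show "m \<in> U" using m(1) p0(2)[OF Go \<open>p0 \<in> G\<close>] by (simp add: U_def)
      show "U \<inter> MFE_all F C = {}"
      proof (intro equals0I, elim IntE)
        fix m' assume "m' \<in> U" "m' \<in> MFE_all F C"
        then have *: "0 < measure m' G" "AE p in m'. p \<notin> G" and s': "sets m' = sets borel"
          by (auto simp: U_def MFE_all_iff probs_on_euclidean G_def elim!: eventually_mono)
        then have "measure m' G = 0"
          using Go by (intro measure_eq_0_AE_notin) auto
        then show False using *(1) by simp
      qed
      fix n w x assume n: "n > 0" and ne: "nash F C n w x"
      show "emp n w x \<notin> U"
      proof
        assume "emp n w x \<in> U"
        then obtain i where "i < n" "(w i, x i) \<in> G" using emp_pos[OF n _, of G w x] Go by (auto simp: U_def)
        then show False using ne by (auto simp: nash_def G_def)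
      qed
    qed
  next
    case True
    then obtain y0 where y0: "y0 \<in> C w0" "F m w0 y0 < F m w0 x0"
      using p0(1) F_eq_INF_iff[OF m(1) True] by (auto simp: p0_eq D_def not_le)
    \<comment> \<open>Half the gain from deviating: two values of \<open>F\<close>, each moved by
      less than \<eta>, remain strictly ordered.\<close>
    define \<eta> where "\<eta> = (F m w0 x0 - F m w0 y0) / 2"
    have \<eta>: "\<eta> > 0" using y0 by (simp add: \<eta>_def)
    obtain U1 V1 V1' where 1: "openin (weak_top euclidean) U1" "m \<in> U1" "open V1" "open V1'" "w0 \<in> V1" "x0 \<in> V1'"
      "\<And>m' w' x'. m' \<in> U1 \<Longrightarrow> w' \<in> V1 \<Longrightarrow> x' \<in> V1' \<Longrightarrow> \<bar>F m' w' x' - F m w0 x0\<bar> < \<eta>"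
      using F_nbhd[OF m(1) \<eta>, of w0 x0] by metis
    obtain U2 V2 V2' where 2: "openin (weak_top euclidean) U2" "m \<in> U2" "open V2" "open V2'" "w0 \<in> V2" "y0 \<in> V2'"
      "\<And>m' w' x'. m' \<in> U2 \<Longrightarrow> w' \<in> V2 \<Longrightarrow> x' \<in> V2' \<Longrightarrow> \<bar>F m' w' x' - F m w0 y0\<bar> < \<eta>"
      using F_nbhd[OF m(1) \<eta>, of w0 y0] by metis
    obtain V3 where 3: "open V3" "w0 \<in> V3" "\<And>w'. w' \<in> V3 \<Longrightarrow> \<exists>y'\<in>C w'. (w', y') \<in> V2 \<times> V2'"
      using C_lower_open[OF y0(1) open_Times[OF 2(3,4)]] 2(5,6) by auto
    define G where "G = (V1 \<inter> V3) \<times> V1'"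
    have Go: "open G" unfolding G_def using 1 3 by (intro open_Times open_Int)
    have pG: "p0 \<in> G" using 1 3 by (simp add: p0_eq G_def)
    obtain V N where V: "openin (weak_top euclidean) V" "m \<in> V" "V \<subseteq> U1 \<inter> U2" and
      VN: "\<And>n w x i y. n \<ge> N \<Longrightarrow> i < n \<Longrightarrow> emp n w x \<in> V \<Longrightarrow> emp n w (x(i := y)) \<in> U1 \<inter> U2"
      using emp_deviation_nbhd[of "U1 \<inter> U2" m] 1(1,2) 2(1,2) by (metis IntI openin_Int)
    \<comment> \<open>Two measures appear because the deviation of one of \<open>n\<close> players
      changes the empirical measure from \<open>m'\<close> to \<open>m''\<close>; for elements of
      \<open>MFE_all\<close> the two coincide.\<close>
    have dev: "\<exists>y\<in>C w. \<forall>m'\<in>U1. \<forall>m''\<in>U2. F m'' w y < F m' w x" if wx: "(w, x) \<in> G" for w x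
    proof -
      obtain y where y: "y \<in> C w" "w \<in> V2" "y \<in> V2'" using 3(3)[of w] wx by (auto simp: G_def)
      have "F m'' w y < F m' w x" if "m' \<in> U1" "m'' \<in> U2" for m' m''
      proof -
        have "\<bar>F m' w x - F m w0 x0\<bar> < \<eta>" using 1(7)[OF that(1), of w x] wx by (simp add: G_def)
        moreover have "\<bar>F m'' w y - F m w0 y0\<bar> < \<eta>" by (rule 2(7)[OF that(2) y(2,3)])
        moreover have "F m w0 x0 - F m w0 y0 = 2 * \<eta>" by (simp add: \<eta>_def)
        ultimately show ?thesis by linarith
      qed
      then show ?thesis using y by blast
    qed
    \<comment> \<open>Membership in \<open>V\<close> makes deviations from \<open>G\<close>
      profitable; positive mass of \<open>G\<close> ensures that there is someone to make
      them.\<close>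
    define U where "U = V \<inter> {m' \<in> probs_on euclidean. 0 < measure m' G}"
    show ?thesis
    proof (rule that[of U N])
      show "openin (weak_top euclidean) U" unfolding U_def by (intro openin_Int V(1) openin_measure_gt[OF Go])
      show "m \<in> U" using m(1) V(2) p0(2)[OF Go pG] by (simp add: U_def)
      show "U \<inter> MFE_all F C = {}"
      proof (intro equals0I, elim IntE)
        fix m' assume m': "m' \<in> U" "m' \<in> MFE_all F C"
        then have m'U: "m' \<in> U1" "m' \<in> U2" "0 < measure m' G" and m'P: "m' \<in> probs_on euclidean"
          using V(3) by (auto simp: U_def)
        have "AE p in m'. snd p \<in> C (fst p) \<and> F m' (fst p) (snd p) = (INF y\<in>C (fst p). F m' (fst p) y)"
          using m'(2) by (simp add: MFE_all_iff)
        then have "AE p in m'. p \<notin> G"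
        proof eventually_elim
          case (elim p)
          show ?case
          proof
            assume "p \<in> G"
            then obtain y where "y \<in> C (fst p)" "F m' (fst p) y < F m' (fst p) (snd p)"
              using dev[of "fst p" "snd p"] m'U by auto
            then show False using elim F_eq_INF_iff[OF m'P, of "snd p" "fst p"] by (meson not_le)
          qed
        qed
        moreover have "sets m' = sets borel" using m'P by (simp add: probs_on_euclidean)
        ultimately have "measure m' G = 0"
          using Go by (intro measure_eq_0_AE_notin) auto
        then show False using m'U by simp
      qed
      fix n w x assume n: "n \<ge> N" "n > 0" and ne: "nash F C n w x"
      show "emp n w x \<notin> U"
      proof
        assume "emp n w x \<in> U"
        then have eV: "emp n w x \<in> V" and eG: "0 < measure (emp n w x) G" by (auto simp: U_def)
        obtain i where i: "i < n" "(w i, x i) \<in> G" using emp_pos[OF n(2) _ eG] Go by auto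
        obtain y where y: "y \<in> C (w i)" "\<forall>m'\<in>U1. \<forall>m''\<in>U2. F m'' (w i) y < F m' (w i) (x i)"
          using dev[OF i(2)] by blast
        have "F (emp n w (x(i := y))) (w i) y < F (emp n w x) (w i) (x i)"
          using y(2) V(3) VN[OF n(1) i(1) eV, of y] eV by blast
        moreover have "F (emp n w x) (w i) (x i) = (INF y\<in>C (w i). F (emp n w (x(i := y))) (w i) y)"
          using ne i(1) by (simp add: nash_def)
        moreover have "(INF y\<in>C (w i). F (emp n w (x(i := y))) (w i) y) \<le> F (emp n w (x(i := y))) (w i) y"
          by (rule cINF_lower[OF F_bdd_below y(1)]) (rule emp_probs)
        ultimately show False by linarith
      qed
    qed
  qed
qed

lemma closedin_MFE_all: "closedin (weak_top euclidean) (MFE_all F C)"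
proof -
  have "openin (weak_top euclidean) (probs_on euclidean - MFE_all F C)"
  proof (subst openin_subopen, intro ballI)
    fix m assume "m \<in> probs_on euclidean - MFE_all F C"
    then obtain U where U: "openin (weak_top euclidean) U" "m \<in> U" "U \<inter> MFE_all F C = {}"
      using non_equilibrium_nbhd[of m] by (metis DiffE)
    then show "\<exists>T. openin (weak_top euclidean) T \<and> m \<in> T \<and> T \<subseteq> probs_on euclidean - MFE_all F C"
      using openin_subset[OF U(1)] by (intro exI[of _ U]) auto
  qed
  then show ?thesis unfolding closedin_def by (auto simp: MFE_all_iff)
qed

end

subsection \<open>Large deviation bounds\<close>

lemma exp_linear_decay: "0 < c \<Longrightarrow> (\<lambda>n. exp (- c * real n)) \<longlonglongrightarrow> 0"
proof -
  assume c: "0 < c"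
  have "filterlim (\<lambda>n. - (c * real n)) at_bot sequentially"
    by (rule filterlim_compose[OF filterlim_uminus_at_bot_at_top
          filterlim_tendsto_pos_mult_at_top[OF tendsto_const c filterlim_real_sequentially]])
  then have "filterlim (\<lambda>n. - c * real n) at_bot sequentially" by simp
  then show ?thesis by (rule filterlim_compose[OF exp_at_bot])
qed

lemma borel_measurable_component:
  "i \<in> I \<Longrightarrow> f \<in> borel_measurable lam \<Longrightarrow> (\<lambda>x. f (x i)) \<in> borel_measurable (PiM I (\<lambda>_. lam))"
  by (rule measurable_compose[OF measurable_component_singleton[of i I "\<lambda>_. lam"]])

text \<open>Markov's inequality for the exponential of the sum, whose mean is the power
  \<open>Z ^ n\<close> by independence.\<close>

lemma chernoff_PiM:
  fixes \<phi> :: "'a \<Rightarrow> real"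
  assumes "prob_space lam" and \<phi>: "\<phi> \<in> borel_measurable lam" "\<And>x. \<bar>\<phi> x\<bar> \<le> B"
  shows "measure (PiM {..<n::nat} (\<lambda>_. lam)) {wv \<in> space (PiM {..<n} (\<lambda>_. lam)). real n * a \<le> (\<Sum>k<n. \<phi> (wv k))}
    \<le> exp (real n * (ln (\<integral>x. exp (\<phi> x) \<partial>lam) - a))"
proof -
  interpret l: prob_space lam by fact
  interpret P: product_prob_space "\<lambda>_. lam" "{..<n}" by unfold_locales
  have PP: "prob_space (PiM {..<n} (\<lambda>_. lam))" using assms(1) by (intro prob_space_PiM)
  interpret PP: prob_space "PiM {..<n} (\<lambda>_. lam)" by fact
  have ei: "integrable lam (\<lambda>x. exp (\<phi> x))"
    using \<phi> by (intro l.integrable_const_bound[of _ "exp B"]) (auto simp: abs_le_iff)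
  define Z where "Z = (\<integral>x. exp (\<phi> x) \<partial>lam)"
  have "(\<integral>x. exp (- B) \<partial>lam) \<le> Z"
    unfolding Z_def using \<phi> ei by (intro integral_mono) (auto simp: abs_le_iff minus_le_iff)
  then have "exp (- B) \<le> Z" by (simp add: l.prob_space)
  then have Z: "0 < Z" using exp_gt_zero[of "-B"] by linarith
  let ?u = "\<lambda>wv. \<Prod>k<n. exp (\<phi> (wv k))"
  have ui: "integrable (PiM {..<n} (\<lambda>_. lam)) ?u"
    by (rule P.product_integrable_prod[OF _ ei]) auto
  have "measure (PiM {..<n} (\<lambda>_. lam)) {wv \<in> space (PiM {..<n} (\<lambda>_. lam)). real n * a \<le> (\<Sum>k<n. \<phi> (wv k))}
      = measure (PiM {..<n} (\<lambda>_. lam)) {wv \<in> space (PiM {..<n} (\<lambda>_. lam)). exp (real n * a) \<le> ?u wv}"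
    by (intro arg_cong2[where f = measure] refl) (simp add: exp_sum[symmetric])
  also have "\<dots> \<le> (\<integral>wv. ?u wv \<partial>PiM {..<n} (\<lambda>_. lam)) / exp (real n * a)"
    by (rule integral_Markov_inequality_measure[OF ui sets.empty_sets]) (auto intro!: AE_I2 prod_nonneg)
  also have "(\<integral>wv. ?u wv \<partial>PiM {..<n} (\<lambda>_. lam)) = Z ^ n"
    by (subst P.product_integral_prod[OF _ ei]) (auto simp: Z_def)
  also have "\<dots> = exp (real n * ln Z)" using Z by (simp add: exp_of_nat_mult)
  finally show ?thesis by (simp add: Z_def exp_diff right_diff_distrib)
qed

text \<open>Testing with \<open>c\<close> times an indicator and dividing by \<open>c\<close> gives
  \<open>measure lam E \<le> exp c * measure lam0 E\<close>; letting \<open>c\<close> tend to 0 and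
  passing to complements yields equality. It identifies the marginal when the upper bound is used at
  level 0.\<close>

lemma relent_le_0_imp_eq:
  assumes p0: "prob_space lam0" and p: "prob_space lam" and H: "relent lam0 lam \<le> ereal 0"
  shows "lam = lam0"
proof -
  interpret l0: prob_space lam0 by fact
  interpret l: prob_space lam by fact
  have sets: "sets lam = sets lam0" using H by (auto simp: relent_def split: if_splits)
  note sp = sets_eq_imp_space_eq[OF sets]
  have le: "measure lam E \<le> measure lam0 E" if E: "E \<in> sets lam0" for E
  proof -
    have "measure lam E \<le> exp c * measure lam0 E" if c: "c > 0" for c
    proof -
      have "(\<integral>x. c * indicator E x \<partial>lam) \<le> 0 + ln (\<integral>x. exp (c * indicator E x) \<partial>lam0)"
        using E c by (intro donsker_varadhan_le[OF p0 p H, where B = c]) (auto simp: indicator_def)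
      also have "(\<integral>x. exp (c * indicator E x) \<partial>lam0) = (\<integral>x. 1 + (exp c - 1) * indicator E x \<partial>lam0)"
        by (intro Bochner_Integration.integral_cong) (auto simp: indicator_def)
      also have "\<dots> = 1 + (exp c - 1) * measure lam0 E"
        using E by (simp add: l0.prob_space less_top[symmetric] sets.Int_space_eq2)
      also have "ln \<dots> \<le> (exp c - 1) * measure lam0 E"
        using c by (intro ln_add_one_self_le_self) auto
      also have "\<dots> \<le> (c * exp c) * measure lam0 E"
      proof (rule mult_right_mono)
        have "exp c * (1 - c) \<le> exp c * exp (- c)"
          using exp_ge_add_one_self[of "- c"] by (intro mult_left_mono) auto
        then show "exp c - 1 \<le> c * exp c" by (simp add: exp_minus algebra_simps)
      qed simp
      finally have "c * measure lam E \<le> c * (exp c * measure lam0 E)"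
        using E sets by (simp add: less_top[symmetric] sets.Int_space_eq2 mult.assoc)
      then show ?thesis using c by simp
    qed
    then have "\<And>n. measure lam E \<le> exp (inverse (real (Suc n))) * measure lam0 E" by simp
    moreover have "(\<lambda>n. exp (inverse (real (Suc n))) * measure lam0 E) \<longlonglongrightarrow> exp 0 * measure lam0 E"
      by (intro tendsto_intros LIMSEQ_inverse_real_of_nat)
    ultimately show ?thesis by (intro LIMSEQ_le_const[of _ "measure lam0 E"]) auto
  qed
  show ?thesis
  proof (rule measure_eqI[OF sets])
    fix E assume E: "E \<in> sets lam"
    then have E0: "E \<in> sets lam0" using sets by simp
    have "measure lam E = measure lam0 E"
      using le[OF E0] le[of "space lam0 - E"] E E0 sp l.prob_compl[OF E] l0.prob_compl[OF E0]
      by (auto intro!: antisym)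
    then show "emeasure lam E = emeasure lam0 E" by (simp add: l.emeasure_eq_measure l0.emeasure_eq_measure)
  qed
qed

text \<open>The sets \<open>K j\<close> are so large that \<open>c j\<close> times the indicator of
  the complement has exponential moment at most 2. Chernoff's inequality then bounds, summably in
  \<open>j\<close>, the chance that more than a fraction \<open>1 / Suc j\<close> of the sample
  leaves \<open>K j\<close>; the variational inequality turns the same moment into tightness of the
  entropy level set.\<close>

lemma exponentially_tight:
  fixes lam :: "'w::polish_space measure"
  assumes lam: "lam \<in> probs_on euclidean" and L: "0 \<le> L"
  obtains K :: "nat \<Rightarrow> 'w set" where "\<And>j. compact (K j)"
    "\<And>n. n > 0 \<Longrightarrow> measure (PiM {..<n} (\<lambda>_. lam)) {wv \<in> space (PiM {..<n} (\<lambda>_. lam)).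
        \<exists>j. real n * (1 / real (Suc j)) < (\<Sum>k<n. indicator (- K j) (wv k))} \<le> exp (- real n * (L + 1))"
    "\<And>\<mu> j. \<mu> \<in> probs_on euclidean \<Longrightarrow> relent lam \<mu> \<le> ereal L \<Longrightarrow> measure \<mu> (- K j) \<le> 1 / real (Suc j)"
proof -
  interpret l: prob_space lam using lam by (simp add: probs_on_euclidean)
  have sl: "sets lam = sets borel" using lam by (simp add: probs_on_euclidean)
  have spl: "space lam = UNIV" using sets_eq_imp_space_eq[OF sl] by simp
  \<comment> \<open>The factor \<open>Suc j\<close> undoes the fraction \<open>1 / Suc j\<close>. Of
    the exponent \<open>L + 3 + j\<close>, one unit pays for the logarithm of the moment and one for
    the sum over \<open>j\<close>, which the term \<open>j\<close> makes geometric;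
    \<open>L + 1\<close> remains.\<close>
  define c where "c j = real (Suc j) * (L + 3 + real j)" for j
  have c0: "c j > 0" for j unfolding c_def using L by (intro mult_pos_pos) auto
  have "\<exists>K. compact K \<and> measure lam (- K) \<le> exp (- c j)" for j
  proof -
    have "(SUP K\<in>{K. K \<subseteq> UNIV \<and> compact K}. emeasure lam K) = emeasure lam UNIV"
      by (rule inner_regular[OF sl, symmetric]) auto
    then have eq1: "(SUP K\<in>{K. K \<subseteq> UNIV \<and> compact K}. emeasure lam K) = 1"
      using l.emeasure_space_1 spl by simp
    have "1 - ennreal (exp (- c j)) < (SUP K\<in>{K. K \<subseteq> UNIV \<and> compact K}. emeasure lam K)"
      unfolding eq1 using c0[of j] by (simp add: ennreal_minus ennreal_less_iff flip: ennreal_1)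
    then obtain K where K: "compact K" "1 - ennreal (exp (- c j)) < emeasure lam K"
      unfolding less_SUP_iff by blast
    have Ks: "K \<in> sets lam" using K(1) sl by (auto intro: borel_closed compact_imp_closed)
    have "1 - exp (- c j) < measure lam K"
    proof -
      have "ennreal (1 - exp (- c j)) < ennreal (measure lam K)"
        using K(2) by (simp add: l.emeasure_eq_measure ennreal_minus flip: ennreal_1)
      then show ?thesis using c0[of j] by (subst (asm) ennreal_less_iff) (auto simp: less_imp_le)
    qed
    then have "measure lam (- K) \<le> exp (- c j)"
      using l.prob_compl[OF Ks] spl by (simp add: Compl_eq_Diff_UNIV)
    then show ?thesis using K(1) by blast
  qed
  then obtain K where K: "\<And>j. compact (K j)" "\<And>j. measure lam (- K j) \<le> exp (- c j)" by metis
  have Kb [measurable]: "- K j \<in> sets borel" for j using K(1) by (simp add: borel_open open_Compl compact_imp_closed)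
  have Kl: "- K j \<in> sets lam" for j using Kb sl by simp
  have Z: "(\<integral>x. exp (c j * indicator (- K j) x) \<partial>lam) \<le> 2" "1 \<le> (\<integral>x. exp (c j * indicator (- K j) x) \<partial>lam)" for j
  proof -
    have "(\<integral>x. exp (c j * indicator (- K j) x) \<partial>lam) = (\<integral>x. 1 + (exp (c j) - 1) * indicator (- K j) x \<partial>lam)"
      by (intro Bochner_Integration.integral_cong) (auto simp: indicator_def)
    also have "\<dots> = 1 + (exp (c j) - 1) * measure lam (- K j)"
      using Kl[of j] spl l.prob_space by (simp add: less_top[symmetric])
    finally have eq: "(\<integral>x. exp (c j * indicator (- K j) x) \<partial>lam) = 1 + (exp (c j) - 1) * measure lam (- K j)" .
    have "(exp (c j) - 1) * measure lam (- K j) \<le> exp (c j) * exp (- c j)"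
      using K(2)[of j] c0[of j] by (intro mult_mono) auto
    then show "(\<integral>x. exp (c j * indicator (- K j) x) \<partial>lam) \<le> 2" unfolding eq by (simp add: exp_minus)
    show "1 \<le> (\<integral>x. exp (c j * indicator (- K j) x) \<partial>lam)" unfolding eq using c0[of j] by simp
  qed
  have ln2: "ln (\<integral>x. exp (c j * indicator (- K j) x) \<partial>lam) \<le> 1" for j
  proof -
    have "ln (\<integral>x. exp (c j * indicator (- K j) x) \<partial>lam) \<le> (\<integral>x. exp (c j * indicator (- K j) x) \<partial>lam) - 1"
      using Z(2)[of j] by (intro ln_le_minus_one) auto
    then show ?thesis using Z(1)[of j] by linarith
  qed
  have \<phi>m: "(\<lambda>x. c j * indicator (- K j) x) \<in> borel_measurable lam" for j
    using Kl[of j] by (intro borel_measurable_times borel_measurable_const borel_measurable_indicator)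
  show ?thesis
  proof (rule that[OF K(1)])
    fix n :: nat assume n: "n > 0"
    let ?P = "PiM {..<n} (\<lambda>_. lam)"
    interpret P: prob_space ?P using l.prob_space_axioms by (intro prob_space_PiM)
    define E where "E j = {wv \<in> space ?P. real n * (L + 3 + real j) \<le> (\<Sum>k<n. c j * indicator (- K j) (wv k))}" for j
    have Es: "E j \<in> sets ?P" for j
    proof -
      have "(\<lambda>wv. \<Sum>k<n. c j * indicator (- K j) (wv k)) \<in> borel_measurable ?P"
        by (intro borel_measurable_sum borel_measurable_component \<phi>m)
      then show ?thesis unfolding E_def by measurable
    qed
    have Eb: "P.prob (E j) \<le> exp (- real n * (L + 2)) * exp (- real n) ^ j" for j
    proof -
      have "P.prob (E j) \<le> exp (real n * (ln (\<integral>x. exp (c j * indicator (- K j) x) \<partial>lam) - (L + 3 + real j)))"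
        unfolding E_def using c0[of j]
        by (intro chernoff_PiM[OF l.prob_space_axioms \<phi>m, where B = "c j"]) (auto simp: indicator_def)
      also have "\<dots> \<le> exp (real n * (1 - (L + 3 + real j)))"
        using ln2[of j] by (intro iffD2[OF exp_le_cancel_iff] mult_left_mono) auto
      also have "\<dots> = exp (- real n * (L + 2) + real j * (- real n))" by (simp add: algebra_simps)
      also have "\<dots> = exp (- real n * (L + 2)) * exp (- real n) ^ j" by (simp only: exp_add exp_of_nat_mult)
      finally show ?thesis .
    qed
    have "1 + real n \<le> exp (real n)" by (rule exp_ge_add_one_self)
    then have "2 \<le> exp (real n)" using n by linarith
    then have e2: "exp (- real n) \<le> 1 / 2" by (simp add: exp_minus field_simps)
    have gs: "summable (\<lambda>j. exp (- real n * (L + 2)) * exp (- real n) ^ j)"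
      using n by (intro summable_mult summable_geometric) auto
    have "{wv \<in> space ?P. \<exists>j. real n * (1 / real (Suc j)) < (\<Sum>k<n. indicator (- K j) (wv k))} \<subseteq> (\<Union>j. E j)"
    proof (intro subsetI, elim CollectE conjE exE)
      fix wv j assume wv: "wv \<in> space ?P" and *: "real n * (1 / real (Suc j)) < (\<Sum>k<n. indicator (- K j) (wv k))"
      have "real n * (L + 3 + real j) = c j * (real n * (1 / real (Suc j)))" by (simp add: c_def)
      also have "\<dots> \<le> c j * (\<Sum>k<n. indicator (- K j) (wv k))" using * c0[of j] by (intro mult_left_mono) auto
      finally show "wv \<in> (\<Union>j. E j)" using wv by (auto simp: E_def sum_distrib_left)
    qed
    then have "P.prob {wv \<in> space ?P. \<exists>j. real n * (1 / real (Suc j)) < (\<Sum>k<n. indicator (- K j) (wv k))}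
        \<le> P.prob (\<Union>j. E j)"
      using Es by (intro P.finite_measure_mono) auto
    also have "\<dots> \<le> (\<Sum>j. P.prob (E j))"
    proof (rule P.finite_measure_subadditive_countably)
      show "summable (\<lambda>j. P.prob (E j))"
        by (rule summable_comparison_test'[OF gs, of 0]) (use Eb in auto)
    qed (use Es in auto)
    also have "\<dots> \<le> (\<Sum>j. exp (- real n * (L + 2)) * exp (- real n) ^ j)"
      by (intro suminf_le Eb gs) (rule summable_comparison_test'[OF gs, of 0], use Eb in auto)
    also have "\<dots> = exp (- real n * (L + 2)) * (1 / (1 - exp (- real n)))"
      using n by (subst suminf_mult) (auto intro!: summable_geometric simp: suminf_geometric)
    also have "\<dots> \<le> exp (- real n * (L + 2)) * exp (real n)"
    proof (rule mult_left_mono)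
      have p: "0 < 1 - exp (- real n)" using e2 by linarith
      have "1 / (1 - exp (- real n)) \<le> 2" using e2 by (simp add: pos_divide_le_eq[OF p] right_diff_distrib)
      then show "1 / (1 - exp (- real n)) \<le> exp (real n)" using \<open>2 \<le> exp (real n)\<close> by linarith
    qed simp
    also have "\<dots> = exp (- real n * (L + 1))" by (simp add: exp_add[symmetric] algebra_simps)
    finally show "P.prob {wv \<in> space ?P. \<exists>j. real n * (1 / real (Suc j)) < (\<Sum>k<n. indicator (- K j) (wv k))}
        \<le> exp (- real n * (L + 1))" .
  next
    fix \<mu> :: "'w measure" and j assume \<mu>: "\<mu> \<in> probs_on euclidean" and H: "relent lam \<mu> \<le> ereal L"
    interpret m: prob_space \<mu> using \<mu> by (simp add: probs_on_euclidean)
    have "(\<integral>x. c j * indicator (- K j) x \<partial>\<mu>) \<le> L + ln (\<integral>x. exp (c j * indicator (- K j) x) \<partial>lam)"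
      using c0[of j]
      by (intro donsker_varadhan_le[OF l.prob_space_axioms m.prob_space_axioms H \<phi>m, where B = "c j"]) (auto simp: indicator_def)
    then have "c j * measure \<mu> (- K j) \<le> L + 1"
      using ln2[of j] Kb[of j] \<mu> by (simp add: probs_on_euclidean)
    then have "measure \<mu> (- K j) \<le> (L + 1) / c j" using c0[of j] by (simp add: field_simps)
    also have "\<dots> \<le> (L + 3 + real j) / c j" using c0[of j] by (intro divide_right_mono) auto
    also have "\<dots> = 1 / real (Suc j)" unfolding c_def using L by simp
    finally show "measure \<mu> (- K j) \<le> 1 / real (Suc j)" .
  qed
qed

lemma bcont_comp_fst:
  "\<phi> \<in> bcont euclidean \<Longrightarrow> (\<lambda>p. \<phi> (fst p)) \<in> bcont euclidean" for \<phi> :: "'w::topological_space \<Rightarrow> real"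
  unfolding bcont_euclidean
  by (auto intro!: continuous_on_compose2[of UNIV \<phi>] continuous_on_fst bounded_subset[of "range \<phi>"])

lemma integral_distr_fst:
  fixes m :: "('w::topological_space \<times> 'x::topological_space) measure" and \<phi> :: "'w \<Rightarrow> real"
  assumes "m \<in> probs_on euclidean" "\<phi> \<in> bcont euclidean"
  shows "(\<integral>w. \<phi> w \<partial>distr m borel fst) = (\<integral>p. \<phi> (fst p) \<partial>m)"
  using bcont_borel_measurable[OF assms(2), of borel]
  by (intro integral_distr fst_measurable_probs[OF assms(1)]) simp

text \<open>The law of the types is left open, because the lower bound under \<open>lam0\<close>
  applies the upper bound under another law \<open>lam\<close>.\<close>

locale nash_selection = nash_game F C
  for F :: "('w::polish_space \<times> 'x::metric_space) measure \<Rightarrow> 'w \<Rightarrow> 'x \<Rightarrow> real" and C :: "'w \<Rightarrow> 'x set" +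
  fixes xh :: "nat \<Rightarrow> nat \<Rightarrow> (nat \<Rightarrow> 'w) \<Rightarrow> 'x"
  assumes xh_meas: "\<And>n i. i < n \<Longrightarrow> xh n i \<in> borel_measurable (PiM {..<n} (\<lambda>_. borel))"
    and xh_nash: "\<And>n wv. wv \<in> space (PiM {..<n} (\<lambda>_. borel)) \<Longrightarrow> nash F C n wv (\<lambda>i. xh n i wv)"
begin

definition eq_emp :: "nat \<Rightarrow> (nat \<Rightarrow> 'w) \<Rightarrow> ('w \<times> 'x) measure" where
  "eq_emp n wv = emp n wv (\<lambda>i. xh n i wv)"

lemma eq_emp_probs: "eq_emp n wv \<in> probs_on euclidean"
  unfolding eq_emp_def by (rule emp_probs)

lemma sets_PiM_probs: "lam \<in> probs_on euclidean \<Longrightarrow> sets (PiM I (\<lambda>_. lam)) = sets (PiM I (\<lambda>_. borel))"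
  by (intro sets_PiM_cong) (auto simp: probs_on_euclidean)

lemma eq_emp_measurable:
  assumes "n > 0" "lam \<in> probs_on euclidean"
  shows "eq_emp n \<in> measurable (PiM {..<n} (\<lambda>_. lam)) (borel_of (weak_top euclidean))"
proof -
  have "eq_emp n \<in> measurable (PiM {..<n} (\<lambda>_. borel)) (borel_of (weak_top euclidean))"
    unfolding eq_emp_def using xh_meas
    by (intro emp_measurable[OF X_compact assms(1)]) auto
  then show ?thesis using measurable_cong_sets[OF sets_PiM_probs[OF assms(2)] refl] by blast
qed

lemma eq_emp_sets:
  assumes "n > 0" "lam \<in> probs_on euclidean" "B \<in> sets (borel_of (weak_top euclidean))"
  shows "{wv \<in> space (PiM {..<n} (\<lambda>_. lam)). eq_emp n wv \<in> B} \<in> sets (PiM {..<n} (\<lambda>_. lam))"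
  using measurable_sets[OF eq_emp_measurable[OF assms(1,2)] assms(3)]
  by (simp add: vimage_def Int_def conj_commute)

lemma eq_emp_nash:
  assumes "lam \<in> probs_on euclidean" "wv \<in> space (PiM {..<n} (\<lambda>_. lam))"
  shows "nash F C n wv (\<lambda>i. xh n i wv)"
  using xh_nash assms sets_eq_imp_space_eq[OF sets_PiM_probs[OF assms(1)]] by metis

text \<open>If the marginal of an equilibrium \<open>m\<close> has entropy above \<open>L\<close>,
  some \<phi> violates the variational inequality at level \<open>L\<close>. The neighbourhood of
  \<open>m\<close> is then an open half-space given by the integral of \<phi>. Whether
  \<open>eq_emp n wv\<close> lies in it depends on the sampled types alone, whatever the selected
  actions, so independence applies.\<close>

lemma local_upper_bound:
  assumes lam: "lam \<in> probs_on euclidean" and L: "0 \<le> L" and m: "m \<in> probs_on euclidean"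
    and H: "m \<in> MFE_all F C \<Longrightarrow> \<not> relent lam (distr m borel fst) \<le> ereal L"
  obtains U c N where "openin (weak_top euclidean) U" "m \<in> U" "L < c"
    "\<And>n. n \<ge> N \<Longrightarrow> n > 0 \<Longrightarrow> measure (PiM {..<n} (\<lambda>_. lam)) {wv \<in> space (PiM {..<n} (\<lambda>_. lam)). eq_emp n wv \<in> U}
       \<le> exp (- c * real n)"
proof (cases "m \<in> MFE_all F C")
  case False
  obtain U N where U: "openin (weak_top euclidean) U" "m \<in> U"
    "\<And>n w x. n \<ge> N \<Longrightarrow> n > 0 \<Longrightarrow> nash F C n w x \<Longrightarrow> emp n w x \<notin> U"
    using non_equilibrium_nbhd[OF m False] by metis
  show ?thesis
  \<comment> \<open>The event is empty for large \<open>n\<close>, so \<open>L + 1\<close> stands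
    for an arbitrary exponent above \<open>L\<close>.\<close>
  proof (rule that[OF U(1,2), of "L + 1" N])
    fix n :: nat assume n: "n \<ge> N" "n > 0"
    have "{wv \<in> space (PiM {..<n} (\<lambda>_. lam)). eq_emp n wv \<in> U} = {}"
      using U(3)[OF n eq_emp_nash[OF lam]] by (auto simp: eq_emp_def)
    then show "measure (PiM {..<n} (\<lambda>_. lam)) {wv \<in> space (PiM {..<n} (\<lambda>_. lam)). eq_emp n wv \<in> U}
       \<le> exp (- (L + 1) * real n)" by (simp only: measure_empty) simp
  qed simp
next
  case True
  interpret l: prob_space lam using lam by (simp add: probs_on_euclidean)
  have sl: "sets lam = sets borel" using lam by (simp add: probs_on_euclidean)
  have "\<exists>\<phi>\<in>bcont euclidean. L + ln (\<integral>x. exp (\<phi> x) \<partial>lam) < (\<integral>x. \<phi> x \<partial>distr m borel fst)"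
  proof (rule ccontr)
    assume "\<not> ?thesis"
    then have "(\<integral>x. \<phi> x \<partial>distr m borel fst) \<le> L + ln (\<integral>x. exp (\<phi> x) \<partial>lam)" if "\<phi> \<in> bcont euclidean" for \<phi>
      using that by (meson not_le)
    then show False using relent_le_of_dv[OF lam distr_fst_probs[OF m]] H[OF True] by blast
  qed
  then obtain \<phi> where \<phi>: "\<phi> \<in> bcont euclidean" "L + ln (\<integral>x. exp (\<phi> x) \<partial>lam) < (\<integral>p. \<phi> (fst p) \<partial>m)"
    using integral_distr_fst[OF m] by auto
  define Z where "Z = ln (\<integral>x. exp (\<phi> x) \<partial>lam)"
  \<comment> \<open>Strictly between, so that \<open>m\<close> lies in the open half-space while the
    exponent \<open>a - Z\<close> still exceeds \<open>L\<close>.\<close>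
  obtain a where a: "L + Z < a" "a < (\<integral>p. \<phi> (fst p) \<partial>m)" using dense \<phi>(2) by (auto simp: Z_def)
  obtain B where B: "\<And>x. \<bar>\<phi> x\<bar> \<le> B" using bcont_bounded[OF \<phi>(1)] by auto
  have \<phi>m: "\<phi> \<in> borel_measurable lam" using bcont_borel_measurable[OF \<phi>(1), of lam] sl by simp
  define U where "U = {m' \<in> probs_on euclidean. a < (\<integral>p. \<phi> (fst p) \<partial>(m' :: ('w \<times> 'x) measure))}"
  show ?thesis
  proof (rule that[of U "a - Z" 0])
    show "openin (weak_top euclidean) U" unfolding U_def by (rule openin_integral_gt[OF bcont_comp_fst[OF \<phi>(1)]])
    show "m \<in> U" using m a(2) by (simp add: U_def)
    show "L < a - Z" using a(1) by simp
    fix n :: nat assume n: "n > 0"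
    let ?P = "PiM {..<n} (\<lambda>_. lam)"
    interpret P: prob_space ?P using l.prob_space_axioms by (intro prob_space_PiM)
    have "{wv \<in> space ?P. eq_emp n wv \<in> U} \<subseteq> {wv \<in> space ?P. real n * a \<le> (\<Sum>k<n. \<phi> (wv k))}"
    proof (intro subsetI, elim CollectE conjE, intro CollectI conjI)
      fix wv assume "wv \<in> space ?P" "eq_emp n wv \<in> U"
      then have "a < (\<Sum>k<n. \<phi> (wv k)) / real n"
        using integral_emp[OF n bcont_borel_measurable[OF bcont_comp_fst[OF \<phi>(1)], of borel], of wv "\<lambda>i. xh n i wv"]
        by (simp add: U_def eq_emp_def)
      then show "real n * a \<le> (\<Sum>k<n. \<phi> (wv k))" using n by (simp add: field_simps)
    qed
    moreover have "{wv \<in> space ?P. real n * a \<le> (\<Sum>k<n. \<phi> (wv k))} \<in> sets ?P"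
    proof -
      have "(\<lambda>wv. \<Sum>k<n. \<phi> (wv k)) \<in> borel_measurable ?P"
        by (intro borel_measurable_sum borel_measurable_component \<phi>m)
      then show ?thesis by measurable
    qed
    ultimately have "P.prob {wv \<in> space ?P. eq_emp n wv \<in> U} \<le> P.prob {wv \<in> space ?P. real n * a \<le> (\<Sum>k<n. \<phi> (wv k))}"
      by (rule P.finite_measure_mono)
    also have "\<dots> \<le> exp (real n * (Z - a))" unfolding Z_def by (rule chernoff_PiM[OF l.prob_space_axioms \<phi>m B])
    also have "real n * (Z - a) = - (a - Z) * real n" by (simp add: algebra_simps)
    finally show "P.prob {wv \<in> space ?P. eq_emp n wv \<in> U} \<le> exp (- (a - Z) * real n)" .
  qed
qed

theorem upper_bound:
  assumes lam: "lam \<in> probs_on euclidean" and L: "0 \<le> L" and B: "closedin (weak_top euclidean) B"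
    and H: "\<And>m. m \<in> B \<Longrightarrow> m \<in> MFE_all F C \<Longrightarrow> \<not> relent lam (distr m borel fst) \<le> ereal L"
  obtains c where "L < c" "\<forall>\<^sub>F n in sequentially.
    measure (PiM {..<n} (\<lambda>_. lam)) {wv \<in> space (PiM {..<n} (\<lambda>_. lam)). eq_emp n wv \<in> B} \<le> exp (- c * real n)"
proof -
  interpret l: prob_space lam using lam by (simp add: probs_on_euclidean)
  let ?P = "\<lambda>n. PiM {..<n} (\<lambda>_. lam)"
  obtain K :: "nat \<Rightarrow> 'w set" where K: "\<And>j. compact (K j)"
    "\<And>n. n > 0 \<Longrightarrow> measure (?P n) {wv \<in> space (?P n).
        \<exists>j. real n * (1 / real (Suc j)) < (\<Sum>k<n. indicator (- K j) (wv k))} \<le> exp (- real n * (L + 1))"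
    by (rule exponentially_tight[OF lam L]) blast
  \<comment> \<open>Only the types can escape to infinity, since the action space is
    compact.\<close>
  define T where "T = {m \<in> probs_on euclidean. \<forall>j. measure m (- (K j \<times> (UNIV :: 'x set))) \<le> 1 / real (Suc j)}"
  have "compactin (weak_top euclidean) T"
    unfolding T_def by (intro tight_compactin_weak_top compact_Times K X_compact)
  then have comp: "compactin (weak_top euclidean) (B \<inter> T)" by (rule closed_Int_compactin[OF B])
  define Q where "Q m U c N \<longleftrightarrow> openin (weak_top euclidean) U \<and> m \<in> U \<and> L < c \<and>
    (\<forall>n\<ge>N. n > 0 \<longrightarrow> measure (?P n) {wv \<in> space (?P n). eq_emp n wv \<in> U} \<le> exp (- c * real n))"
    for m U c and N :: nat
  have "\<exists>U c N. Q m U c N" if m: "m \<in> B \<inter> T" for m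
  proof -
    have mP: "m \<in> probs_on euclidean" using m by (simp add: T_def)
    have mH: "m \<in> MFE_all F C \<Longrightarrow> \<not> relent lam (distr m borel fst) \<le> ereal L" using H m by blast
    show ?thesis
      by (rule local_upper_bound[OF lam L mP mH]) (auto simp: Q_def)
  qed
  then obtain U c N where Q: "\<And>m. m \<in> B \<inter> T \<Longrightarrow> Q m (U m) (c m) (N m)" by metis
  have U: "\<And>m. m \<in> B \<inter> T \<Longrightarrow> openin (weak_top euclidean) (U m)" "\<And>m. m \<in> B \<inter> T \<Longrightarrow> m \<in> U m"
    "\<And>m. m \<in> B \<inter> T \<Longrightarrow> L < c m"
    "\<And>m n. m \<in> B \<inter> T \<Longrightarrow> n \<ge> N m \<Longrightarrow> n > 0 \<Longrightarrow>
       measure (?P n) {wv \<in> space (?P n). eq_emp n wv \<in> U m} \<le> exp (- c m * real n)"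
    using Q unfolding Q_def by blast+
  have "\<forall>V\<in>U ` (B \<inter> T). openin (weak_top euclidean) V" using U(1) by blast
  moreover have "B \<inter> T \<subseteq> \<Union> (U ` (B \<inter> T))" using U(2) by blast
  ultimately have "\<exists>\<F>. finite \<F> \<and> \<F> \<subseteq> U ` (B \<inter> T) \<and> B \<inter> T \<subseteq> \<Union> \<F>"
    using comp[unfolded compactin_def, THEN conjunct2, THEN spec, of "U ` (B \<inter> T)"] by blast
  then obtain \<F> where \<F>: "finite \<F>" "\<F> \<subseteq> U ` (B \<inter> T)" "B \<inter> T \<subseteq> \<Union> \<F>" by blast
  obtain D where "D \<subseteq> B \<inter> T" "finite D" "\<F> = U ` D" using finite_subset_image[OF \<F>(1,2)] by blast
  then have D: "D \<subseteq> B \<inter> T" "finite D" "B \<inter> T \<subseteq> \<Union> (U ` D)" using \<F>(3) by auto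
  \<comment> \<open>The cap \<open>L + 1\<close> is the exponent of the event \<open>R\<close> that
    the sample is not tight.\<close>
  define c1 where "c1 = Min (insert (L + 1) (c ` D))"
  have c1: "L < c1" using D U(3) by (auto simp: c1_def)
  have c1c: "c1 \<le> c m" if "m \<in> D" for m using that D by (auto simp: c1_def)
  have c1L: "c1 \<le> L + 1" using D by (auto simp: c1_def)
  \<comment> \<open>The gap \<open>c1 - c2\<close> absorbs the number \<open>card D + 1\<close> of
    terms once \<open>n \<ge> N2\<close>.\<close>
  define c2 where "c2 = (c1 + L) / 2"
  have c2: "L < c2" "c2 < c1" using c1 by (auto simp: c2_def)
  define N1 where "N1 = Max (insert 1 (N ` D))"
  have N1: "N m \<le> N1" if "m \<in> D" for m using that D by (auto simp: N1_def)
  have N11: "1 \<le> N1" using D by (auto simp: N1_def)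
  obtain N2 :: nat where N2: "ln (real (card D + 1)) < real N2 * (c1 - c2)"
    using reals_Archimedean3[of "c1 - c2"] c2 by auto
  show ?thesis
  proof (rule that[OF c2(1)], rule eventually_sequentiallyI[of "max N1 N2"])
    fix n assume n: "max N1 N2 \<le> n"
    then have n0: "n > 0" and nN: "N1 \<le> n" "N2 \<le> n" using N11 by auto
    interpret P: prob_space "?P n" using l.prob_space_axioms by (intro prob_space_PiM)
    let ?E = "\<lambda>S. {wv \<in> space (?P n). eq_emp n wv \<in> S}"
    define R where "R = {wv \<in> space (?P n). \<exists>j. real n * (1 / real (Suc j)) < (\<Sum>k<n. indicator (- K j) (wv k))}"
    have Kb: "- K j \<in> sets borel" for j using K(1) by (simp add: borel_open open_Compl compact_imp_closed)
    have Rs: "R \<in> sets (?P n)"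
    proof -
      have "indicat_real (- K j) \<in> borel_measurable lam" for j
        using Kb lam by (intro borel_measurable_indicator) (auto simp: probs_on_euclidean)
      then have [measurable]: "(\<lambda>wv. \<Sum>k<n. indicat_real (- K j) (wv k)) \<in> borel_measurable (?P n)" for j
        by (intro borel_measurable_sum borel_measurable_component)
      show ?thesis unfolding R_def by measurable
    qed
    have Us: "?E (U m) \<in> sets (?P n)" if "m \<in> D" for m
      using that D(1) U(1) by (intro eq_emp_sets[OF n0 lam] openin_borel_of) auto
    have sub: "?E B \<subseteq> (\<Union>m\<in>D. ?E (U m)) \<union> R"
    proof (intro subsetI, elim CollectE conjE)
      fix wv assume wv: "wv \<in> space (?P n)" "eq_emp n wv \<in> B"
      show "wv \<in> (\<Union>m\<in>D. ?E (U m)) \<union> R"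
      proof (cases "eq_emp n wv \<in> T")
        case True
        then show ?thesis using wv D(3) by auto
      next
        case False
        then obtain j where j: "1 / real (Suc j) < measure (eq_emp n wv) (- (K j \<times> (UNIV :: 'x set)))"
          using eq_emp_probs by (auto simp: T_def not_le)
        have Kx: "- (K j \<times> (UNIV :: 'x set)) \<in> sets borel"
          by (intro borel_open open_Compl compact_imp_closed compact_Times K(1) X_compact)
        have "measure (eq_emp n wv) (- (K j \<times> (UNIV :: 'x set)))
            = (\<integral>p. indicator (- (K j \<times> (UNIV :: 'x set))) p \<partial>eq_emp n wv)"
          using Kx eq_emp_probs[of n wv] by (simp add: probs_on_euclidean)
        also have "\<dots> = (\<Sum>k<n. indicator (- (K j \<times> (UNIV :: 'x set))) (wv k, xh n k wv)) / real n"
          unfolding eq_emp_def using Kx by (intro integral_emp[OF n0]) auto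
        also have "\<dots> = (\<Sum>k<n. indicator (- K j) (wv k)) / real n"
          by (intro arg_cong2[where f = "(/)"] sum.cong refl) (auto simp: indicator_def)
        finally have eq: "measure (eq_emp n wv) (- (K j \<times> (UNIV :: 'x set))) = (\<Sum>k<n. indicator (- K j) (wv k)) / real n" .
        have "real n * (1 / real (Suc j)) < real n * ((\<Sum>k<n. indicator (- K j) (wv k)) / real n)"
          using mult_strict_left_mono[OF j, of "real n"] n0 unfolding eq by simp
        then have "real n * (1 / real (Suc j)) < (\<Sum>k<n. indicator (- K j) (wv k))"
          using n0 by simp
        then show ?thesis using wv by (auto simp: R_def)
      qed
    qed
    have "P.prob (?E B) \<le> P.prob ((\<Union>m\<in>D. ?E (U m)) \<union> R)"
      using sub Us Rs D(2) by (intro P.finite_measure_mono sets.Un sets.finite_UN) simp_all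
    also have "\<dots> \<le> P.prob (\<Union>m\<in>D. ?E (U m)) + P.prob R"
      using Us Rs D(2) by (intro measure_Un_le sets.finite_UN) simp_all
    also have "P.prob (\<Union>m\<in>D. ?E (U m)) \<le> (\<Sum>m\<in>D. P.prob (?E (U m)))"
      using Us D(2) by (intro measure_UNION_le) simp_all
    also have "\<dots> \<le> (\<Sum>m\<in>D. exp (- c1 * real n))"
    proof (rule sum_mono)
      fix m assume m: "m \<in> D"
      have "P.prob (?E (U m)) \<le> exp (- c m * real n)" using U(4)[of m n] m D(1) N1[OF m] nN n0 by auto
      also have "\<dots> \<le> exp (- c1 * real n)" using c1c[OF m] by (simp add: mult_right_mono)
      finally show "P.prob (?E (U m)) \<le> exp (- c1 * real n)" .
    qed
    also have "P.prob R \<le> exp (- c1 * real n)"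
    proof -
      have "P.prob R \<le> exp (- real n * (L + 1))" unfolding R_def by (rule K(2)[OF n0])
      also have "\<dots> \<le> exp (- c1 * real n)" using mult_right_mono[OF c1L, of "real n"] by (simp add: mult.commute)
      finally show ?thesis .
    qed
    finally have "P.prob (?E B) \<le> real (card D + 1) * exp (- c1 * real n)" by (simp add: algebra_simps)
    also have "\<dots> = exp (ln (real (card D + 1)) - c1 * real n)" by (simp add: exp_diff exp_minus divide_inverse)
    also have "\<dots> \<le> exp (- c2 * real n)"
    proof -
      have "real N2 * (c1 - c2) \<le> real n * (c1 - c2)" using nN c2 by (intro mult_right_mono) auto
      then have "ln (real (card D + 1)) \<le> real n * (c1 - c2)" using N2 by linarith
      then show ?thesis by (simp add: algebra_simps)
    qed
    finally show "P.prob (?E B) \<le> exp (- c2 * real n)" .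
  qed
qed

text \<open>The indicator of the event is multiplied by \<open>a = (h + \<delta>) * n\<close>. If
  the probability \<open>q\<close> under \<open>lam0\<close> were below \<open>exp (- a)\<close>,
  the exponential moment would be at most 2, so that \<open>a * p \<le> n * h + ln 2\<close>, where
  the probability \<open>p\<close> under \<open>lam\<close> tends to 1; this fails for large
  \<open>n\<close>.\<close>

theorem lower_bound:
  assumes lam0: "lam0 \<in> probs_on euclidean" and lam: "lam \<in> probs_on euclidean"
    and H: "relent lam0 lam \<le> ereal h" and G: "openin (weak_top euclidean) G" and MG: "MFE F C lam \<subseteq> G"
    and \<delta>: "0 < \<delta>"
  shows "\<forall>\<^sub>F n in sequentially. exp (- (h + \<delta>) * real n)
    \<le> measure (PiM {..<n} (\<lambda>_. lam0)) {wv \<in> space (PiM {..<n} (\<lambda>_. lam0)). eq_emp n wv \<in> G}"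
proof -
  interpret l0: prob_space lam0 using lam0 by (simp add: probs_on_euclidean)
  interpret l: prob_space lam using lam by (simp add: probs_on_euclidean)
  let ?R = "\<lambda>n. PiM {..<n} (\<lambda>_. lam0)" and ?P = "\<lambda>n. PiM {..<n} (\<lambda>_. lam)"
  let ?E = "\<lambda>n. {wv \<in> space (?P n). eq_emp n wv \<in> G}"
  have h0: "0 \<le> h" using relent_nonneg[OF l0.prob_space_axioms l.prob_space_axioms] H
    by (metis ereal_less_eq(5) order_trans zero_ereal_def)
  \<comment> \<open>An equilibrium outside \<open>G\<close> cannot have marginal \<open>lam\<close>,
    so its marginal has positive entropy relative to \<open>lam\<close>; the upper bound at level 0
    thus applies to the complement of \<open>G\<close>.\<close>
  have "closedin (weak_top euclidean) (probs_on euclidean - G)" using G by (metis closedin_diff closedin_topspace topspace_weak_top)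
  then obtain c where c: "0 < c" and up: "\<forall>\<^sub>F n in sequentially.
    measure (?P n) {wv \<in> space (?P n). eq_emp n wv \<in> probs_on euclidean - G} \<le> exp (- c * real n)"
  proof (rule upper_bound[OF lam order_refl])
    fix m assume m: "m \<in> probs_on euclidean - G" "m \<in> MFE_all F C"
    show "\<not> relent lam (distr m borel fst) \<le> ereal 0"
    proof
      assume "relent lam (distr m borel fst) \<le> ereal 0"
      then have "distr m borel fst = lam"
        using relent_le_0_imp_eq[OF l.prob_space_axioms] distr_fst_probs[of m] m(1) by (auto simp: probs_on_euclidean)
      then show False using m MG by (auto simp: MFE_iff)
    qed
  qed
  \<comment> \<open>The margin \<open>a * p - n * h - ln 2\<close>, divided by \<open>n\<close> and
    with \<open>p\<close> replaced by its lower bound; the limit is \<delta>.\<close>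
  have lim: "(\<lambda>n. (h + \<delta>) * (1 - exp (- c * real n)) - ln 2 / real n - h) \<longlonglongrightarrow> (h + \<delta>) * (1 - 0) - 0 - h"
    by (intro tendsto_intros exp_linear_decay[OF c] lim_const_over_n)
  then have "\<forall>\<^sub>F n in sequentially. 0 < (h + \<delta>) * (1 - exp (- c * real n)) - ln 2 / real n - h"
    using \<delta> by (intro order_tendstoD) auto
  then show ?thesis
    using up eventually_gt_at_top[of 0]
  proof eventually_elim
    case (elim n)
    then have n: "n > 0" by simp
    interpret P0: prob_space "?R n" using l0.prob_space_axioms by (intro prob_space_PiM)
    interpret P: prob_space "?P n" using l.prob_space_axioms by (intro prob_space_PiM)
    have sp: "sets (?P n) = sets (?R n)" using sets_PiM_probs lam lam0 by metis
    have spc: "space (?P n) = space (?R n)" by (rule sets_eq_imp_space_eq[OF sp])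
    define En where "En = ?E n"
    have Es: "En \<in> sets (?P n)" unfolding En_def by (rule eq_emp_sets[OF n lam openin_borel_of[OF G]])
    then have Es0: "En \<in> sets (?R n)" using sp by simp
    define p where "p = P.prob (En)"
    define q where "q = P0.prob (En)"
    have "{wv \<in> space (?P n). eq_emp n wv \<in> probs_on euclidean - G} = space (?P n) - En"
      using eq_emp_probs by (auto simp: En_def)
    then have "1 - p \<le> exp (- c * real n)" using elim(2) P.prob_compl[OF Es] by (simp add: p_def)
    show ?case
    proof (rule ccontr)
      assume neg: "\<not> ?thesis"
      then have q: "q < exp (- (h + \<delta>) * real n)" by (simp add: q_def En_def spc)
      define a where "a = (h + \<delta>) * real n"
      have a0: "a \<ge> 0" using h0 \<delta> by (simp add: a_def)
      have "(\<integral>x. a * indicator (En) x \<partial>?P n) \<le> real (card {..<n}) * h + ln (\<integral>x. exp (a * indicator (En) x) \<partial>?R n)"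
        using Es0 a0
        by (intro donsker_varadhan_PiM[OF l0.prob_space_axioms l.prob_space_axioms H, where B = a]) (auto simp: indicator_def)
      also have "(\<integral>x. exp (a * indicator (En) x) \<partial>?R n) = (\<integral>x. 1 + (exp a - 1) * indicator (En) x \<partial>?R n)"
        by (intro Bochner_Integration.integral_cong) (auto simp: indicator_def)
      also have "\<dots> = 1 + (exp a - 1) * q"
        using Es0 P0.prob_space by (simp add: less_top[symmetric] q_def sets.Int_space_eq2)
      also have "ln (1 + (exp a - 1) * q) \<le> ln 2"
      proof -
        have "q \<le> exp (- a)" using q by (simp add: a_def del: minus_add_distrib)
        then have "(exp a - 1) * q \<le> exp a * exp (- a)" using a0 by (intro mult_mono) (auto simp: q_def)
        then have "(exp a - 1) * q \<le> 1" by (simp add: exp_minus)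
        moreover have "0 \<le> (exp a - 1) * q" using a0 by (simp add: q_def)
        ultimately show ?thesis by (subst ln_le_cancel_iff) auto
      qed
      finally have "a * p \<le> real n * h + ln 2"
        using Es by (simp add: p_def sets.Int_space_eq2)
      moreover have "a * (1 - exp (- c * real n)) \<le> a * p"
        using \<open>1 - p \<le> exp (- c * real n)\<close> a0 by (intro mult_left_mono) auto
      ultimately have "(h + \<delta>) * real n * (1 - exp (- c * real n)) \<le> real n * h + ln 2" by (simp add: a_def)
      moreover have "0 < real n * ((h + \<delta>) * (1 - exp (- c * real n)) - ln 2 / real n - h)"
        using elim(1) n by simp
      moreover have "real n * ((h + \<delta>) * (1 - exp (- c * real n)) - ln 2 / real n - h)
          = (h + \<delta>) * real n * (1 - exp (- c * real n)) - ln 2 - real n * h"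
      proof -
        define z where "z = ln 2 / real n"
        have "real n * z = ln 2" using n by (simp add: z_def)
        then show ?thesis unfolding z_def[symmetric] by (simp add: algebra_simps)
      qed
      ultimately show False by linarith
    qed
  qed
qed

end

subsection \<open>The conditional limit\<close>

context nash_game
begin

text \<open>By the two halves of the variational formula the level set is an intersection of closed
  half-spaces, one for each test function of the type.\<close>

lemma closedin_relent_level:
  assumes lam0: "lam0 \<in> probs_on euclidean"
  shows "closedin (weak_top euclidean) {m \<in> probs_on euclidean. relent lam0 (distr (m :: ('w \<times> 'x) measure) borel fst) \<le> ereal L}"
proof -
  interpret l0: prob_space lam0 using lam0 by (simp add: probs_on_euclidean)
  define S where "S \<phi> = {m \<in> topspace (weak_top euclidean).
      (\<integral>p. \<phi> (fst p) \<partial>(m :: ('w \<times> 'x) measure)) \<in> {..L + ln (\<integral>x. exp (\<phi> x) \<partial>lam0)}}" for \<phi>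
  have "{m \<in> probs_on euclidean. relent lam0 (distr (m :: ('w \<times> 'x) measure) borel fst) \<le> ereal L}
      = (\<Inter>\<phi>\<in>bcont euclidean. S \<phi>)" (is "?A = ?B")
  proof (intro set_eqI iffI INT_I)
    fix m \<phi> assume m: "m \<in> ?A" and \<phi>: "\<phi> \<in> bcont (euclidean :: 'w topology)"
    then have mP: "m \<in> probs_on euclidean" by simp
    obtain B where B: "\<And>x. \<bar>\<phi> x\<bar> \<le> B" using bcont_bounded[OF \<phi>] by auto
    have "(\<integral>x. \<phi> x \<partial>distr m borel fst) \<le> L + ln (\<integral>x. exp (\<phi> x) \<partial>lam0)"
      using distr_fst_probs[OF mP] m bcont_borel_measurable[OF \<phi>, of lam0] lam0
      by (intro donsker_varadhan_le[OF l0.prob_space_axioms _ _ _ B]) (auto simp: probs_on_euclidean)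
    then show "m \<in> S \<phi>" using mP by (simp add: S_def integral_distr_fst[OF mP \<phi>])
  next
    fix m assume m: "m \<in> ?B"
    then have "m \<in> S (\<lambda>_. 0)" using bcont_const by blast
    then have mP: "m \<in> probs_on euclidean" by (simp add: S_def)
    have "relent lam0 (distr m borel fst) \<le> ereal L"
    proof (rule relent_le_of_dv[OF lam0 distr_fst_probs[OF mP]])
      fix \<phi> assume \<phi>: "\<phi> \<in> bcont (euclidean :: 'w topology)"
      then have "m \<in> S \<phi>" using m by blast
      then show "(\<integral>x. \<phi> x \<partial>distr m borel fst) \<le> L + ln (\<integral>x. exp (\<phi> x) \<partial>lam0)"
        by (simp add: S_def integral_distr_fst[OF mP \<phi>])
    qed
    then show "m \<in> ?A" using mP by simp
  qed
  moreover have "closedin (weak_top euclidean) (\<Inter>\<phi>\<in>bcont euclidean. S \<phi>)"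
  proof (rule closedin_Inter)
    show "S ` bcont euclidean \<noteq> {}" using bcont_const by blast
    fix T assume "T \<in> S ` bcont euclidean"
    then obtain \<phi> where \<phi>: "\<phi> \<in> bcont euclidean" "T = S \<phi>" by blast
    show "closedin (weak_top euclidean) T"
      unfolding \<phi>(2) S_def
      by (rule closedin_continuous_map_preimage[OF continuous_map_integral[OF bcont_comp_fst[OF \<phi>(1)]]]) simp
  qed
  ultimately show ?thesis by simp
qed

text \<open>The entropy bound makes the type marginals uniformly tight, and compactness of the
  action space extends this to the joint laws.\<close>

lemma compactin_relent_level:
  assumes lam0: "lam0 \<in> probs_on euclidean" and L: "0 \<le> L"
  shows "compactin (weak_top euclidean) {m \<in> probs_on euclidean. relent lam0 (distr (m :: ('w \<times> 'x) measure) borel fst) \<le> ereal L}"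
proof -
  obtain K :: "nat \<Rightarrow> 'w set" where K: "\<And>j. compact (K j)"
    "\<And>\<mu> j. \<mu> \<in> probs_on euclidean \<Longrightarrow> relent lam0 \<mu> \<le> ereal L \<Longrightarrow> measure \<mu> (- K j) \<le> 1 / real (Suc j)"
    by (rule exponentially_tight[OF lam0 L]) blast
  have "compactin (weak_top euclidean)
      {m \<in> probs_on euclidean. \<forall>j. measure m (- (K j \<times> (UNIV :: 'x set))) \<le> 1 / real (Suc j)}"
    by (intro tight_compactin_weak_top compact_Times K X_compact)
  then show ?thesis
  proof (rule closed_compactin[OF _ _ closedin_relent_level[OF lam0]], safe)
    fix m :: "('w \<times> 'x) measure" and j
    assume m: "m \<in> probs_on euclidean" "relent lam0 (distr m borel fst) \<le> ereal L"
    have Kb: "- K j \<in> sets borel" using K(1) by (simp add: borel_open open_Compl compact_imp_closed)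
    have "measure (distr m borel fst) (- K j) = measure m (fst -` (- K j) \<inter> space m)"
      by (rule measure_distr[OF fst_measurable_probs[OF m(1)] Kb])
    also have "space m = UNIV" using m(1) sets_eq_imp_space_eq[of m borel] by (simp add: probs_on_euclidean)
    then have "fst -` (- K j) \<inter> space m = - (K j \<times> (UNIV :: 'x set))" by auto
    finally show "measure m (- (K j \<times> (UNIV :: 'x set))) \<le> 1 / real (Suc j)"
      using K(2)[OF distr_fst_probs[OF m(1)] m(2), of j] by simp
  qed
qed

section \<open>The rate and its minimizers\<close>

lemma rate_cl_nonneg:
  assumes "lam0 \<in> probs_on euclidean" shows "0 \<le> rate_cl F C lam0 A"
  unfolding rate_cl_def using assms
  by (intro INF_greatest relent_nonneg) (auto simp: probs_on_euclidean)

lemma relent_finite_ac: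
  "relent lam0 lam < \<infinity> \<Longrightarrow> absolutely_continuous lam0 lam"
  by (auto simp: relent_def split: if_splits)

text \<open>Finite entropy supplies the absolute continuity demanded in \<open>rate_cl\<close>;
  infinite entropy makes the bound trivial.\<close>

lemma rate_cl_le:
  assumes "m \<in> weak_top euclidean closure_of A" "m \<in> MFE_all F C"
  shows "rate_cl F C lam0 A \<le> relent lam0 (distr m borel fst)"
proof (cases "relent lam0 (distr m borel fst) < \<infinity>")
  case True
  have "m \<in> MFE F C (distr m borel fst)" using assms by (simp add: MFE_iff)
  then show ?thesis unfolding rate_cl_def using assms True
    by (intro INF_lower) (auto simp: relent_finite_ac distr_fst_probs MFE_all_iff)
qed auto

text \<open>On equilibria in the closure of \<open>A\<close> the entropy is at least the rate, so
  the equality in \<open>minset\<close> may be weakened to \<le>, which exhibits it as an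
  intersection of closed sets.\<close>

lemma minset_eq:
  assumes "rate_cl F C lam0 A = ereal I"
  shows "minset F C lam0 A = (weak_top euclidean closure_of A \<inter> MFE_all F C)
    \<inter> {m \<in> probs_on euclidean. relent lam0 (distr m borel fst) \<le> ereal I}"
  unfolding minset_def using rate_cl_le[of _ A lam0] assms by (auto simp: MFE_all_iff intro: antisym)

lemma closedin_minset:
  assumes "lam0 \<in> probs_on euclidean" "rate_cl F C lam0 A = ereal I"
  shows "closedin (weak_top euclidean) (minset F C lam0 A)"
  unfolding minset_eq[OF assms(2)]
  by (intro closedin_Int closedin_closure_of closedin_MFE_all closedin_relent_level assms)

lemma compactin_minset:
  assumes lam0: "lam0 \<in> probs_on euclidean" and I: "rate_cl F C lam0 A = ereal I"
  shows "compactin (weak_top euclidean) (minset F C lam0 A)"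
proof (rule closed_compactin[OF compactin_relent_level[OF lam0]])
  show "0 \<le> I" using rate_cl_nonneg[OF lam0, of A] I by simp
  show "minset F C lam0 A \<subseteq> {m \<in> probs_on euclidean. relent lam0 (distr m borel fst) \<le> ereal I}"
    unfolding minset_eq[OF I] by blast
qed (rule closedin_minset[OF assms])

text \<open>The minimizing sequence is replaced by nested closed sets \<open>S n\<close> of
  equilibria within \<open>1 / Suc n\<close> of the optimum. If their intersection were empty, their
  complements would cover the compact level set at \<open>I + 1\<close>, and finitely many would
  already do so, although every \<open>S n\<close> is nonempty.\<close>

lemma minset_nonempty:
  assumes lam0: "lam0 \<in> probs_on euclidean" and I: "rate_cl F C lam0 A = ereal I"
  shows "minset F C lam0 A \<noteq> {}"
proof
  assume empty: "minset F C lam0 A = {}"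
  define lev where "lev L = {m \<in> probs_on euclidean. relent lam0 (distr (m :: ('w \<times> 'x) measure) borel fst) \<le> ereal L}" for L
  define S where "S n = (weak_top euclidean closure_of A \<inter> MFE_all F C) \<inter> lev (I + 1 / real (Suc n))" for n :: nat
  have I0: "0 \<le> I" using rate_cl_nonneg[OF lam0, of A] I by simp
  have Scl: "closedin (weak_top euclidean) (S n)" for n
    unfolding S_def lev_def by (intro closedin_Int closedin_closure_of closedin_MFE_all closedin_relent_level lam0)
  have dec: "S n \<subseteq> S k" if "k \<le> n" for k n
  proof -
    have "1 / real (Suc n) \<le> 1 / real (Suc k)" using that by (intro divide_left_mono) auto
    then have "ereal (I + 1 / real (Suc n)) \<le> ereal (I + 1 / real (Suc k))" by simp
    then show ?thesis unfolding S_def lev_def by (auto intro: order_trans)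
  qed
  have "lev (I + 1) \<subseteq> (\<Union>n. topspace (weak_top euclidean) - S n)"
  proof
    fix m assume m: "m \<in> lev (I + 1)"
    show "m \<in> (\<Union>n. topspace (weak_top euclidean) - S n)"
    proof (rule ccontr)
      assume "m \<notin> (\<Union>n. topspace (weak_top euclidean) - S n)"
      then have mS: "\<And>n. m \<in> S n" using m by (auto simp: lev_def)
      have "relent lam0 (distr m borel fst) \<le> ereal I"
      proof (rule ereal_le_epsilon2)
        fix e :: real assume "0 < e"
        then obtain n where n: "1 / real (Suc n) < e" using nat_approx_posE by blast
        have "relent lam0 (distr m borel fst) \<le> ereal (I + 1 / real (Suc n))" using mS[of n] by (simp add: S_def lev_def)
        also have "\<dots> \<le> ereal I + ereal e" using n by simp
        finally show "relent lam0 (distr m borel fst) \<le> ereal I + ereal e" .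
      qed
      then have "m \<in> minset F C lam0 A" using mS[of 0] by (simp add: minset_eq[OF I] S_def lev_def)
      then show False using empty by simp
    qed
  qed
  moreover have "compactin (weak_top euclidean) (lev (I + 1))"
    unfolding lev_def using I0 by (intro compactin_relent_level lam0) auto
  moreover have "\<forall>V\<in>range (\<lambda>n. topspace (weak_top euclidean) - S n). openin (weak_top euclidean) V"
    using openin_diff[OF openin_topspace Scl] by blast
  ultimately obtain \<F> where \<F>: "finite \<F>" "\<F> \<subseteq> range (\<lambda>n. topspace (weak_top euclidean) - S n)" "lev (I + 1) \<subseteq> \<Union> \<F>"
    unfolding compactin_def by meson
  obtain D where D: "finite D" "\<F> = (\<lambda>n. topspace (weak_top euclidean) - S n) ` D"
    using finite_subset_image[OF \<F>(1,2)] by blast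
  \<comment> \<open>The sets decrease, so a point of \<open>S N\<close> lies in every
    \<open>S n\<close> with \<open>n \<in> D\<close> and is missed by the subcover.\<close>
  define N where "N = Max (insert 0 D)"
  have "rate_cl F C lam0 A < ereal (I + 1 / real (Suc N))" using I by simp
  then obtain lam where lam: "(weak_top euclidean closure_of A) \<inter> MFE F C lam \<noteq> {}" "relent lam0 lam < ereal (I + 1 / real (Suc N))"
    unfolding rate_cl_def INF_less_iff by auto
  then obtain m where "m \<in> weak_top euclidean closure_of A" "m \<in> MFE F C lam" by blast
  then have m: "m \<in> weak_top euclidean closure_of A" "m \<in> MFE_all F C" "distr m borel fst = lam"
    by (simp_all add: MFE_iff)
  then have mN: "m \<in> S N" using lam(2) by (auto simp: S_def lev_def MFE_all_iff)
  moreover have "S N \<subseteq> lev (I + 1)" using dec[of 0 N] by (auto simp: S_def)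
  ultimately obtain n where n: "n \<in> D" "m \<notin> S n" using \<F>(3) D(2) by blast
  have "n \<le> N" using n(1) D(1) by (simp add: N_def)
  then show False using dec mN n(2) by blast
qed

text \<open>The minimizer set is the zero set of a continuous function: pull back the distance to its compact
  image under a countable separating family of integrals.\<close>

lemma zero_set_function:
  fixes S :: "('w \<times> 'x) measure set"
  assumes S: "compactin (weak_top euclidean) S" "S \<noteq> {}"
  obtains f where "f \<in> bcont (weak_top euclidean)" "\<And>m. 0 \<le> f m"
    "\<And>m. m \<in> probs_on euclidean \<Longrightarrow> f m = 0 \<longleftrightarrow> m \<in> S"
proof -
  obtain \<phi> :: "nat \<Rightarrow> ('w \<times> 'x) \<Rightarrow> real" where \<phi>: "\<And>k. \<phi> k \<in> bcont euclidean"
    "\<And>m m'. m \<in> probs_on euclidean \<Longrightarrow> m' \<in> probs_on euclidean \<Longrightarrow>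
       (\<And>k. (\<integral>p. \<phi> k p \<partial>m) = (\<integral>p. \<phi> k p \<partial>m')) \<Longrightarrow> m = m'"
    using countable_separating_family[OF X_compact] by metis
  define \<Phi> where "\<Phi> m = (\<lambda>k. \<integral>p. \<phi> k p \<partial>m)" for m
  have "continuous_map (weak_top euclidean) (product_topology (\<lambda>_. euclideanreal) UNIV) \<Phi>"
    unfolding continuous_map_componentwise_UNIV \<Phi>_def by (auto intro: continuous_map_integral \<phi>)
  then have \<Phi>c: "continuous_map (weak_top euclidean) euclidean \<Phi>" by (simp add: euclidean_product_topology)
  \<comment> \<open>Compactness of \<open>S\<close> makes its image closed, so that distance 0 to
    the image means membership.\<close>
  have "compact (\<Phi> ` S)" using image_compactin[OF S(1) \<Phi>c] by simp
  then have cl: "closed (\<Phi> ` S)" by (rule compact_imp_closed)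
  have ne: "\<Phi> ` S \<noteq> {}" using S(2) by simp
  have Ssub: "S \<subseteq> probs_on euclidean" using compactin_subset_topspace[OF S(1)] by simp
  have inj: "m \<in> S" if "m \<in> probs_on euclidean" "\<Phi> m \<in> \<Phi> ` S" for m
  proof -
    obtain s where s: "s \<in> S" "\<Phi> m = \<Phi> s" using \<open>\<Phi> m \<in> \<Phi> ` S\<close> by blast
    have "m = s" using s Ssub that(1) by (intro \<phi>(2)) (auto simp: \<Phi>_def fun_eq_iff)
    then show ?thesis using s by simp
  qed
  show ?thesis
  \<comment> \<open>The minimum with 1 makes the function bounded and leaves its zero set
    unchanged.\<close>
  proof (rule that[of "\<lambda>m. min 1 (infdist (\<Phi> m) (\<Phi> ` S))"])
    have "continuous_map euclidean euclideanreal (\<lambda>z. infdist z (\<Phi> ` S))"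
      by (auto intro!: continuous_intros)
    then have "continuous_map (weak_top euclidean) euclideanreal (\<lambda>m. infdist (\<Phi> m) (\<Phi> ` S))"
      using continuous_map_compose[OF \<Phi>c] unfolding comp_def by blast
    then have "continuous_map (weak_top euclidean) euclideanreal (\<lambda>m. min 1 (infdist (\<Phi> m) (\<Phi> ` S)))"
      by (intro continuous_map_real_min continuous_map_const[THEN iffD2]) auto
    moreover have "\<bar>min 1 (infdist (\<Phi> m) (\<Phi> ` S))\<bar> \<le> 1" for m using infdist_nonneg[of "\<Phi> m" "\<Phi> ` S"] by linarith
    ultimately show "(\<lambda>m. min 1 (infdist (\<Phi> m) (\<Phi> ` S))) \<in> bcont (weak_top euclidean)"
      by (auto simp: bcont_def bounded_iff)
    show "0 \<le> min 1 (infdist (\<Phi> m) (\<Phi> ` S))" for m by (simp add: infdist_nonneg)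
    show "min 1 (infdist (\<Phi> m) (\<Phi> ` S)) = 0 \<longleftrightarrow> m \<in> S" if "m \<in> probs_on euclidean" for m
    proof -
      have "min 1 (infdist (\<Phi> m) (\<Phi> ` S)) = 0 \<longleftrightarrow> infdist (\<Phi> m) (\<Phi> ` S) = 0" by auto
      also have "\<dots> \<longleftrightarrow> \<Phi> m \<in> \<Phi> ` S" using in_closed_iff_infdist_zero[OF cl ne] by simp
      also have "\<dots> \<longleftrightarrow> m \<in> S" using inj[OF that] by blast
      finally show ?thesis .
    qed
  qed
qed

section \<open>Rates as infima over equilibria\<close>

lemma rate_cl_eq:
  "rate_cl F C lam0 A = (INF m\<in>(weak_top euclidean closure_of A) \<inter> MFE_all F C. relent lam0 (distr m borel fst))"
proof (rule antisym)
  show "rate_cl F C lam0 A \<le> (INF m\<in>(weak_top euclidean closure_of A) \<inter> MFE_all F C. relent lam0 (distr m borel fst))"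
    by (intro INF_greatest rate_cl_le) auto
  show "(INF m\<in>(weak_top euclidean closure_of A) \<inter> MFE_all F C. relent lam0 (distr m borel fst)) \<le> rate_cl F C lam0 A"
    unfolding rate_cl_def
  proof (rule INF_greatest)
    fix lam assume "lam \<in> {lam \<in> probs_on euclidean. absolutely_continuous lam0 lam \<and>
        (weak_top euclidean closure_of A) \<inter> MFE F C lam \<noteq> {}}"
    then obtain m where "m \<in> weak_top euclidean closure_of A" "m \<in> MFE F C lam" by blast
    then have "m \<in> (weak_top euclidean closure_of A) \<inter> MFE_all F C" "distr m borel fst = lam"
      by (simp_all add: MFE_iff)
    then show "(INF m\<in>(weak_top euclidean closure_of A) \<inter> MFE_all F C. relent lam0 (distr m borel fst)) \<le> relent lam0 lam"
      by (metis INF_lower)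
  qed
qed

text \<open>When \<open>MFE F C lam\<close> has one element, its inclusion in the interior and its
  intersecting the interior are the same condition. Equilibria of infinite entropy do not affect the
  infimum.\<close>

lemma rate_int_eq:
  assumes single: "\<And>lam. lam \<in> probs_on euclidean \<Longrightarrow> absolutely_continuous lam0 lam \<Longrightarrow> \<exists>m. MFE F C lam = {m}"
  shows "rate_int F C lam0 A = (INF m\<in>(weak_top euclidean interior_of A) \<inter> MFE_all F C. relent lam0 (distr m borel fst))"
proof (rule antisym)
  show "rate_int F C lam0 A \<le> (INF m\<in>(weak_top euclidean interior_of A) \<inter> MFE_all F C. relent lam0 (distr m borel fst))"
  proof (rule INF_greatest)
    fix m assume m: "m \<in> (weak_top euclidean interior_of A) \<inter> MFE_all F C"
    show "rate_int F C lam0 A \<le> relent lam0 (distr m borel fst)"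
    proof (cases "relent lam0 (distr m borel fst) < \<infinity>")
      case True
      have P: "distr m borel fst \<in> probs_on euclidean" using m by (simp add: MFE_all_iff distr_fst_probs)
      obtain m' where m': "MFE F C (distr m borel fst) = {m'}" using single[OF P relent_finite_ac[OF True]] by blast
      have "m \<in> MFE F C (distr m borel fst)" using m by (simp add: MFE_iff)
      then have "MFE F C (distr m borel fst) = {m}" using m' by simp
      then show ?thesis unfolding rate_int_def using m P relent_finite_ac[OF True] by (intro INF_lower) auto
    qed auto
  qed
  show "(INF m\<in>(weak_top euclidean interior_of A) \<inter> MFE_all F C. relent lam0 (distr m borel fst)) \<le> rate_int F C lam0 A"
    unfolding rate_int_def
  proof (rule INF_greatest)
    fix lam assume lam: "lam \<in> {lam \<in> probs_on euclidean. absolutely_continuous lam0 lam \<and>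
        MFE F C lam \<subseteq> weak_top euclidean interior_of A}"
    then obtain m where "MFE F C lam = {m}" using single by blast
    then have "m \<in> (weak_top euclidean interior_of A) \<inter> MFE_all F C" "distr m borel fst = lam"
      using lam MFE_iff[of m F C lam] by auto
    then show "(INF m\<in>(weak_top euclidean interior_of A) \<inter> MFE_all F C. relent lam0 (distr m borel fst)) \<le> relent lam0 lam"
      by (metis INF_lower)
  qed
qed

end

text \<open>A non-measurable set has \<open>measure\<close> 0, so only the larger set has to be
  measurable. This serves for events defined through an infimum of distances, which are enclosed in
  measurable ones.\<close>

lemma measure_mono_superset:
  assumes "finite_measure M" "X \<subseteq> Y" "Y \<in> sets M"
  shows "measure M X \<le> measure M Y"
proof (cases "X \<in> sets M")
  case True
  then show ?thesis using assms finite_measure.finite_measure_mono by blast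
qed (simp add: measure_notin_sets)

section \<open>Empirical measures of equilibria with sampled types\<close>

locale nash_sampling = nash_selection F C xh
  for F :: "('w::polish_space \<times> 'x::metric_space) measure \<Rightarrow> 'w \<Rightarrow> 'x \<Rightarrow> real" and C :: "'w \<Rightarrow> 'x set"
    and xh :: "nat \<Rightarrow> nat \<Rightarrow> (nat \<Rightarrow> 'w) \<Rightarrow> 'x" +
  fixes lam0 :: "'w measure" and Pr :: "'o measure" and W :: "nat \<Rightarrow> 'o \<Rightarrow> 'w"
    and A :: "('w \<times> 'x) measure set"
  assumes lam0: "lam0 \<in> probs_on euclidean"
    and Pr: "prob_space Pr"
    and W_meas: "\<And>i. W i \<in> measurable Pr borel"
    and W_indep: "prob_space.indep_vars Pr (\<lambda>_. borel) W UNIV"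
    and W_law: "\<And>i. distr Pr borel (W i) = lam0"
    and A_sub: "A \<subseteq> probs_on euclidean"
    and A_meas: "A \<in> sets (borel_of (weak_top euclidean))"
begin

sublocale Pr: prob_space Pr by (rule Pr)

abbreviation "\<mu> \<equiv> mu_n W xh"
abbreviation "event n B \<equiv> {\<omega> \<in> space Pr. \<mu> n \<omega> \<in> B}"

lemma sample_measurable: "(\<lambda>\<omega>. restrict (\<lambda>k. W k \<omega>) {..<n}) \<in> measurable Pr (PiM {..<n} (\<lambda>_. borel))"
  using W_meas by (intro measurable_restrict) auto

lemma sample_law:
  assumes "n > 0"
  shows "distr Pr (PiM {..<n} (\<lambda>_. borel)) (\<lambda>\<omega>. restrict (\<lambda>k. W k \<omega>) {..<n}) = PiM {..<n} (\<lambda>_. lam0)"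
proof -
  have "Pr.indep_vars (\<lambda>_. borel) W {..<n}" by (rule Pr.indep_vars_subset[OF W_indep]) auto
  then show ?thesis
    using Pr.indep_vars_iff_distr_eq_PiM'[of "{..<n}" W "\<lambda>_. borel"] W_meas W_law assms by (auto simp: lessThan_empty_iff)
qed

lemma mu_eq: "n > 0 \<Longrightarrow> \<mu> n \<omega> = eq_emp n (restrict (\<lambda>k. W k \<omega>) {..<n})"
  unfolding mu_n_def eq_emp_def by (rule emp_cong) auto

lemma mu_measurable:
  assumes "n > 0" shows "\<mu> n \<in> measurable Pr (borel_of (weak_top euclidean))"
proof -
  have "eq_emp n \<in> measurable (PiM {..<n} (\<lambda>_. borel)) (borel_of (weak_top euclidean))"
    using eq_emp_measurable[OF assms lam0] measurable_cong_sets[OF sets_PiM_probs[OF lam0, of "{..<n}"] refl] by blast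
  then show ?thesis using measurable_compose[OF sample_measurable] assms by (simp add: mu_eq cong: measurable_cong)
qed

lemma event_sets: "n > 0 \<Longrightarrow> B \<in> sets (borel_of (weak_top euclidean)) \<Longrightarrow> event n B \<in> sets Pr"
  using measurable_sets[OF mu_measurable, of n B] by (simp add: vimage_def Int_def conj_commute)

text \<open>Independence and the common law turn the sample into a draw from the product measure,
  where the large deviation bounds were proved.\<close>

lemma prob_event:
  assumes n: "n > 0" and B: "B \<in> sets (borel_of (weak_top euclidean))"
  shows "Pr.prob (event n B) = measure (PiM {..<n} (\<lambda>_. lam0)) {wv \<in> space (PiM {..<n} (\<lambda>_. lam0)). eq_emp n wv \<in> B}"
proof -
  let ?R = "\<lambda>\<omega>. restrict (\<lambda>k. W k \<omega>) {..<n}"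
  have "measure (distr Pr (PiM {..<n} (\<lambda>_. borel)) ?R) {wv \<in> space (PiM {..<n} (\<lambda>_. lam0)). eq_emp n wv \<in> B}
      = Pr.prob (?R -` {wv \<in> space (PiM {..<n} (\<lambda>_. lam0)). eq_emp n wv \<in> B} \<inter> space Pr)"
    using eq_emp_sets[OF n lam0 B] sets_PiM_probs[OF lam0, of "{..<n}"]
    by (intro measure_distr sample_measurable) auto
  also have "?R -` {wv \<in> space (PiM {..<n} (\<lambda>_. lam0)). eq_emp n wv \<in> B} \<inter> space Pr = event n B"
    using measurable_space[OF sample_measurable, of _ n] sets_eq_imp_space_eq[OF sets_PiM_probs[OF lam0, of "{..<n}"]]
    by (auto simp: mu_eq[OF n])
  finally show ?thesis unfolding sample_law[OF n] by simp
qed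

text \<open>On equilibria in \<open>B\<close> the entropy exceeds the rate, so the upper bound beats
  the lower bound for the interior of \<open>A\<close>. Stating it for arbitrary closed
  \<open>B\<close> and as a product instead of a quotient makes it serve both the metric estimate
  and the integrals of test functions.\<close>

theorem concentration:
  assumes I: "rate_cl F C lam0 A < \<infinity>" "rate_cl F C lam0 A = rate_int F C lam0 A"
    and B: "closedin (weak_top euclidean) B" "B \<subseteq> weak_top euclidean closure_of A" "B \<inter> minset F C lam0 A = {}"
  obtains c where "0 < c" "\<forall>\<^sub>F n in sequentially. Pr.prob (event n B) \<le> exp (- c * real n) * Pr.prob (event n A)"
proof -
  obtain I' where I': "rate_cl F C lam0 A = ereal I'" "0 \<le> I'"
    using rate_cl_nonneg[OF lam0, of A] I(1) by (cases "rate_cl F C lam0 A") auto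
  obtain c where c: "I' < c" and up: "\<forall>\<^sub>F n in sequentially.
    measure (PiM {..<n} (\<lambda>_. lam0)) {wv \<in> space (PiM {..<n} (\<lambda>_. lam0)). eq_emp n wv \<in> B} \<le> exp (- c * real n)"
  proof (rule upper_bound[OF lam0 I'(2) B(1)])
    fix m assume m: "m \<in> B" "m \<in> MFE_all F C"
    then have "m \<notin> minset F C lam0 A" using B(3) by blast
    then show "\<not> relent lam0 (distr m borel fst) \<le> ereal I'"
      using m B(2) by (auto simp: minset_eq[OF I'(1)] MFE_all_iff)
  qed blast
  \<comment> \<open>Of the gap between the two exponents one third goes to the choice of a nearly
    optimal \<open>lam\<close>, one third is lost in \<open>lower_bound\<close>, and the last is the
    rate obtained.\<close>
  define \<delta> where "\<delta> = (c - I') / 3"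
  have \<delta>: "0 < \<delta>" "c = I' + 3 * \<delta>" using c by (simp_all add: \<delta>_def field_simps)
  have "rate_int F C lam0 A = ereal I'" using I(2) I'(1) by metis
  then have "rate_int F C lam0 A < ereal (I' + \<delta>)" using \<delta>(1) by simp
  then obtain lam where lam: "lam \<in> probs_on euclidean" "MFE F C lam \<subseteq> weak_top euclidean interior_of A"
    "relent lam0 lam < ereal (I' + \<delta>)"
    unfolding rate_int_def INF_less_iff by auto
  have low: "\<forall>\<^sub>F n in sequentially. exp (- (I' + \<delta> + \<delta>) * real n)
    \<le> measure (PiM {..<n} (\<lambda>_. lam0)) {wv \<in> space (PiM {..<n} (\<lambda>_. lam0)). eq_emp n wv \<in> weak_top euclidean interior_of A}"
    using lam(3) by (intro lower_bound[OF lam0 lam(1) _ openin_interior_of lam(2) \<delta>(1)]) simp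
  have "\<forall>\<^sub>F n in sequentially. Pr.prob (event n B) \<le> exp (- \<delta> * real n) * Pr.prob (event n A)"
    using up low eventually_gt_at_top[of 0]
  proof eventually_elim
    case (elim n)
    have "Pr.prob (event n B) \<le> exp (- c * real n)"
      using elim(1,3) prob_event[OF _ closedin_borel_of[OF B(1)]] by simp
    also have "\<dots> = exp (- \<delta> * real n) * exp (- (I' + \<delta> + \<delta>) * real n)"
      unfolding \<delta>(2) by (simp add: exp_add[symmetric] algebra_simps)
    also have "exp (- (I' + \<delta> + \<delta>) * real n) \<le> Pr.prob (event n (weak_top euclidean interior_of A))"
      using elim(2,3) prob_event[OF _ openin_borel_of[OF openin_interior_of]] by simp
    also have "\<dots> \<le> Pr.prob (event n A)"
      using interior_of_subset[of "weak_top euclidean" A] event_sets[OF _ A_meas] elim(3)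
      by (intro Pr.finite_measure_mono) auto
    finally show ?case by simp
  qed
  then show ?thesis using \<delta>(1) that by blast
qed

text \<open>The set \<open>B\<close> is the closure of \<open>A\<close> without the open
  \<epsilon>-balls about the minimizers; a point at distance at least \<epsilon> from all of these
  lies outside every ball.\<close>

lemma concentration_metric:
  assumes I: "rate_cl F C lam0 A < \<infinity>" "rate_cl F C lam0 A = rate_int F C lam0 A"
    and d: "Metric_space (probs_on euclidean) d" "Metric_space.mtopology (probs_on euclidean) d = weak_top euclidean"
    and \<epsilon>: "0 < \<epsilon>"
  shows "\<exists>c>0. \<forall>\<^sub>F n in sequentially.
     Pr.prob {\<omega> \<in> space Pr. \<mu> n \<omega> \<in> A \<and> (INF m\<in>minset F C lam0 A. d (\<mu> n \<omega>) m) \<ge> \<epsilon>} / Pr.prob (event n A)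
       \<le> exp (- c * real n)"
proof -
  interpret d: Metric_space "probs_on euclidean" d by fact
  define V where "V = (\<Union>s\<in>minset F C lam0 A. d.mball s \<epsilon>)"
  have V: "openin (weak_top euclidean) V"
    unfolding V_def d(2)[symmetric] by (intro openin_Union) (auto intro: d.openin_mball)
  define B where "B = (weak_top euclidean closure_of A) - V"
  have Bc: "closedin (weak_top euclidean) B" unfolding B_def by (intro closedin_diff closedin_closure_of V)
  have "minset F C lam0 A \<subseteq> V"
    using \<epsilon> d.centre_in_mball_iff by (auto simp: V_def minset_def MFE_all_iff)
  then obtain c where c: "0 < c" "\<forall>\<^sub>F n in sequentially. Pr.prob (event n B) \<le> exp (- c * real n) * Pr.prob (event n A)"
    using concentration[OF I Bc] unfolding B_def by blast
  have "\<forall>\<^sub>F n in sequentially.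
     Pr.prob {\<omega> \<in> space Pr. \<mu> n \<omega> \<in> A \<and> (INF m\<in>minset F C lam0 A. d (\<mu> n \<omega>) m) \<ge> \<epsilon>} / Pr.prob (event n A)
       \<le> exp (- c * real n)"
    using c(2) eventually_gt_at_top[of 0]
  proof eventually_elim
    case (elim n)
    have "{\<omega> \<in> space Pr. \<mu> n \<omega> \<in> A \<and> (INF m\<in>minset F C lam0 A. d (\<mu> n \<omega>) m) \<ge> \<epsilon>} \<subseteq> event n B"
    proof safe
      fix \<omega> assume \<omega>: "\<omega> \<in> space Pr" "\<mu> n \<omega> \<in> A" "\<epsilon> \<le> (INF m\<in>minset F C lam0 A. d (\<mu> n \<omega>) m)"
      have "\<mu> n \<omega> \<notin> V"
      proof
        assume "\<mu> n \<omega> \<in> V"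
        then obtain s where s: "s \<in> minset F C lam0 A" "d s (\<mu> n \<omega>) < \<epsilon>" by (auto simp: V_def)
        have "(INF m\<in>minset F C lam0 A. d (\<mu> n \<omega>) m) \<le> d (\<mu> n \<omega>) s"
          by (rule cINF_lower[OF _ s(1)]) (auto intro!: bdd_belowI2[where m = 0])
        then show False using \<omega>(3) s(2) d.commute[of s "\<mu> n \<omega>"] by simp
      qed
      moreover have "\<mu> n \<omega> \<in> weak_top euclidean closure_of A"
        using \<omega>(2) closure_of_subset[of A "weak_top euclidean"] A_sub by auto
      ultimately show "\<mu> n \<omega> \<in> B" by (simp add: B_def)
    qed
    then have "Pr.prob {\<omega> \<in> space Pr. \<mu> n \<omega> \<in> A \<and> (INF m\<in>minset F C lam0 A. d (\<mu> n \<omega>) m) \<ge> \<epsilon>} \<le> Pr.prob (event n B)"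
      using event_sets[OF elim(2) closedin_borel_of[OF Bc]]
      by (intro measure_mono_superset) (auto simp: Pr.finite_measure_axioms)
    also note elim(1)
    \<comment> \<open>Division by 0 yields 0, so the bound also holds when \<open>A\<close> has
      probability 0.\<close>
    finally show ?case
      by (cases "Pr.prob (event n A) = 0") (auto simp: pos_divide_le_eq zero_less_measure_iff)
  qed
  then show ?thesis using c(1) by blast
qed

section \<open>Conditional laws of the empirical measure\<close>

abbreviation "claw n \<equiv> cond_law Pr (weak_top euclidean) (\<mu> n) (event n A)"

lemma cond_law_probs:
  assumes "n > 0" "0 < Pr.prob (event n A)"
  shows "claw n \<in> probs_on (weak_top euclidean)"
proof -
  have e: "emeasure Pr (event n A) \<noteq> 0" "emeasure Pr (event n A) \<noteq> \<infinity>"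
    using assms(2) by (auto simp: Pr.emeasure_eq_measure)
  interpret u: prob_space "uniform_measure Pr (event n A)" by (rule prob_space_uniform_measure[OF e])
  have "\<mu> n \<in> measurable (uniform_measure Pr (event n A)) (borel_of (weak_top euclidean))"
    using mu_measurable[OF assms(1)] by simp
  then show ?thesis unfolding cond_law_def probs_on_def using u.prob_space_distr by simp
qed

lemma measure_cond_law:
  assumes "n > 0" "0 < Pr.prob (event n A)" "S \<in> sets (borel_of (weak_top euclidean))"
  shows "measure (claw n) S = Pr.prob (event n (S \<inter> A)) / Pr.prob (event n A)"
proof -
  have e: "emeasure Pr (event n A) \<noteq> 0" "emeasure Pr (event n A) \<noteq> \<infinity>"
    using assms(2) by (auto simp: Pr.emeasure_eq_measure)
  have m: "\<mu> n \<in> measurable (uniform_measure Pr (event n A)) (borel_of (weak_top euclidean))"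
    using mu_measurable[OF assms(1)] by simp
  have "measure (claw n) S = measure (uniform_measure Pr (event n A)) (\<mu> n -` S \<inter> space Pr)"
    unfolding cond_law_def using measure_distr[OF m assms(3)] by simp
  also have "\<dots> = Pr.prob (event n A \<inter> (\<mu> n -` S \<inter> space Pr)) / Pr.prob (event n A)"
    using measurable_sets[OF mu_measurable[OF assms(1)] assms(3)] by (intro measure_uniform_measure e)
  also have "event n A \<inter> (\<mu> n -` S \<inter> space Pr) = event n (S \<inter> A)" by auto
  finally show ?thesis .
qed

text \<open>Test functions vanishing on the minimizers take over the role of the metric: the part of
  the closure of \<open>A\<close> where \<open>g\<close> is at least \<open>\<delta> / 2\<close> is
  a closed set to which \<open>concentration\<close> applies, so it contributes at most
  \<open>K * exp (- c * n)\<close> to the integral.\<close>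

lemma cond_law_integral_small:
  assumes I: "rate_cl F C lam0 A < \<infinity>" "rate_cl F C lam0 A = rate_int F C lam0 A"
    and pos: "\<forall>\<^sub>F n in sequentially. 0 < Pr.prob (event n A)"
    and g: "g \<in> bcont (weak_top euclidean)" "\<And>m. m \<in> minset F C lam0 A \<Longrightarrow> g m = 0" and \<delta>: "0 < \<delta>"
  shows "\<forall>\<^sub>F n in sequentially. (\<integral>m. g m \<partial>claw n) < \<delta>"
proof -
  define B where "B = (weak_top euclidean closure_of A) \<inter> {m \<in> topspace (weak_top euclidean). g m \<in> {\<delta> / 2..}}"
  have "closedin (weak_top euclidean) {m \<in> topspace (weak_top euclidean). g m \<in> {\<delta> / 2..}}"
    using g(1) by (intro closedin_continuous_map_preimage) (auto simp: bcont_def)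
  then have Bc: "closedin (weak_top euclidean) B" unfolding B_def by (intro closedin_Int closedin_closure_of)
  have "B \<inter> minset F C lam0 A = {}" using g(2) \<delta> by (auto simp: B_def)
  then obtain c where c: "0 < c" "\<forall>\<^sub>F n in sequentially. Pr.prob (event n B) \<le> exp (- c * real n) * Pr.prob (event n A)"
    using concentration[OF I Bc] unfolding B_def by blast
  obtain K where K: "K > 0" "\<And>m. m \<in> probs_on euclidean \<Longrightarrow> \<bar>g m\<bar> \<le> K" using bcont_bounded[OF g(1)] by auto
  define S where "S = {m \<in> topspace (weak_top euclidean). g m \<in> {\<delta> / 2..}}"
  have Ss: "S \<in> sets (borel_of (weak_top euclidean))"
    unfolding S_def using g(1) by (intro closedin_borel_of closedin_continuous_map_preimage) (auto simp: bcont_def)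
  have "(\<lambda>n. \<delta> / 2 + K * exp (- c * real n)) \<longlonglongrightarrow> \<delta> / 2 + K * 0"
    by (intro tendsto_intros exp_linear_decay c(1))
  then have "\<forall>\<^sub>F n in sequentially. \<delta> / 2 + K * exp (- c * real n) < \<delta>"
    by (rule order_tendstoD(2)) (use \<delta> in simp)
  then show ?thesis using c(2) pos eventually_gt_at_top[of 0]
  proof eventually_elim
    case (elim n)
    have P: "claw n \<in> probs_on (weak_top euclidean)" by (rule cond_law_probs[OF elim(4,3)])
    interpret cl: prob_space "claw n" using P by (simp add: probs_on_def)
    have scl: "sets (claw n) = sets (borel_of (weak_top euclidean))" using P by (simp add: probs_on_def)
    have spc: "space (claw n) = probs_on euclidean" using sets_eq_imp_space_eq[OF scl] by simp
    have Sc: "S \<in> sets (claw n)" using Ss scl by simp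
    have "cl.prob S = Pr.prob (event n (S \<inter> A)) / Pr.prob (event n A)" by (rule measure_cond_law[OF elim(4,3) Ss])
    also have "\<dots> \<le> Pr.prob (event n B) / Pr.prob (event n A)"
    proof (intro divide_right_mono measure_mono_superset)
      show "event n (S \<inter> A) \<subseteq> event n B"
        using closure_of_subset[of A "weak_top euclidean"] A_sub by (auto simp: B_def S_def)
    qed (use event_sets[OF elim(4) closedin_borel_of[OF Bc]] Pr.finite_measure_axioms in auto)
    also have "\<dots> \<le> exp (- c * real n)" using elim(2,3) by (simp add: pos_divide_le_eq)
    finally have S: "cl.prob S \<le> exp (- c * real n)" .
    have "(\<integral>m. g m \<partial>claw n) \<le> (\<integral>m. \<delta> / 2 + K * indicator S m \<partial>claw n)"
    proof (rule integral_mono)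
      show "integrable (claw n) g" by (rule bcont_integrable[OF g(1) P])
      show "integrable (claw n) (\<lambda>m. \<delta> / 2 + K * indicator S m)" using Sc by (auto simp: less_top[symmetric])
      fix m assume "m \<in> space (claw n)"
      then have "m \<in> probs_on euclidean" using spc by simp
      then show "g m \<le> \<delta> / 2 + K * indicator S m" using K(2)[of m] \<delta> by (auto simp: S_def indicator_def abs_le_iff)
    qed
    also have "\<dots> = \<delta> / 2 + K * cl.prob S" using Sc by (simp add: less_top[symmetric] cl.prob_space)
    also have "\<dots> \<le> \<delta> / 2 + K * exp (- c * real n)" using S K(1) by (intro add_left_mono mult_left_mono) auto
    finally show ?case using elim(1) by linarith
  qed
qed

text \<open>The conditional laws may give no mass to the minimizer set itself, so its mass under
  \<open>Q\<close> is read off a nonnegative continuous function with exactly this zero set: its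
  integrals tend to 0, hence it vanishes \<open>Q\<close>-almost everywhere.\<close>

lemma limit_point_support:
  assumes I: "rate_cl F C lam0 A < \<infinity>" "rate_cl F C lam0 A = rate_int F C lam0 A"
    and pos: "\<forall>\<^sub>F n in sequentially. 0 < Pr.prob (event n A)"
    and r: "strict_mono (r :: nat \<Rightarrow> nat)"
    and lim: "limitin (weak_top (weak_top euclidean)) (\<lambda>k. claw (r k)) Q sequentially"
  shows "measure Q (minset F C lam0 A) = 1"
proof -
  obtain I' where I': "rate_cl F C lam0 A = ereal I'" "0 \<le> I'"
    using rate_cl_nonneg[OF lam0, of A] I(1) by (cases "rate_cl F C lam0 A") auto
  have QP: "Q \<in> probs_on (weak_top euclidean)" using lim by (simp add: limitin_def)
  interpret Q: prob_space Q using QP by (simp add: probs_on_def)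
  have sQ: "sets Q = sets (borel_of (weak_top euclidean))" using QP by (simp add: probs_on_def)
  have spQ: "space Q = probs_on euclidean" using sets_eq_imp_space_eq[OF sQ] by simp
  obtain f where f: "f \<in> bcont (weak_top euclidean)" "\<And>m. 0 \<le> f m"
    "\<And>m. m \<in> probs_on euclidean \<Longrightarrow> f m = 0 \<longleftrightarrow> m \<in> minset F C lam0 A"
    using zero_set_function[OF compactin_minset[OF lam0 I'(1)] minset_nonempty[OF lam0 I'(1)]] by metis
  have f0: "f m = 0" if "m \<in> minset F C lam0 A" for m
    using that f(3)[of m] by (auto simp: minset_def MFE_all_iff)
  have fl: "(\<lambda>k. \<integral>m. f m \<partial>claw (r k)) \<longlonglongrightarrow> (\<integral>m. f m \<partial>Q)"
    using continuous_map_limit[OF continuous_map_integral[OF f(1)] lim] by (simp add: comp_def)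
  have "(\<integral>m. f m \<partial>Q) \<le> 0 + \<delta>" if "0 < \<delta>" for \<delta>
  proof -
    have "\<forall>\<^sub>F k in sequentially. (\<integral>m. f m \<partial>claw (r k)) < \<delta>"
      using eventually_subseq[OF r cond_law_integral_small[OF I pos f(1) f0 that]] by simp
    then have "\<forall>\<^sub>F k in sequentially. (\<integral>m. f m \<partial>claw (r k)) \<le> \<delta>" by eventually_elim simp
    then show ?thesis using tendsto_upperbound[OF fl] by simp
  qed
  then have "(\<integral>m. f m \<partial>Q) \<le> 0" by (rule field_le_epsilon)
  then have "(\<integral>m. f m \<partial>Q) = 0" using f(2) by (intro antisym integral_nonneg_AE) auto
  then have "AE m in Q. f m = 0"
    using integral_nonneg_eq_0_iff_AE[OF bcont_integrable[OF f(1) QP]] f(2) by simp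
  then have "AE m in Q. m \<in> minset F C lam0 A"
    using AE_space by eventually_elim (use f(3) spQ in auto)
  moreover have "minset F C lam0 A \<in> sets Q"
    using closedin_borel_of[OF closedin_minset[OF lam0 I'(1)]] sQ by simp
  ultimately show ?thesis using Q.prob_eq_1 by simp
qed

text \<open>For each of the finitely many test functions \<open>f\<close> that define a
  neighbourhood of the point mass, the deviation \<open>\<bar>f m - f \<nu>\<bar>\<close> vanishes
  on the only minimizer, so its conditional mean becomes small.\<close>

lemma singleton_limit:
  assumes I: "rate_cl F C lam0 A < \<infinity>" "rate_cl F C lam0 A = rate_int F C lam0 A"
    and pos: "\<forall>\<^sub>F n in sequentially. 0 < Pr.prob (event n A)"
    and \<nu>: "minset F C lam0 A = {\<nu>}"
  shows "limitin (weak_top (weak_top euclidean)) claw (return (borel_of (weak_top euclidean)) \<nu>) sequentially"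
proof -
  have \<nu>P: "\<nu> \<in> probs_on euclidean" using \<nu> by (auto simp: minset_def MFE_all_iff)
  define R where "R = return (borel_of (weak_top euclidean)) \<nu>"
  have RP: "R \<in> probs_on (weak_top euclidean)"
    unfolding R_def probs_on_def using \<nu>P by (auto intro: prob_space_return)
  show ?thesis
    unfolding limitin_def R_def[symmetric]
  proof (intro conjI allI impI)
    show "R \<in> topspace (weak_top (weak_top euclidean))" using RP by simp
    fix U assume "openin (weak_top (weak_top euclidean)) U \<and> R \<in> U"
    then obtain J \<epsilon> where J: "finite J" "J \<subseteq> bcont (weak_top euclidean)" "\<epsilon> > 0"
      and JU: "\<And>m'. m' \<in> probs_on (weak_top euclidean) \<Longrightarrow>
        (\<And>f. f \<in> J \<Longrightarrow> \<bar>(\<integral>x. f x \<partial>m') - (\<integral>x. f x \<partial>R)\<bar> < \<epsilon>) \<Longrightarrow> m' \<in> U"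
      using weak_top_nbhd[of "weak_top euclidean" U R] by metis
    have gb: "(\<lambda>m. \<bar>f m - f \<nu>\<bar>) \<in> bcont (weak_top euclidean)" if f: "f \<in> bcont (weak_top euclidean)" for f
    proof -
      have "continuous_map (weak_top euclidean) euclideanreal (\<lambda>m. \<bar>f m - f \<nu>\<bar>)"
        using f by (intro continuous_map_real_abs continuous_map_diff) (auto simp: bcont_def)
      moreover obtain K where K: "\<And>m. m \<in> probs_on euclidean \<Longrightarrow> \<bar>f m\<bar> \<le> K" using bcont_bounded[OF f] by auto
      have "\<bar>f m - f \<nu>\<bar> \<le> 2 * K" if "m \<in> probs_on euclidean" for m using K[OF that] K[OF \<nu>P] by linarith
      ultimately show ?thesis by (auto simp: bcont_def bounded_iff)
    qed
    have "\<forall>\<^sub>F n in sequentially. \<forall>f\<in>J. (\<integral>m. \<bar>f m - f \<nu>\<bar> \<partial>claw n) < \<epsilon>"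
      using J gb by (intro eventually_ball_finite ballI cond_law_integral_small[OF I pos]) (auto simp: \<nu>)
    then show "\<forall>\<^sub>F n in sequentially. claw n \<in> U"
      using pos eventually_gt_at_top[of 0]
    proof eventually_elim
      case (elim n)
      have P: "claw n \<in> probs_on (weak_top euclidean)" by (rule cond_law_probs[OF elim(3,2)])
      interpret cl: prob_space "claw n" using P by (simp add: probs_on_def)
      show ?case
      proof (rule JU[OF P])
        fix f assume f: "f \<in> J"
        then have fb: "f \<in> bcont (weak_top euclidean)" using J(2) by auto
        have fi: "integrable (claw n) f" by (rule bcont_integrable[OF fb P])
        have "(\<integral>x. f x \<partial>R) = f \<nu>"
          unfolding R_def using \<nu>P bcont_borel_measurable[OF fb refl] by (intro integral_return) auto
        moreover have "\<bar>(\<integral>x. f x \<partial>claw n) - f \<nu>\<bar> \<le> (\<integral>m. \<bar>f m - f \<nu>\<bar> \<partial>claw n)"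
          using integral_abs_bound[of "claw n" "\<lambda>m. f m - f \<nu>"] fi by (simp add: cl.prob_space)
        ultimately show "\<bar>(\<integral>x. f x \<partial>claw n) - (\<integral>x. f x \<partial>R)\<bar> < \<epsilon>" using elim(1) f by force
      qed
    qed
  qed
qed

end

theorem theorem2p5:
  fixes F :: "('w::polish_space \<times> 'x::metric_space) measure \<Rightarrow> 'w \<Rightarrow> 'x \<Rightarrow> real"
    and C :: "'w \<Rightarrow> 'x set"
    and lam0 :: "'w measure"
    and Pr :: "'o measure"
    and W :: "nat \<Rightarrow> 'o \<Rightarrow> 'w"
    and xh :: "nat \<Rightarrow> nat \<Rightarrow> (nat \<Rightarrow> 'w) \<Rightarrow> 'x"
    and A :: "('w \<times> 'x) measure set"
  assumes X_compact: "compact (UNIV :: 'x set)"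
    and C_ne_closed: "\<forall>w. C w \<noteq> {} \<and> closed (C w)"
    and C_graph: "closed {(w, x). x \<in> C w}"
    and C_lower: "\<forall>ws w x. ws \<longlonglongrightarrow> w \<and> x \<in> C w \<longrightarrow>
                    (\<exists>r xs. strict_mono r \<and> (\<forall>k. xs k \<in> C (ws (r k))) \<and> xs \<longlonglongrightarrow> x)"
    and F_cont: "continuous_map (prod_topology (weak_top euclidean) (prod_topology euclidean euclidean))
                   euclideanreal (\<lambda>(m, w, x). F m w x)"
    and F_bdd: "\<exists>B. \<forall>m\<in>probs_on euclidean. \<forall>w x. \<bar>F m w x\<bar> \<le> B"
    and eq_exist: "\<forall>n w. \<exists>x. nash F C n w x"
    and lam0: "lam0 \<in> probs_on euclidean"
    and Pr: "prob_space Pr"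
    and W_meas: "\<forall>i. W i \<in> measurable Pr borel"
    and W_indep: "prob_space.indep_vars Pr (\<lambda>_. borel) W UNIV"
    and W_law: "\<forall>i. distr Pr borel (W i) = lam0"
    and xh_meas: "\<forall>n. \<forall>i<n. xh n i \<in> borel_measurable (PiM {..<n} (\<lambda>_. borel))"
    and xh_nash: "\<forall>n. \<forall>wv\<in>space (PiM {..<n} (\<lambda>_. borel)). nash F C n wv (\<lambda>i. xh n i wv)"
    and A_sub: "A \<subseteq> probs_on euclidean"
    and A_meas: "A \<in> sets (borel_of (weak_top euclidean))"
  shows
   "(rate_cl F C lam0 A < \<infinity> \<longrightarrow>
       minset F C lam0 A \<noteq> {} \<and> compactin (weak_top euclidean) (minset F C lam0 A))
  \<and> (rate_cl F C lam0 A < \<infinity> \<and> rate_cl F C lam0 A = rate_int F C lam0 A \<and>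
       (\<forall>\<^sub>F n in sequentially. measure Pr {\<omega>\<in>space Pr. mu_n W xh n \<omega> \<in> A} > 0) \<longrightarrow>
       (\<forall>d. Metric_space (probs_on euclidean) d \<and>
            Metric_space.mtopology (probs_on euclidean) d = weak_top euclidean \<longrightarrow>
          (\<forall>\<epsilon>>0. \<exists>c>0. \<forall>\<^sub>F n in sequentially.
             measure Pr {\<omega>\<in>space Pr. mu_n W xh n \<omega> \<in> A \<and>
                 (INF m\<in>minset F C lam0 A. d (mu_n W xh n \<omega>) m) \<ge> \<epsilon>}
               / measure Pr {\<omega>\<in>space Pr. mu_n W xh n \<omega> \<in> A}
             \<le> exp (- c * real n)))
     \<and> (\<forall>Q r. strict_mono r \<and>
          limitin (weak_top (weak_top euclidean))
            (\<lambda>k. cond_law Pr (weak_top euclidean) (mu_n W xh (r k))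
                    {\<omega>\<in>space Pr. mu_n W xh (r k) \<omega> \<in> A}) Q sequentially
          \<longrightarrow> measure Q (minset F C lam0 A) = 1)
     \<and> (\<forall>\<nu>. minset F C lam0 A = {\<nu>} \<longrightarrow>
          limitin (weak_top (weak_top euclidean))
            (\<lambda>n. cond_law Pr (weak_top euclidean) (mu_n W xh n)
                    {\<omega>\<in>space Pr. mu_n W xh n \<omega> \<in> A})
            (return (borel_of (weak_top euclidean)) \<nu>) sequentially))
  \<and> ((\<forall>lam\<in>probs_on euclidean. absolutely_continuous lam0 lam \<longrightarrow> (\<exists>m. MFE F C lam = {m})) \<longrightarrow>
       (rate_cl F C lam0 A = rate_int F C lam0 A \<longleftrightarrow>
          rate_cl F C lam0 A = (INF m\<in>(weak_top euclidean closure_of A) \<inter> MFE_all F C.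
                                   relent lam0 (distr m borel fst)) \<and>
          rate_cl F C lam0 A = (INF m\<in>(weak_top euclidean interior_of A) \<inter> MFE_all F C.
                                   relent lam0 (distr m borel fst))))"
proof -
  interpret Pr: prob_space Pr by (rule Pr)
  interpret nash_sampling F C xh lam0 Pr W A
  proof unfold_locales
    show "compact (UNIV :: 'x set)" by (rule X_compact)
    show "closed {(w, x). x \<in> C w}" by (rule C_graph)
    show "C w \<noteq> {}" for w using C_ne_closed by simp
    show "\<exists>r xs. strict_mono (r :: nat \<Rightarrow> nat) \<and> (\<forall>k. xs k \<in> C (ws (r k))) \<and> xs \<longlonglongrightarrow> x"
      if "ws \<longlonglongrightarrow> w" "x \<in> C w" for ws w x
      using C_lower that by simp
    show "xh n i \<in> borel_measurable (PiM {..<n} (\<lambda>_. borel))" if "i < n" for n i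
      using xh_meas that by simp
    show "nash F C n wv (\<lambda>i. xh n i wv)" if "wv \<in> space (PiM {..<n} (\<lambda>_. borel))" for n wv
      using xh_nash that by simp
    show "W i \<in> measurable Pr borel" for i using W_meas by simp
    show "distr Pr borel (W i) = lam0" for i using W_law by simp
  qed (fact F_cont F_bdd lam0 W_indep A_sub A_meas)+
  \<comment> \<open>Nonnegativity excludes -\<infinity>, so a finite rate is a real number, as the
    lemmas on \<open>minset\<close> require.\<close>
  have real: "\<exists>I. rate_cl F C lam0 A = ereal I" if "rate_cl F C lam0 A < \<infinity>"
    using rate_cl_nonneg[OF lam0, of A] that by (cases "rate_cl F C lam0 A") auto
  show ?thesis
  proof (intro conjI impI, goal_cases)
    case 1
    then show ?case using real minset_nonempty[OF lam0] by blast
  next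
    case 2
    then show ?case using real compactin_minset[OF lam0] by blast
  next
    case 3
    then show ?case using concentration_metric by blast
  next
    case 4
    then show ?case using limit_point_support by blast
  next
    case 5
    then show ?case using singleton_limit by blast
  next
    \<comment> \<open>The equality with the infimum over the closure always holds, by
      \<open>rate_cl_eq\<close>; the equivalence thus reduces to rewriting
      \<open>rate_int\<close>.\<close>
    case 6
    then have "rate_int F C lam0 A = (INF m\<in>(weak_top euclidean interior_of A) \<inter> MFE_all F C. relent lam0 (distr m borel fst))"
      by (intro rate_int_eq) blast
    then show ?case using rate_cl_eq[of lam0 A] by simp
  qed
qed

end
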